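(* The value functional $\rho$ is a viscosity solution (in the sense defined in the context) of the Hamilton--Jacobi equation $$\partial_t^{ci}\varphi(t,w)+H\bigl(t,z,w(-\tau(t,z)),\nabla^{ci}\varphi(t,w)\bigr)=0,\qquad t<T,\ z=w(0),$$ with the terminal condition $\varphi(T,w)=g(w(0),w)$ for $w\in\operatorname{Lip}([-\bar\tau,0];\mathbb R^n)$.
   Context: Setting. Let $t_0<T$, $I=[t_0,T]$, $n,m\ge 1$; $A\subset\mathbb R^m$ is nonempty, convex and compact. $\|\cdot\|$ is the Euclidean norm on $\mathbb R^n$; $\|\cdot\|_1,\|\cdot\|_\infty$ are the usual $L^1,L^\infty$ norms for functions on $[-\bar\tau,0]$ (with $\bar\tau$ introduced in (7) below). $\mathbb G:=I\times\operatorname{Lip}([-\bar\tau,0];\mathbb R^n)$. For $t_0\le t<s\le T$, $\mathcal A_{t,s}$ is the set of measurable functions $\alpha:(t,s)\to A$. For $R>0$: $P(R)=\{w\in\operatorname{Lip}([-\bar\tau,0];\mathbb R^n):\|w\|_\infty\le R\}$, $V(R)=\{w\in P(R):\|\dot w\|_\infty\le R\}$, $B_R=\{x\in\mathbb R^n:\|x\|\le R\}$. $\mathcal X=\{(z,w):w\in\operatorname{Lip}([-\bar\tau,0];\mathbb R^n),\ z=w(0)\}$ with norm $\|(z,w)\|_{\mathcal X}=\|z\|+\|w\|_1$. Standing assumptions. (1) $f:I\times\mathbb R^n\times\mathbb R^n\times A\to\mathbb R^n$ and $L:I\times\mathbb R^n\times\mathbb R^n\times A\to\mathbb R$ are continuous.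 (2) There is $\lambda_f>0$ with $\|f(t,z,y,a)-f(t,z',y',a)\|\le\lambda_f(\|z-z'\|+\|y-y'\|)$ for all arguments, and hence $\|f(t,z,y,a)\|\le C_f(1+\|z\|+\|y\|)$ for some fixed $C_f>0$. (3) For every $(t,z,y)$ the set $\{(f(t,z,y,a),\ell)\in\mathbb R^n\times\mathbb R:a\in A,\ \ell\ge L(t,z,y,a)\}$ is convex. (4) For every $R>0$ there is $\lambda_L(R)>0$ with $|L(t,z,y,a)-L(t,z',y',a)|\le\lambda_L(R)(\|z-z'\|+\|y-y'\|)$ for $t\in I$, $a\in A$, $z,y,z',y'\in B_R$. (5) There is $C_L>0$ with $|L(t,z,y,a)|\le C_L(1+\|z\|+\|y\|)$ for all arguments. (6) $g:\mathcal X\to\mathbb R$ and for every $R>0$ there is $\lambda_g(R)>0$ with $|g(z_1,w_1)-g(z_2,w_2)|\le\lambda_g(R)\|(z_1,w_1)-(z_2,w_2)\|_{\mathcal X}$ for all $(z_i,w_i)\in\mathcal X$ with $w_i\in P(R)$. (7) $\tau:I\times\mathbb R^n\to[0,\infty)$ is $C^1$ with supremum $\bar\tau<\infty$, and there is $\lambda_\tau>0$ with $|\tau(t,z)-\tau(t,y)|\le\lambda_\tau\|z-y\|$ for all $t\in I$, $z,y\in\mathbb R^n$. State equation. For $(t,w)\in\mathbb G$ and $\alpha\in\mathcal A_{t,T}$, $x(\cdot\,|\,t,w,\alpha)$ denotes the unique Lipschitz $x:[t-\bar\tau,T]\to\mathbb R^n$ with $\dot x(s)=f(s,x(s),x(s-\tau(s,x(s))),\alpha(s))$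 for a.e. $s\in(t,T)$ and $x(t+\theta)=w(\theta)$ for $\theta\in[-\bar\tau,0]$ (it exists and is unique under (1)-(7)). Write $x_s(\theta)=x(s+\theta)$, $\theta\in[-\bar\tau,0]$. (8) (Monotone delay) For every $r>0$ there is $d(r)>0$ such that for every such solution with $t\in I$, $w\in P(r)$, $\alpha\in\mathcal A_{t,T}$: $1-\tau_t(s,x(s))-\tau_z(s,x(s))\cdot\dot x(s)\ge d(r)$ for a.e. $s\in[t,T]$. Cost and value. $J(t,w,\alpha)=\int_t^TL(s,x(s),x(s-\tau(s,x(s))),\alpha(s))\,ds+g(x(T),x_T)$ with $x=x(\cdot\,|\,t,w,\alpha)$, and $\rho(t,w)=\inf_{\alpha\in\mathcal A_{t,T}}J(t,w,\alpha)$; for $t=T$ this means $\rho(T,w)=g(w(0),w)$. Hamiltonian. $H(t,z,y,p)=\min_{a\in A}\{f(t,z,y,a)\cdot p+L(t,z,y,a)\}$. Co-invariant derivatives (only used to write the equation formally). $\varphi:\mathbb G\to\mathbb R$ is co-invariantly differentiable at $(t,w)$ with derivatives $\partial^{ci}_t\varphi(t,w)\in\mathbb R$, $\nabla^{ci}\varphi(t,w)\in\mathbb R^n$ if for every Lipschitz $y:[t-\bar\tau,\infty)\to\mathbb R^n$ with $y_t=w$ and $s\in(t,T]$, $\varphi(s,y_s)-\varphi(t,w)=\partial^{ci}_t\varphi(t,w)(s-t)+\nabla^{ci}\varphi(t,w)\cdot(y(s)-y(t))+o(s-t)$, with $o(\cdot)$ possibly depending on $y$. Polygonal extension and projection. For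 $(t,w)\in\mathbb G$, $z=w(0)$, $s\in(t,T]$, $x\in\mathbb R^n$, let $v=v^{s,x}$ be: $v(\xi)=w(\xi-t)$ for $\xi\in[t-\bar\tau,t)$; $v(\xi)=z+\frac{x-z}{s-t}(\xi-t)$ for $\xi\in[t,s]$; $v(\xi)=x$ for $\xi>s$. For $\varphi:\mathbb G\to\mathbb R$, the projection with base point $(t,w)$ is $\bar\varphi(s,x)=\varphi(s,v_s)$ for $(s,x)\in(t,T]\times\mathbb R^n$, where $v_s(\theta)=v(s+\theta)$, and $\bar\varphi(t,z)=\varphi(t,w)$. Cone: $K(a,b,z,C)=\{(s,x)\in[a,b]\times\mathbb R^n:\|x-z\|\le C(s-a)\}$. Class $\Phi$: functionals $\varphi:\mathbb G\to\mathbb R$ such that for every $R>0$ there is $\lambda_\varphi(R)>0$ with $|\varphi(t_1,w_1)-\varphi(t_2,w_2)|\le\lambda_\varphi(R)(|t_1-t_2|+\|w_1(0)-w_2(0)\|+\|w_1-w_2\|_1)$ for all $t_i\in I$, $w_i\in V(R)$. Viscosity solutions. $\varphi\in\Phi$ is a viscosity supersolution if for any $(t,w)\in\mathbb G$ with $t<T$, $z=w(0)$, any $\phi\in C^1(\mathbb R\times\mathbb R^n)$, $C>C_f(1+2\|w\|_\infty)$ and $\delta>0$ (with $t+\delta\le T$): if $\bar\varphi(t,z)-\phi(t,z)\le\bar\varphi(s,x)-\phi(s,x)$ for all $(s,x)\in K(t,t+\delta,z,C)$ (projection with base point $(t,w)$), then $\partial_t\phi(t,z)+H(t,z,w(-\tau(t,z)),\nabla\phi(t,z))\le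 0$. It is a viscosity subsolution if, with the same quantifiers, $\bar\varphi(t,z)-\phi(t,z)\ge\bar\varphi(s,x)-\phi(s,x)$ on $K(t,t+\delta,z,C)$ implies $\partial_t\phi(t,z)+H(t,z,w(-\tau(t,z)),\nabla\phi(t,z))\ge0$. A viscosity solution of the equation with the terminal condition is a $\varphi$ that is both a sub- and a supersolution and satisfies the terminal condition. *)

theory Defs
  imports "HOL-Analysis.Analysis"
begin

text \<open>
  \<open>Lip(S; \<real>\<^sup>n)\<close>. Elements are \<^const>\<open>extensional\<close>, i.e. equal to \<^const>\<open>undefined\<close> off \<open>S\<close>, so that an
  element is determined by its values on \<open>S\<close>; in particular a Lipschitz solution on a given
  interval can be unique as a HOL function.
\<close>

definition lip_space :: "real set \<Rightarrow> (real \<Rightarrow> real ^ 'n::finite) set" where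
  "lip_space S = {w \<in> extensional S. \<exists>C. lipschitz_on C S w}"

definition hist :: "real \<Rightarrow> (real \<Rightarrow> real ^ 'n::finite) \<Rightarrow> real \<Rightarrow> real \<Rightarrow> real ^ 'n" where
  "hist taubar x s = restrict (\<lambda>\<theta>. x (s + \<theta>)) {-taubar..0}"

text \<open>
  For Lipschitz \<open>w\<close> the \<open>L\<^sup>\<infinity>\<close> norm on \<open>[-taubar, 0]\<close> is the supremum of \<open>|w|\<close>. The supremum is used
  because it is also meaningful in the degenerate case \<open>taubar = 0\<close>, where the interval is a
  null set.
\<close>

definition sup_norm :: "real \<Rightarrow> (real \<Rightarrow> real ^ 'n::finite) \<Rightarrow> real" where
  "sup_norm taubar w = (SUP \<theta>\<in>{-taubar..0}. norm (w \<theta>))"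

definition L1_norm :: "real \<Rightarrow> (real \<Rightarrow> real ^ 'n::finite) \<Rightarrow> real" where
  "L1_norm taubar w = (LINT \<theta>:{-taubar..0}|lebesgue. norm (w \<theta>))"

definition P_set :: "real \<Rightarrow> real \<Rightarrow> (real \<Rightarrow> real ^ 'n::finite) set" where
  "P_set taubar R = {w \<in> lip_space {-taubar..0}. sup_norm taubar w \<le> R}"

text \<open>
  The condition on the derivative says that its essential supremum is at most \<open>R\<close>.
\<close>

definition V_set :: "real \<Rightarrow> real \<Rightarrow> (real \<Rightarrow> real ^ 'n::finite) set" where
  "V_set taubar R = {w \<in> P_set taubar R.
     AE \<theta> in lebesgue. \<theta> \<in> {-taubar<..<0} \<longrightarrow> norm (vector_derivative w (at \<theta>)) \<le> R}"

definition X_space :: "real \<Rightarrow> ((real ^ 'n::finite) \<times> (real \<Rightarrow> real ^ 'n)) set" where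
  "X_space taubar = {(z, w). w \<in> lip_space {-taubar..0} \<and> z = w 0}"

definition X_norm :: "real \<Rightarrow> (real ^ 'n::finite) \<times> (real \<Rightarrow> real ^ 'n) \<Rightarrow> real" where
  "X_norm taubar = (\<lambda>(z, w). norm z + L1_norm taubar w)"

text \<open>
  \<open>\<phi>\<close> is of class \<open>C\<^sup>1\<close> on \<open>S\<close>, with partial derivative \<open>\<phi>t\<close> in time and gradient \<open>\<phi>z\<close> in space.
  The derivative is taken within \<open>S\<close>, hence one-sided in time at the ends of
  \<open>S = [t0, T] \<times> \<real>\<^sup>n\<close>; it is unique there.
\<close>

definition C1_with :: "(real \<times> (real ^ 'n::finite)) set \<Rightarrow> (real \<Rightarrow> real ^ 'n \<Rightarrow> real) \<Rightarrow>
    (real \<Rightarrow> real ^ 'n \<Rightarrow> real) \<Rightarrow> (real \<Rightarrow> real ^ 'n \<Rightarrow> real ^ 'n) \<Rightarrow> bool" where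
  "C1_with S \<phi> \<phi>t \<phi>z \<longleftrightarrow>
     (\<forall>(t, z)\<in>S. ((\<lambda>(s, y). \<phi> s y) has_derivative (\<lambda>(h, k). \<phi>t t z * h + \<phi>z t z \<bullet> k))
        (at (t, z) within S)) \<and>
     continuous_on S (\<lambda>(t, z). \<phi>t t z) \<and>
     continuous_on S (\<lambda>(t, z). \<phi>z t z)"

text \<open>Only the values of a control on the open interval \<open>(t, s)\<close> matter.\<close>

definition controls :: "(real ^ 'm::finite) set \<Rightarrow> real \<Rightarrow> real \<Rightarrow> (real \<Rightarrow> real ^ 'm) set" where
  "controls A t s = {\<alpha>. \<alpha> \<in> borel_measurable (lebesgue_on {t<..<s}) \<and> (\<forall>r\<in>{t<..<s}. \<alpha> r \<in> A)}"

definition is_trajectory :: "real \<Rightarrow> real \<Rightarrow> (real \<Rightarrow> real ^ 'n \<Rightarrow> real) \<Rightarrow>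
    (real \<Rightarrow> real ^ 'n \<Rightarrow> real ^ 'n \<Rightarrow> real ^ 'm \<Rightarrow> real ^ 'n) \<Rightarrow>
    real \<Rightarrow> (real \<Rightarrow> real ^ 'n::finite) \<Rightarrow> (real \<Rightarrow> real ^ 'm::finite) \<Rightarrow> (real \<Rightarrow> real ^ 'n) \<Rightarrow> bool" where
  "is_trajectory T taubar \<tau> f t w \<alpha> x \<longleftrightarrow>
     x \<in> lip_space {t - taubar..T} \<and>
     (\<forall>\<theta>\<in>{-taubar..0}. x (t + \<theta>) = w \<theta>) \<and>
     (AE s in lebesgue. s \<in> {t<..<T} \<longrightarrow>
        (x has_vector_derivative f s (x s) (x (s - \<tau> s (x s))) (\<alpha> s)) (at s))"

definition trajectory :: "real \<Rightarrow> real \<Rightarrow> (real \<Rightarrow> real ^ 'n \<Rightarrow> real) \<Rightarrow>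
    (real \<Rightarrow> real ^ 'n \<Rightarrow> real ^ 'n \<Rightarrow> real ^ 'm \<Rightarrow> real ^ 'n) \<Rightarrow>
    real \<Rightarrow> (real \<Rightarrow> real ^ 'n::finite) \<Rightarrow> (real \<Rightarrow> real ^ 'm::finite) \<Rightarrow> real \<Rightarrow> real ^ 'n" where
  "trajectory T taubar \<tau> f t w \<alpha> = (THE x. is_trajectory T taubar \<tau> f t w \<alpha> x)"

definition cost :: "real \<Rightarrow> real \<Rightarrow> (real \<Rightarrow> real ^ 'n \<Rightarrow> real) \<Rightarrow>
    (real \<Rightarrow> real ^ 'n \<Rightarrow> real ^ 'n \<Rightarrow> real ^ 'm \<Rightarrow> real ^ 'n) \<Rightarrow>
    (real \<Rightarrow> real ^ 'n \<Rightarrow> real ^ 'n \<Rightarrow> real ^ 'm \<Rightarrow> real) \<Rightarrow>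
    ((real ^ 'n) \<times> (real \<Rightarrow> real ^ 'n) \<Rightarrow> real) \<Rightarrow>
    real \<Rightarrow> (real \<Rightarrow> real ^ 'n::finite) \<Rightarrow> (real \<Rightarrow> real ^ 'm::finite) \<Rightarrow> real" where
  "cost T taubar \<tau> f L g t w \<alpha> =
     (let x = trajectory T taubar \<tau> f t w \<alpha> in
        (LINT s:{t..T}|lebesgue. L s (x s) (x (s - \<tau> s (x s))) (\<alpha> s)) + g (x T, hist taubar x T))"

definition value_functional :: "real \<Rightarrow> real \<Rightarrow> (real \<Rightarrow> real ^ 'n \<Rightarrow> real) \<Rightarrow> (real ^ 'm) set \<Rightarrow>
    (real \<Rightarrow> real ^ 'n \<Rightarrow> real ^ 'n \<Rightarrow> real ^ 'm \<Rightarrow> real ^ 'n) \<Rightarrow>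
    (real \<Rightarrow> real ^ 'n \<Rightarrow> real ^ 'n \<Rightarrow> real ^ 'm \<Rightarrow> real) \<Rightarrow>
    ((real ^ 'n) \<times> (real \<Rightarrow> real ^ 'n) \<Rightarrow> real) \<Rightarrow>
    real \<Rightarrow> (real \<Rightarrow> real ^ 'n::finite) \<Rightarrow> real" where
  "value_functional T taubar \<tau> A f L g t w =
     (if t = T then g (w 0, w)
      else (INF \<alpha>\<in>controls A t T. cost T taubar \<tau> f L g t w (\<alpha> :: real \<Rightarrow> real ^ 'm::finite)))"

text \<open>The infimum is a minimum when \<open>A\<close> is nonempty and compact and \<open>f\<close>, \<open>L\<close> are continuous.\<close>

definition hamiltonian :: "(real ^ 'm::finite) set \<Rightarrow>
    (real \<Rightarrow> real ^ 'n \<Rightarrow> real ^ 'n \<Rightarrow> real ^ 'm \<Rightarrow> real ^ 'n) \<Rightarrow>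
    (real \<Rightarrow> real ^ 'n \<Rightarrow> real ^ 'n \<Rightarrow> real ^ 'm \<Rightarrow> real) \<Rightarrow>
    real \<Rightarrow> real ^ 'n::finite \<Rightarrow> real ^ 'n \<Rightarrow> real ^ 'n \<Rightarrow> real" where
  "hamiltonian A f L t z y p = (INF a\<in>A. f t z y a \<bullet> p + L t z y a)"

definition polygonal_ext :: "real \<Rightarrow> (real \<Rightarrow> real ^ 'n::finite) \<Rightarrow> real \<Rightarrow> real ^ 'n \<Rightarrow>
    real \<Rightarrow> real ^ 'n" where
  "polygonal_ext t w s x \<xi> =
     (if \<xi> < t then w (\<xi> - t)
      else if \<xi> \<le> s then w 0 + ((\<xi> - t) / (s - t)) *\<^sub>R (x - w 0)
      else x)"

text \<open>At \<open>s = t\<close> only \<open>x = w 0\<close> is meaningful; this is the only point of the cone below with \<open>s = t\<close>.\<close>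

definition projection :: "real \<Rightarrow> (real \<Rightarrow> (real \<Rightarrow> real ^ 'n::finite) \<Rightarrow> real) \<Rightarrow>
    real \<Rightarrow> (real \<Rightarrow> real ^ 'n) \<Rightarrow> real \<Rightarrow> real ^ 'n \<Rightarrow> real" where
  "projection taubar \<phi> t w s x =
     (if s = t then \<phi> t w else \<phi> s (hist taubar (polygonal_ext t w s x) s))"

definition cone_K :: "real \<Rightarrow> real \<Rightarrow> real ^ 'n::finite \<Rightarrow> real \<Rightarrow> (real \<times> (real ^ 'n)) set" where
  "cone_K a b z C = {(s, x). a \<le> s \<and> s \<le> b \<and> norm (x - z) \<le> C * (s - a)}"

definition Phi_class :: "real \<Rightarrow> real \<Rightarrow> real \<Rightarrow> (real \<Rightarrow> (real \<Rightarrow> real ^ 'n::finite) \<Rightarrow> real) set" where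
  "Phi_class t0 T taubar = {\<phi>. \<forall>R>0. \<exists>lam>0.
     \<forall>t1\<in>{t0..T}. \<forall>t2\<in>{t0..T}. \<forall>w1\<in>V_set taubar R. \<forall>w2\<in>V_set taubar R.
       \<bar>\<phi> t1 w1 - \<phi> t2 w2\<bar>
         \<le> lam * (\<bar>t1 - t2\<bar> + norm (w1 0 - w2 0) + L1_norm taubar (\<lambda>\<theta>. w1 \<theta> - w2 \<theta>))}"

text \<open>
  Viscosity sub- and supersolutions of
  \<open>\<partial>\<^sub>t\<^sup>c\<^sup>i \<phi>(t,w) + Ham(t, z, w(-\<tau>(t,z)), \<nabla>\<^sup>c\<^sup>i \<phi>(t,w)) = 0\<close>, \<open>t < T\<close>, \<open>z = w 0\<close>.
  The co-invariant derivatives of the equation are replaced by the classical derivatives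
  of test functions \<open>\<psi>\<close>, so they do not occur in the definitions. \<open>Cf\<close> is the linear growth
  constant of the dynamics; it enters through the opening of the admissible cones.
\<close>

definition viscosity_supersolution :: "real \<Rightarrow> real \<Rightarrow> real \<Rightarrow> (real \<Rightarrow> real ^ 'n \<Rightarrow> real) \<Rightarrow> real \<Rightarrow>
    (real \<Rightarrow> real ^ 'n \<Rightarrow> real ^ 'n \<Rightarrow> real ^ 'n \<Rightarrow> real) \<Rightarrow>
    (real \<Rightarrow> (real \<Rightarrow> real ^ 'n::finite) \<Rightarrow> real) \<Rightarrow> bool" where
  "viscosity_supersolution t0 T taubar \<tau> Cf Ham \<phi> \<longleftrightarrow>
     \<phi> \<in> Phi_class t0 T taubar \<and>
     (\<forall>t w \<psi> \<psi>t \<psi>z C \<delta>.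
        t0 \<le> t \<longrightarrow> t < T \<longrightarrow> w \<in> lip_space {-taubar..0} \<longrightarrow>
        C1_with UNIV \<psi> \<psi>t \<psi>z \<longrightarrow>
        C > Cf * (1 + 2 * sup_norm taubar w) \<longrightarrow> \<delta> > 0 \<longrightarrow> t + \<delta> \<le> T \<longrightarrow>
        (\<forall>(s, x)\<in>cone_K t (t + \<delta>) (w 0) C.
           projection taubar \<phi> t w t (w 0) - \<psi> t (w 0) \<le> projection taubar \<phi> t w s x - \<psi> s x) \<longrightarrow>
        \<psi>t t (w 0) + Ham t (w 0) (w (- \<tau> t (w 0))) (\<psi>z t (w 0)) \<le> 0)"

definition viscosity_subsolution :: "real \<Rightarrow> real \<Rightarrow> real \<Rightarrow> (real \<Rightarrow> real ^ 'n \<Rightarrow> real) \<Rightarrow> real \<Rightarrow>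
    (real \<Rightarrow> real ^ 'n \<Rightarrow> real ^ 'n \<Rightarrow> real ^ 'n \<Rightarrow> real) \<Rightarrow>
    (real \<Rightarrow> (real \<Rightarrow> real ^ 'n::finite) \<Rightarrow> real) \<Rightarrow> bool" where
  "viscosity_subsolution t0 T taubar \<tau> Cf Ham \<phi> \<longleftrightarrow>
     \<phi> \<in> Phi_class t0 T taubar \<and>
     (\<forall>t w \<psi> \<psi>t \<psi>z C \<delta>.
        t0 \<le> t \<longrightarrow> t < T \<longrightarrow> w \<in> lip_space {-taubar..0} \<longrightarrow>
        C1_with UNIV \<psi> \<psi>t \<psi>z \<longrightarrow>
        C > Cf * (1 + 2 * sup_norm taubar w) \<longrightarrow> \<delta> > 0 \<longrightarrow> t + \<delta> \<le> T \<longrightarrow>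
        (\<forall>(s, x)\<in>cone_K t (t + \<delta>) (w 0) C.
           projection taubar \<phi> t w t (w 0) - \<psi> t (w 0) \<ge> projection taubar \<phi> t w s x - \<psi> s x) \<longrightarrow>
        \<psi>t t (w 0) + Ham t (w 0) (w (- \<tau> t (w 0))) (\<psi>z t (w 0)) \<ge> 0)"

definition viscosity_solution :: "real \<Rightarrow> real \<Rightarrow> real \<Rightarrow> (real \<Rightarrow> real ^ 'n \<Rightarrow> real) \<Rightarrow> real \<Rightarrow>
    (real \<Rightarrow> real ^ 'n \<Rightarrow> real ^ 'n \<Rightarrow> real ^ 'n \<Rightarrow> real) \<Rightarrow>
    ((real ^ 'n) \<times> (real \<Rightarrow> real ^ 'n) \<Rightarrow> real) \<Rightarrow>
    (real \<Rightarrow> (real \<Rightarrow> real ^ 'n::finite) \<Rightarrow> real) \<Rightarrow> bool" where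
  "viscosity_solution t0 T taubar \<tau> Cf Ham g \<phi> \<longleftrightarrow>
     viscosity_subsolution t0 T taubar \<tau> Cf Ham \<phi> \<and>
     viscosity_supersolution t0 T taubar \<tau> Cf Ham \<phi> \<and>
     (\<forall>w\<in>lip_space {-taubar..0}. \<phi> T w = g (w 0, w))"

end

theory Submission
  imports Defs
begin

text \<open>
  The dynamic programming principle reduces the two viscosity inequalities at \<open>(t, w)\<close> to a first
  order expansion on a short interval \<open>[t, t + h]\<close>. A trajectory starting from \<open>w\<close> stays in every
  cone of opening \<open>C > C\<^sub>f (1 + 2 |w|\<^sub>\<infinity>)\<close> for a short time, and its history at \<open>t + h\<close> differs in
  \<open>L\<^sup>1\<close> from the history of the polygonal extension only by \<open>O(h\<^sup>2)\<close>; as the value functional is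
  Lipschitz in this norm, it may be replaced by its projection. Constant controls then give the
  subsolution inequality and \<open>o(h)\<close>-optimal controls the supersolution inequality.

  The Lipschitz estimate in the \<open>L\<^sup>1\<close> norm rests on the monotone delay: \<open>s \<mapsto> s - \<tau>(s, x(s))\<close> has
  derivative at least \<open>d\<close>, so integrals of delayed values are controlled by integrals of the
  trajectory, and Gronwall's inequality applies. Trajectories exist by Picard iteration. Two facts
  of Lebesgue theory are needed throughout: Lipschitz curves are differentiable almost everywhere
  (by a Vitali covering argument) and are the integrals of their derivatives.
\<close>

section \<open>Almost everywhere differentiability of Lipschitz curves\<close>

text \<open>The delayed states of two trajectories are read at two different times, and an L1 bound
  on the difference of histories says nothing about values at a single time. So
  \<open>x1 (rtime x1 r) - x2 (rtime x2 r)\<close> is split at \<open>x1 (rtime x2 r)\<close>: the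
  first part is paid for by the Lipschitz constants of \<open>x1\<close> and of the delay, the
  second is estimated only after integration. This is why the stability constants depend on a
  Lipschitz bound \<open>R\<close> of the history, and why a larger bound \<open>K\<close> takes
  over as soon as later histories of the trajectory enter. The second difficulty is uniformity. A
  nearly optimal control is chosen with tolerance \<open>e * h\<close>, thus after the step
  \<open>h\<close>; the cone, continuity and projection estimates must therefore hold with one
  \<open>h\<close> for all controls at once. Differentiability is reduced to bi-Lipschitz bijections
  of the line: adding a large multiple of the identity to a Lipschitz function gives slopes bounded
  away from 0 and infinity, and then the covering estimate can be used for the function and for its
  inverse alike.\<close>

lemma vitali_increasing_image:
  fixes F :: "real \<Rightarrow> real"
  assumes mono: "mono F" and lip: "lipschitz_on K UNIV F"
    and W: "open W" "W \<in> lmeasurable" "S \<subseteq> W" and p: "0 \<le> p"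
    and slope: "\<And>x d. x \<in> S \<Longrightarrow> d > 0 \<Longrightarrow> \<exists>y. y \<noteq> x \<and> \<bar>y - x\<bar> < d \<and> (F y - F x) / (y - x) < p"
  obtains T where "T \<in> lmeasurable" "F ` S \<subseteq> T" "measure lebesgue T \<le> p * measure lebesgue W"
proof -
  \<comment> \<open>An index is a pair (centre, radius). These intervals form a Vitali cover of
    \<open>S\<close>: a chord of slope below \<open>p\<close> starting at \<open>x\<close> can be
    taken as short as desired, and its base has \<open>x\<close> as an endpoint. A disjoint
    countable subfamily covers \<open>S\<close> up to a null set, and as \<open>F\<close> is
    increasing, the images are intervals of at most \<open>p\<close> times the original
    length.\<close>
  define \<K> where "\<K> = {i::real\<times>real. 0 < snd i \<and> cball (fst i) (snd i) \<subseteq> W \<and>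
      F (fst i + snd i) - F (fst i - snd i) \<le> p * (2 * snd i)}"
  have pos: "0 < snd i" if "i \<in> \<K>" for i using that by (simp add: \<K>_def)
  have fine: "\<exists>i. i \<in> \<K> \<and> x \<in> cball (fst i) (snd i) \<and> snd i < d" if x: "x \<in> S" and d: "0 < d" for x d
  proof -
    obtain e where e: "e > 0" "ball x e \<subseteq> W"
      using W x by (meson openE subsetD)
    obtain y where y: "y \<noteq> x" "\<bar>y - x\<bar> < min d e" "(F y - F x) / (y - x) < p"
      using slope[OF x, of "min d e"] d e by auto
    define c where "c = (x + y) / 2"
    define r where "r = \<bar>y - x\<bar> / 2"
    have r: "r > 0" "r < d" using y d by (auto simp: r_def)
    have sub: "cball c r \<subseteq> ball x e"
    proof
      fix u assume "u \<in> cball c r"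
      then have "\<bar>2 * u - (x + y)\<bar> \<le> \<bar>y - x\<bar>" by (auto simp: c_def r_def dist_real_def abs_if field_simps split: if_splits)
      then have "\<bar>x - u\<bar> < e" using y by linarith
      then show "u \<in> ball x e" by (simp add: dist_real_def)
    qed
    have le: "F (c + r) - F (c - r) \<le> p * (2 * r)"
    proof (cases "x < y")
      case True
      then have "F y - F x < p * (y - x)" using y by (simp add: divide_less_eq)
      moreover have "c + r = y" "c - r = x" "2 * r = y - x" using True by (auto simp: c_def r_def field_simps)
      ultimately show ?thesis by (simp only: less_imp_le)
    next
      case False
      then have "y - x < 0" using y(1) by simp
      then have "p * (y - x) < F y - F x" using y(3) neg_divide_less_eq[of "y - x" "F y - F x" p] by blast
      then have "F x - F y < p * (x - y)" by (simp add: algebra_simps)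
      moreover have "c + r = x" "c - r = y" "2 * r = x - y" using False by (auto simp: c_def r_def field_simps)
      ultimately show ?thesis by (simp only: less_imp_le)
    qed
    have xc: "x \<in> cball c r" by (auto simp: c_def r_def dist_real_def abs_if field_simps)
    have "cball c r \<subseteq> W" using sub e(2) by (rule order_trans)
    then have "(c, r) \<in> \<K>" unfolding \<K>_def mem_Collect_eq fst_conv snd_conv using le r(1) by (intro conjI)
    moreover have "x \<in> cball (fst (c, r)) (snd (c, r)) \<and> snd (c, r) < d"
      unfolding fst_conv snd_conv using xc r(2) by (intro conjI)
    ultimately show ?thesis by (rule exI[where x="(c, r)", OF conjI])
  qed
  obtain C where C: "countable C" "C \<subseteq> \<K>"
     "pairwise (\<lambda>i j. disjnt (cball (fst i) (snd i)) (cball (fst j) (snd j))) C"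
     "negligible (S - (\<Union>i\<in>C. cball (fst i) (snd i)))"
    by (rule Vitali_covering_theorem_cballs[of \<K> snd S fst, OF pos fine]) (assumption | rule that)+
  define J where "J i = {F (fst i - snd i)..F (fst i + snd i)}" for i
  \<comment> \<open>The part of \<open>S\<close> missed by the intervals is null, and a Lipschitz
    map sends null sets to null sets.\<close>
  define N where "N = F ` (S - (\<Union>i\<in>C. cball (fst i) (snd i)))"
  have N: "negligible N"
    unfolding N_def
  proof (rule negligible_locally_Lipschitz_image)
    show "\<exists>T B. open T \<and> x \<in> T \<and> (\<forall>y\<in>(S - (\<Union>i\<in>C. cball (fst i) (snd i))) \<inter> T. norm (F y - F x) \<le> B * norm (y - x))" for x
      using lipschitz_on_normD[OF lip] by (intro exI[of _ UNIV] exI[of _ K]) auto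
  qed (use C in auto)
  have meas: "J i \<in> lmeasurable" for i by (simp add: J_def)
  have le: "measure lebesgue (\<Union>i\<in>I. J i) \<le> p * measure lebesgue W" if I: "I \<subseteq> C" "finite I" for I
  proof -
    have "measure lebesgue (\<Union>i\<in>I. J i) \<le> (\<Sum>i\<in>I. measure lebesgue (J i))"
      using I meas by (intro measure_UNION_le) (auto simp: fmeasurableD)
    also have "\<dots> \<le> (\<Sum>i\<in>I. p * measure lebesgue (cball (fst i) (snd i)))"
    proof (rule sum_mono)
      fix i assume "i \<in> I"
      then have i: "i \<in> \<K>" using I C by auto
      have "F (fst i - snd i) \<le> F (fst i + snd i)" using mono pos[OF i] by (simp add: monoD)
      then show "measure lebesgue (J i) \<le> p * measure lebesgue (cball (fst i) (snd i))"
      proof -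
        have "measure lebesgue (J i) = F (fst i + snd i) - F (fst i - snd i)"
          unfolding J_def using \<open>F (fst i - snd i) \<le> F (fst i + snd i)\<close> by simp
        moreover have "measure lebesgue (cball (fst i) (snd i)) = 2 * snd i"
          using pos[OF i] by (simp add: cball_eq_atLeastAtMost)
        moreover have "F (fst i + snd i) - F (fst i - snd i) \<le> p * (2 * snd i)" using i unfolding \<K>_def by blast
        ultimately show ?thesis by (simp only:)
      qed
    qed
    also have "\<dots> = p * measure lebesgue (\<Union>i\<in>I. cball (fst i) (snd i))"
    proof -
      have "disjoint_family_on (\<lambda>i. cball (fst i) (snd i)) I"
        using C(3) I(1) unfolding disjoint_family_on_def pairwise_def disjnt_def by (meson subsetD)
      then have "measure lebesgue (\<Union>i\<in>I. cball (fst i) (snd i)) = (\<Sum>i\<in>I. measure lebesgue (cball (fst i) (snd i)))"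
        using I(2) emeasure_lborel_cball_finite by (intro measure_finite_Union) (auto simp: less_top[symmetric])
      then show ?thesis by (simp add: sum_distrib_left)
    qed
    also have "\<dots> \<le> p * measure lebesgue W"
    proof (intro mult_left_mono measure_mono_fmeasurable)
      show "(\<Union>i\<in>I. cball (fst i) (snd i)) \<subseteq> W" using I(1) C(2) unfolding \<K>_def by blast
      show "(\<Union>i\<in>I. cball (fst i) (snd i)) \<in> sets lebesgue" using I(2) by (intro sets.finite_UN) auto
    qed (use W p in auto)
    finally show ?thesis .
  qed
  have U: "(\<Union>i\<in>C. J i) \<in> lmeasurable" "measure lebesgue (\<Union>i\<in>C. J i) \<le> p * measure lebesgue W"
    using fmeasurable_UN_bound[OF C(1) meas le] measure_UN_bound[OF C(1) meas le] by auto
  show ?thesis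
  proof
    show "(\<Union>i\<in>C. J i) \<union> N \<in> lmeasurable" using U N negligible_imp_measurable by blast
    show "F ` S \<subseteq> (\<Union>i\<in>C. J i) \<union> N"
    proof clarify
      fix x assume x: "x \<in> S" "F x \<notin> N"
      then have "x \<in> (\<Union>i\<in>C. cball (fst i) (snd i))" unfolding N_def by blast
      then obtain i where i: "i \<in> C" "x \<in> cball (fst i) (snd i)" by blast
      then have "F x \<in> J i" using mono by (auto simp: J_def monoD cball_eq_atLeastAtMost)
      then show "F x \<in> (\<Union>i\<in>C. J i)" using i by auto
    qed
    have "measure lebesgue ((\<Union>i\<in>C. J i) \<union> N) \<le> measure lebesgue (\<Union>i\<in>C. J i) + measure lebesgue N"
      using U N negligible_imp_measurable by (intro measure_Un_le) (auto simp: negligible_imp_sets)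
    then show "measure lebesgue ((\<Union>i\<in>C. J i) \<union> N) \<le> p * measure lebesgue W"
      using U N negligible_imp_measure0 by fastforce
  qed
qed

text \<open>
  \<open>F\<close> contracts outer measure on \<open>S\<close> by the factor \<open>p\<close> and \<open>G\<close> expands it by at most \<open>1 / q\<close>, so going
  back and forth multiplies the outer measure of \<open>S\<close> by \<open>p / q < 1\<close>.
\<close>
lemma negligible_slope_gap:
  fixes F G :: "real \<Rightarrow> real"
  assumes F: "mono F" "lipschitz_on K UNIV F" and G: "mono G" "lipschitz_on K' UNIV G"
    and GF: "\<And>x. G (F x) = x" and FG: "\<And>y. F (G y) = y"
    and S: "bounded S" and pq: "0 < p" "p < q"
    and low: "\<And>x d. x \<in> S \<Longrightarrow> d > 0 \<Longrightarrow> \<exists>y. y \<noteq> x \<and> \<bar>y - x\<bar> < d \<and> (F y - F x) / (y - x) < p"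
    and high: "\<And>x d. x \<in> S \<Longrightarrow> d > 0 \<Longrightarrow> \<exists>y. y \<noteq> x \<and> \<bar>y - x\<bar> < d \<and> (F y - F x) / (y - x) > q"
  shows "negligible S"
proof -
  let ?\<mu> = "measure lebesgue"
  have outer: "\<exists>W. open W \<and> W \<in> lmeasurable \<and> T \<subseteq> W \<and> ?\<mu> W \<le> ?\<mu> T + e" if T: "T \<in> lmeasurable" and e: "e > 0" for T :: "real set" and e
  proof -
    obtain W where W: "open W" "T \<subseteq> W" "W - T \<in> lmeasurable" "emeasure lebesgue (W - T) < ennreal e"
      using sets_lebesgue_outer_open[of T e] T e by (auto simp: fmeasurableD)
    have WT: "W = T \<union> (W - T)" using W by auto
    then have "W \<in> lmeasurable" using T W(3) by (metis fmeasurable.Un)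
    moreover have "?\<mu> W \<le> ?\<mu> T + ?\<mu> (W - T)" using T W(3) WT measure_Un_le[of T lebesgue "W - T"] by (simp add: fmeasurableD)
    moreover have "?\<mu> (W - T) < e" using W e by (simp add: emeasure_eq_measure2 ennreal_less_iff)
    ultimately show ?thesis using W by (intro exI[of _ W]) auto
  qed
  define \<W> where "\<W> = {W. open W \<and> W \<in> lmeasurable \<and> S \<subseteq> W}"
  \<comment> \<open>This is the outer measure of \<open>S\<close>, which may be nonmeasurable, as an
    infimum over open supersets.\<close>
  define m where "m = Inf (?\<mu> ` \<W>)"
  obtain b where "S \<subseteq> ball 0 b" using S bounded_subset_ballD by blast
  then have ne: "\<W> \<noteq> {}" by (auto simp: \<W>_def intro!: exI[of _ "ball 0 b"])
  have bdd: "bdd_below (?\<mu> ` \<W>)" by (rule bdd_belowI[of _ 0]) auto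
  have m0: "0 \<le> m" unfolding m_def using ne by (intro cINF_greatest) auto
  have step: "m \<le> p / q * ?\<mu> W + e" if W: "W \<in> \<W>" and e: "e > 0" for W e
  proof -
    obtain T where T: "T \<in> lmeasurable" "F ` S \<subseteq> T" "?\<mu> T \<le> p * ?\<mu> W"
      using vitali_increasing_image[OF F, of W S p] W pq low by (auto simp: \<W>_def)
    obtain W' where W': "open W'" "W' \<in> lmeasurable" "T \<subseteq> W'" "?\<mu> W' \<le> ?\<mu> T + e * q / 2"
      using outer[OF T(1), of "e * q / 2"] e pq by auto
    \<comment> \<open>A chord of \<open>F\<close> at \<open>u\<close> with slope above
      \<open>q\<close>, read backwards, is a chord of \<open>G\<close> at \<open>F u\<close> with
      slope below \<open>1 / q\<close>. The scale \<open>d / (K + 1)\<close> makes the image chord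
      shorter than \<open>d\<close>, also when \<open>K = 0\<close>.\<close>
    have *: "\<exists>y. y \<noteq> x \<and> \<bar>y - x\<bar> < d \<and> (G y - G x) / (y - x) < 1 / q" if x: "x \<in> F ` S" and d: "d > 0" for x d
    proof -
      obtain u where u: "u \<in> S" "x = F u" using x by auto
      have K: "K \<ge> 0" using F(2) lipschitz_on_nonneg by blast
      obtain v where v: "v \<noteq> u" "\<bar>v - u\<bar> < d / (K + 1)" "(F v - F u) / (v - u) > q"
        using high[OF u(1), of "d / (K + 1)"] d K by auto
      have "\<bar>F v - F u\<bar> \<le> K * \<bar>v - u\<bar>" using lipschitz_on_normD[OF F(2), of v u] by simp
      also have "\<dots> \<le> (K + 1) * \<bar>v - u\<bar>" by (simp add: algebra_simps)
      also have "\<dots> < d" using v(2) K by (simp add: pos_less_divide_eq mult.commute)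
      finally have "\<bar>F v - F u\<bar> < d" .
      moreover have "F v \<noteq> F u" using v(1) GF by metis
      moreover have "(v - u) / (F v - F u) < 1 / q"
        using v(3) pq frac_less2[of 1 1 q "(F v - F u) / (v - u)"] by simp
      ultimately show ?thesis using u GF by (intro exI[of _ "F v"]) auto
    qed
    obtain T' where T': "T' \<in> lmeasurable" "G ` (F ` S) \<subseteq> T'" "?\<mu> T' \<le> 1 / q * ?\<mu> W'"
      using vitali_increasing_image[OF G W'(1,2) order_trans[OF T(2) W'(3)] _ *] pq by (metis less_eq_real_def zero_less_divide_1_iff order_less_trans)
    obtain W'' where W'': "open W''" "W'' \<in> lmeasurable" "T' \<subseteq> W''" "?\<mu> W'' \<le> ?\<mu> T' + e / 2"
      using outer[OF T'(1), of "e / 2"] e by auto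
    have "W'' \<in> \<W>" using W'' T' GF by (auto simp: \<W>_def image_image)
    then have "m \<le> ?\<mu> W''" unfolding m_def using bdd by (intro cINF_lower)
    also have "\<dots> \<le> 1 / q * (p * ?\<mu> W + e * q / 2) + e / 2"
    proof -
      have "1 / q * ?\<mu> W' \<le> 1 / q * (p * ?\<mu> W + e * q / 2)" using W' T pq by (intro mult_left_mono) auto
      then show ?thesis using W'' T' by linarith
    qed
    also have "\<dots> = p / q * ?\<mu> W + e" using pq by (simp add: field_simps)
    finally show ?thesis .
  qed
  have "m \<le> 0"
  proof (rule ccontr)
    assume "\<not> m \<le> 0"
    then have m: "m > 0" by simp
    \<comment> \<open>With this choice \<open>p / q * m + 2 * e = m - 2 * e\<close>, which falls
      below \<open>m\<close> and contradicts \<open>step\<close> for a near-minimal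
      \<open>W\<close>.\<close>
    define e where "e = m * (1 - p / q) / 4"
    have e: "e > 0" using m pq by (simp add: e_def)
    obtain W where W: "W \<in> \<W>" "?\<mu> W < m + e"
      using cInf_lessD[of "?\<mu> ` \<W>" "m + e"] ne e unfolding m_def by auto
    have "m \<le> p / q * ?\<mu> W + e" by (rule step[OF W(1) e])
    also have "\<dots> \<le> p / q * (m + e) + e" using W pq by (intro add_mono mult_left_mono) auto
    also have "\<dots> \<le> p / q * m + e + e" using pq e by (simp add: distrib_left field_simps)
    also have "\<dots> = m - 2 * e" by (simp add: e_def field_simps)
    finally show False using e by simp
  qed
  show ?thesis
    unfolding negligible_outer
  proof (intro allI impI)
    fix e :: real assume "e > 0"
    then obtain W where "W \<in> \<W>" "?\<mu> W < e"
      using cInf_lessD[of "?\<mu> ` \<W>" e] ne \<open>m \<le> 0\<close> unfolding m_def by auto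
    then show "\<exists>T. S \<subseteq> T \<and> T \<in> lmeasurable \<and> ?\<mu> T < e" by (auto simp: \<W>_def)
  qed
qed

text \<open>Where the difference quotients, which lie in \<open>[1, K]\<close>, fail to converge,
  two rationals \<open>p < q\<close> separate their lower and upper limits, so the point lies in one
  of countably many sets with a slope gap. Expansion makes \<open>F\<close> a bijection of the line
  with a 1-Lipschitz inverse, so each of these sets is null.\<close>

lemma expanding_lipschitz_differentiable_AE:
  fixes F :: "real \<Rightarrow> real"
  assumes lip: "lipschitz_on K UNIV F" and exp: "\<And>x y. x \<le> y \<Longrightarrow> y - x \<le> F y - F x"
  shows "negligible {x. \<not> F differentiable (at x)}"
proof -
  have lip': "\<bar>F y - F x\<bar> \<le> K * \<bar>y - x\<bar>" for x y using lipschitz_on_normD[OF lip, of y x] by simp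
  have monoF: "mono F" by (rule monoI) (use exp in fastforce)
  have inj: "F x = F y \<longleftrightarrow> x = y" for x y using exp[of x y] exp[of y x] by fastforce
  have contF: "continuous_on UNIV F" using lip lipschitz_on_continuous_on by blast
  have "\<exists>x. F x = y" for y
  proof -
    define r where "r = \<bar>y - F 0\<bar>"
    have "F (- r) \<le> y" "y \<le> F r" using exp[of "-r" 0] exp[of 0 r] by (auto simp: r_def)
    moreover have "- r \<le> r" by (simp add: r_def)
    ultimately show ?thesis using IVT'[of F "-r" y r] continuous_on_subset[OF contF] by blast
  qed
  then obtain G where FG: "\<And>y. F (G y) = y" by metis
  then have GF: "\<And>x. G (F x) = x" using inj by blast
  have monoG: "mono G"
    by (rule monoI) (metis FG exp diff_ge_0_iff_ge linorder_linear order_antisym order_trans)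
  have lipG: "lipschitz_on 1 UNIV G"
  proof (rule lipschitz_onI)
    fix x y :: real
    show "dist (G x) (G y) \<le> 1 * dist x y"
      using exp[of "G x" "G y"] exp[of "G y" "G x"] FG[of x] FG[of y] by (auto simp: dist_real_def abs_if)
  qed auto
  define lowp where "lowp p x \<longleftrightarrow> (\<forall>d>0. \<exists>y. y \<noteq> x \<and> \<bar>y - x\<bar> < d \<and> (F y - F x) / (y - x) < p)" for p x
  define highp where "highp q x \<longleftrightarrow> (\<forall>d>0. \<exists>y. y \<noteq> x \<and> \<bar>y - x\<bar> < d \<and> (F y - F x) / (y - x) > q)" for q x
  \<comment> \<open>The index \<open>n\<close> cuts the sets down to bounded ones; restricting
    \<open>p\<close> and \<open>q\<close> to rationals will keep the family countable.\<close>
  define Z where "Z = (\<lambda>(p, q, n). {x \<in> ball 0 (real n). 0 < p \<and> p < q \<and> lowp p x \<and> highp q x})"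
  have negZ: "negligible (Z i)" for i
  proof -
    obtain p q n where i: "i = (p, q, n)" by (cases i)
    show ?thesis
    proof (cases "0 < p \<and> p < q")
      case True
      show ?thesis
      proof (rule negligible_slope_gap[OF monoF lip monoG lipG GF FG])
        show "bounded (Z i)" by (rule bounded_subset[OF bounded_ball[of 0 "real n"]]) (auto simp: Z_def i)
      qed (use True in \<open>auto simp: Z_def i lowp_def highp_def\<close>)
    qed (auto simp: Z_def i)
  qed
  have cover: "{x. \<not> F differentiable (at x)} \<subseteq> (\<Union>i\<in>\<rat> \<times> \<rat> \<times> UNIV. Z i)"
  proof (rule subsetI, rule ccontr)
    fix x assume x: "x \<in> {x. \<not> F differentiable (at x)}" "x \<notin> (\<Union>i\<in>\<rat> \<times> \<rat> \<times> UNIV. Z i)"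
    define s where "s y = (F y - F x) / (y - x)" for y
    have s1: "1 \<le> s y" if "y \<noteq> x" for y
      using exp[of x y] exp[of y x] that unfolding s_def by (cases "x < y") (auto simp: pos_le_divide_eq neg_le_divide_eq)
    have sK: "s y \<le> K" if "y \<noteq> x" for y
    proof -
      have "\<bar>s y\<bar> \<le> K" using lip'[of y x] that by (simp add: s_def abs_divide divide_le_eq)
      then show ?thesis by simp
    qed
    obtain n :: nat where n: "\<bar>x\<bar> < n" using reals_Archimedean2 by blast
    have gap: "\<not> highp q x" if "p \<in> \<rat>" "q \<in> \<rat>" "0 < p" "p < q" "lowp p x" for p q
    proof
      assume "highp q x"
      then have "x \<in> Z (p, q, n)" using that n by (auto simp: Z_def dist_real_def)
      then show False using x(2) that by blast
    qed
    \<comment> \<open>\<open>P\<close> collects the eventual lower bounds of the difference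
      quotients at \<open>x\<close>, so its supremum \<open>l\<close> is their lower limit.\<close>
    define P where "P = {p. \<not> lowp p x}"
    have P1: "1 \<in> P" using s1 unfolding P_def lowp_def s_def[symmetric] by (auto intro!: exI[of _ 1]) (meson not_le)
    have bddP: "bdd_above P"
    proof (rule bdd_aboveI)
      fix p assume "p \<in> P"
      then obtain d where d: "d > 0" "\<And>y. y \<noteq> x \<Longrightarrow> \<bar>y - x\<bar> < d \<Longrightarrow> p \<le> s y"
        unfolding P_def lowp_def s_def[symmetric] mem_Collect_eq by (metis not_le)
      have "p \<le> s (x + d/2)" by (rule d(2)) (use d(1) in auto)
      also have "\<dots> \<le> K" using d(1) by (intro sK) auto
      finally show "p \<le> K" .
    qed
    define l where "l = Sup P"
    have l1: "1 \<le> l" unfolding l_def using P1 bddP by (rule cSup_upper)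
    have "(s \<longlongrightarrow> l) (at x)"
    proof (rule tendstoI)
      fix e :: real assume e: "e > 0"
      obtain p where p: "p \<in> P" "l - e < p" using less_cSupD[of P "l - e"] P1 e unfolding l_def by auto
      obtain d1 where d1: "d1 > 0" "\<And>y. y \<noteq> x \<Longrightarrow> \<bar>y - x\<bar> < d1 \<Longrightarrow> p \<le> s y"
        using p(1) unfolding P_def lowp_def s_def[symmetric] mem_Collect_eq not_all not_imp not_ex not_less by (metis not_le)
      \<comment> \<open>Two rationals above \<open>l\<close> are used: \<open>a\<close> exceeds the
        lower limit, so chords of slope below \<open>a\<close> persist at every scale; as
        \<open>x\<close> lies in none of the sets \<open>Z i\<close>, chords of slope above
        \<open>b\<close> cannot persist as well.\<close>
      obtain a where a: "a \<in> \<rat>" "l < a" "a < l + e" using Rats_dense_in_real[of l "l + e"] e by auto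
      obtain b where b: "b \<in> \<rat>" "a < b" "b < l + e" using Rats_dense_in_real[of a "l + e"] a by auto
      have "a \<notin> P" using a cSup_upper[OF _ bddP, of a] unfolding l_def by auto
      then have "\<not> highp b x" using gap[of a b] a b l1 by (auto simp: P_def)
      then obtain d2 where d2: "d2 > 0" "\<And>y. y \<noteq> x \<Longrightarrow> \<bar>y - x\<bar> < d2 \<Longrightarrow> s y \<le> b"
        unfolding highp_def s_def[symmetric] by (metis not_le)
      show "eventually (\<lambda>y. dist (s y) l < e) (at x)"
        unfolding eventually_at
      proof (intro exI[of _ "min d1 d2"] conjI ballI impI)
        fix y assume y: "y \<noteq> x \<and> dist y x < min d1 d2"
        then have "p \<le> s y" "s y \<le> b" using d1(2)[of y] d2(2)[of y] by (auto simp: dist_real_def)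
        then show "dist (s y) l < e" using p b by (auto simp: dist_real_def)
      qed (use d1 d2 in auto)
    qed
    then have "(F has_field_derivative l) (at x)" by (simp add: has_field_derivative_iff s_def[abs_def])
    then show False using x(1) real_differentiable_def by blast
  qed
  have "negligible (\<Union>i\<in>\<rat> \<times> \<rat> \<times> UNIV. Z i)"
    by (rule negligible_countable_Union) (auto intro: negZ simp: countable_rat)
  then show ?thesis using cover negligible_subset by blast
qed

text \<open>Clamping extends \<open>x\<close> to the line with the same Lipschitz constant, and
  adding \<open>(K + 1) * s\<close> lifts all slopes from \<open>[-K, K]\<close> to at least 1. The
  added term is smooth, so differentiability is not affected.\<close>

lemma lipschitz_differentiable_AE_real:
  fixes x :: "real \<Rightarrow> real"
  assumes lip: "lipschitz_on K {a..b} x"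
  shows "negligible {s \<in> {a<..<b}. \<not> x differentiable (at s)}"
proof (cases "a < b")
  case True
  define cl where "cl s = max a (min b s)" for s
  define F where "F s = x (cl s) + (K + 1) * s" for s
  have K: "K \<ge> 0" using lip lipschitz_on_nonneg by blast
  have clip: "lipschitz_on K UNIV (\<lambda>s. x (cl s))"
  proof (rule lipschitz_onI)
    fix s t :: real
    have "dist (x (cl s)) (x (cl t)) \<le> K * dist (cl s) (cl t)"
      by (rule lipschitz_onD[OF lip]) (use True in \<open>auto simp: cl_def\<close>)
    also have "\<dots> \<le> K * dist s t"
      using K by (intro mult_left_mono) (auto simp: cl_def dist_real_def)
    finally show "dist (x (cl s)) (x (cl t)) \<le> K * dist s t" .
  qed (fact K)
  have "negligible {s. \<not> F differentiable (at s)}"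
  proof (rule expanding_lipschitz_differentiable_AE)
    show "lipschitz_on (K + (K + 1)) UNIV F"
      unfolding F_def using K by (intro lipschitz_on_add clip lipschitz_on_cmult_real_nonneg[where C=1, simplified] lipschitz_on_id) auto
    show "t - s \<le> F t - F s" if "s \<le> t" for s t
      using lipschitz_on_normD[OF clip, of t s] that by (simp add: F_def algebra_simps)
  qed
  moreover have "{s \<in> {a<..<b}. \<not> x differentiable (at s)} \<subseteq> {s. \<not> F differentiable (at s)}"
  proof clarify
    fix s assume s: "s \<in> {a<..<b}" and F: "F differentiable (at s)" and nd: "\<not> x differentiable (at s)"
    have "(\<lambda>s. F s - (K + 1) * s) differentiable (at s)" using F by (intro derivative_intros) auto
    then obtain D where D: "((\<lambda>s. x (cl s)) has_derivative D) (at s)"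
      by (auto simp: F_def differentiable_def)
    have "(x has_derivative D) (at s)"
      by (rule has_derivative_transform_within_open[OF D, of "{a<..<b}"]) (use s in \<open>auto simp: cl_def\<close>)
    then show False using nd by (auto simp: differentiable_def)
  qed
  ultimately show ?thesis using negligible_subset by blast
qed auto

lemma lipschitz_differentiable_AE:
  fixes x :: "real \<Rightarrow> 'a::euclidean_space"
  assumes lip: "lipschitz_on K {a..b} x"
  shows "AE s in lebesgue. s \<in> {a<..<b} \<longrightarrow> x differentiable (at s)"
proof -
  have K: "K \<ge> 0" using lip lipschitz_on_nonneg by blast
  have "negligible {s \<in> {a<..<b}. \<not> (\<lambda>s. x s \<bullet> i) differentiable (at s)}" if i: "i \<in> Basis" for i
  proof (rule lipschitz_differentiable_AE_real[where K=K], rule lipschitz_onI)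
    fix s t assume "s \<in> {a..b}" "t \<in> {a..b}"
    then have "norm (x s - x t) \<le> K * dist s t" using lipschitz_onD[OF lip, of s t] by (simp add: dist_norm)
    moreover have "\<bar>(x s - x t) \<bullet> i\<bar> \<le> norm (x s - x t)" using i Basis_le_norm by blast
    ultimately show "dist (x s \<bullet> i) (x t \<bullet> i) \<le> K * dist s t" by (simp add: dist_real_def inner_diff_left)
  qed (fact K)
  then have "negligible (\<Union>i\<in>Basis. {s \<in> {a<..<b}. \<not> (\<lambda>s. x s \<bullet> i) differentiable (at s)})"
    by (intro negligible_Union finite_imageI) auto
  moreover have "{s \<in> {a<..<b}. \<not> x differentiable (at s)} \<subseteq> (\<Union>i\<in>Basis. {s \<in> {a<..<b}. \<not> (\<lambda>s. x s \<bullet> i) differentiable (at s)})"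
    by (auto simp: differentiable_componentwise_within[of x])
  ultimately have "negligible {s \<in> {a<..<b}. \<not> x differentiable (at s)}" using negligible_subset by blast
  then show ?thesis by (intro AE_I'[of "{s \<in> {a<..<b}. \<not> x differentiable (at s)}"]) (auto simp: negligible_iff_null_sets)
qed

section \<open>The fundamental theorem of calculus for Lipschitz curves\<close>

lemma clamp_lipschitz:
  fixes x :: "real \<Rightarrow> 'a::metric_space"
  assumes "lipschitz_on K {a..b} x" "a \<le> b"
  shows "lipschitz_on K UNIV (\<lambda>s. x (max a (min b s)))"
proof (rule lipschitz_onI)
  show K: "K \<ge> 0" using assms lipschitz_on_nonneg by blast
  fix s t :: real
  have "dist (x (max a (min b s))) (x (max a (min b t))) \<le> K * dist (max a (min b s)) (max a (min b t))"
    by (rule lipschitz_onD[OF assms(1)]) (use assms(2) in auto)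
  also have "\<dots> \<le> K * dist s t"
    using K by (intro mult_left_mono) (auto simp: dist_real_def)
  finally show "dist (x (max a (min b s))) (x (max a (min b t))) \<le> K * dist s t" .
qed

lemma AE_lebesgue_negligibleE:
  assumes "AE s in lebesgue. P s"
  obtains N where "negligible N" "\<And>s. s \<notin> N \<Longrightarrow> P s"
proof -
  obtain N where N: "N \<in> null_sets lebesgue" "{s \<in> space lebesgue. \<not> P s} \<subseteq> N"
    using assms unfolding eventually_ae_filter by auto
  then have "negligible N" by (simp add: negligible_iff_null_sets)
  moreover have "P s" if "s \<notin> N" for s using N(2) that by auto
  ultimately show ?thesis by (rule that)
qed

text \<open>The difference quotients of the clamped extension are bounded by \<open>K\<close> and
  tend to \<open>h\<close> a.e., so dominated convergence yields the integrability of
  \<open>h\<close> along with its integral. The integrals of the quotients telescope to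
  \<open>x b\<close> minus an average of the extension over a short interval starting at
  \<open>a\<close>.\<close>

lemma lipschitz_has_integral_derivative:
  fixes x :: "real \<Rightarrow> 'a::euclidean_space"
  assumes lip: "lipschitz_on K {a..b} x" and ab: "a \<le> b"
    and der: "AE s in lebesgue. s \<in> {a<..<b} \<longrightarrow> (x has_vector_derivative h s) (at s)"
  shows "(h has_integral (x b - x a)) {a..b}"
proof -
  have K: "K \<ge> 0" using lip lipschitz_on_nonneg by blast
  \<comment> \<open>\<open>y\<close> is constant to the right of \<open>b\<close>, so quotients near
    \<open>b\<close> make sense and the shifted integral contributes exactly
    \<open>x b\<close>.\<close>
  define y where "y s = x (max a (min b s))" for s
  have ylip: "lipschitz_on K UNIV y" unfolding y_def using clamp_lipschitz[OF lip ab] .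
  have ycont: "continuous_on S y" for S using lipschitz_on_continuous_on[OF ylip] continuous_on_subset by blast
  have yint: "y integrable_on {u..v}" for u v using ycont integrable_continuous_real by blast
  obtain N where N0: "negligible N" "\<And>s. s \<notin> N \<Longrightarrow> s \<in> {a<..<b} \<longrightarrow> (x has_vector_derivative h s) (at s)"
    by (rule AE_lebesgue_negligibleE[OF der]) (rule that)
  have N: "negligible N" "\<And>s. s \<in> {a<..<b} - N \<Longrightarrow> (x has_vector_derivative h s) (at s)"
    using N0 by blast+
  define Z where "Z = N \<union> {a, b}"
  have Z: "negligible Z" unfolding Z_def using N by (intro negligible_Un) auto
  define \<delta> where "\<delta> k = 1 / real (Suc k)" for k
  have \<delta>: "\<delta> k > 0" for k by (simp add: \<delta>_def)
  have \<delta>0: "\<delta> \<longlonglongrightarrow> 0" unfolding \<delta>_def[abs_def] using LIMSEQ_inverse_real_of_nat by (simp add: inverse_eq_divide)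
  define q where "q k s = (1 / \<delta> k) *\<^sub>R (y (s + \<delta> k) - y s)" for k s
  have qint: "q k integrable_on {a..b}" for k
    unfolding q_def by (intro integrable_continuous_real continuous_intros continuous_on_compose2[OF ycont[of UNIV]]) auto
  \<comment> \<open>Dominated convergence is applied with convergence at every point, so quotients
    and limit are both set to 0 on the exceptional null set.\<close>
  define Q where "Q k s = (if s \<in> Z then 0 else q k s)" for k s
  define g where "g s = (if s \<in> Z then 0 else h s)" for s
  have Qint: "Q k integrable_on {a..b}" for k
    by (rule integrable_spike[OF qint Z]) (auto simp: Q_def)
  have Qeq: "integral {a..b} (Q k) = integral {a..b} (q k)" for k
    by (rule integral_spike[OF Z]) (auto simp: Q_def)
  have qb: "norm (Q k s) \<le> K" for k s
  proof -
    have "norm (y (s + \<delta> k) - y s) \<le> K * \<delta> k"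
      using lipschitz_on_normD[OF ylip, of "s + \<delta> k" s] \<delta>[of k] by simp
    then have "norm (q k s) \<le> K" using \<delta>[of k] by (simp add: q_def divide_le_eq)
    then show ?thesis using K by (simp add: Q_def)
  qed
  have lim: "(\<lambda>k. Q k s) \<longlonglongrightarrow> g s" if s: "s \<in> {a..b}" for s
  proof (cases "s \<in> Z")
    case False
    then have s': "s \<in> {a<..<b} - N" using s by (auto simp: Z_def)
    have "(y has_vector_derivative h s) (at s)"
      by (rule has_vector_derivative_transform_within_open[OF N(2)[OF s'], of "{a<..<b}"]) (use s' in \<open>auto simp: y_def\<close>)
    then have "((\<lambda>e. norm (y (s + e) - y s - e *\<^sub>R h s) / norm e) \<longlongrightarrow> 0) (at 0)"
      by (simp add: has_vector_derivative_def has_derivative_at)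
    then have "(\<lambda>k. norm (y (s + \<delta> k) - y s - \<delta> k *\<^sub>R h s) / norm (\<delta> k)) \<longlonglongrightarrow> 0"
      by (rule filterlim_compose) (use \<delta>0 \<delta> in \<open>auto simp: filterlim_at order_less_imp_not_eq2\<close>)
    moreover have "norm (y (s + \<delta> k) - y s - \<delta> k *\<^sub>R h s) / norm (\<delta> k) = norm (q k s - h s)" for k
    proof -
      have "q k s - h s = (1 / \<delta> k) *\<^sub>R (y (s + \<delta> k) - y s - \<delta> k *\<^sub>R h s)"
        using \<delta>[of k] by (simp add: q_def scaleR_diff_right)
      then show ?thesis by simp
    qed
    ultimately have "(\<lambda>k. norm (q k s - h s)) \<longlonglongrightarrow> 0" by simp
    then show ?thesis using False by (simp add: Q_def g_def LIM_zero_iff tendsto_norm_zero_iff)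
  qed (simp add: Q_def g_def)
  have dc: "g integrable_on {a..b}" "(\<lambda>k. integral {a..b} (Q k)) \<longlonglongrightarrow> integral {a..b} g"
    using dominated_convergence[of Q "{a..b}" "\<lambda>_. K" g] Qint qb lim by auto
  have val: "integral {a..b} (q k) = x b - (1 / \<delta> k) *\<^sub>R integral {a..a + \<delta> k} y" for k
  proof -
    have e1: "integral {a..b} (\<lambda>s. y (s + \<delta> k)) = integral {a + \<delta> k..b + \<delta> k} y"
      using integral_shift[of a "\<delta> k" b y] ycont by (simp add: o_def)
    have e2: "integral {a..a + \<delta> k} y + integral {a + \<delta> k..b + \<delta> k} y = integral {a..b + \<delta> k} y"
      using ab \<delta>[of k] by (intro Henstock_Kurzweil_Integration.integral_combine yint) auto
    have e3: "integral {a..b} y + integral {b..b + \<delta> k} y = integral {a..b + \<delta> k} y"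
      using ab \<delta>[of k] by (intro Henstock_Kurzweil_Integration.integral_combine yint) auto
    have e4: "integral {b..b + \<delta> k} y = \<delta> k *\<^sub>R x b"
    proof -
      have "integral {b..b + \<delta> k} y = integral {b..b + \<delta> k} (\<lambda>_. x b)"
        using ab by (intro integral_cong) (auto simp: y_def)
      then show ?thesis using \<delta>[of k] by simp
    qed
    have e5: "integral {a..b} (q k) = (1 / \<delta> k) *\<^sub>R (integral {a..b} (\<lambda>s. y (s + \<delta> k)) - integral {a..b} y)"
      unfolding q_def using yint
      by (subst integral_cmul, subst integral_diff)
        (auto intro!: integrable_continuous_real continuous_on_compose2[OF ycont[of UNIV]] continuous_intros)
    have alg: "J - B = C - A" if "A + J = W" "B + C = W" for A B C J W :: 'a
    proof -
      have "J = W - A" "C = W - B" using that by (metis add_diff_cancel_left')+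
      then show ?thesis by simp
    qed
    have "integral {a..b} (q k) = (1 / \<delta> k) *\<^sub>R (\<delta> k *\<^sub>R x b - integral {a..a + \<delta> k} y)"
      by (simp only: e5 e1 alg[OF e2 e3] e4)
    then show ?thesis using \<delta>[of k] by (simp add: scaleR_diff_right)
  qed
  have "(\<lambda>k. integral {a..b} (q k)) \<longlonglongrightarrow> x b - x a"
  proof -
    have "norm ((1 / \<delta> k) *\<^sub>R integral {a..a + \<delta> k} y - x a) \<le> K * \<delta> k" for k
    proof -
      have "norm (integral {a..a + \<delta> k} (\<lambda>s. y s - x a)) \<le> integral {a..a + \<delta> k} (\<lambda>s. K * \<delta> k)"
      proof (rule integral_norm_bound_integral)
        fix s assume s: "s \<in> {a..a + \<delta> k}"
        have "norm (y s - y a) \<le> K * norm (s - a)" using lipschitz_on_normD[OF ylip, of s a] by simp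
        also have "\<dots> \<le> K * \<delta> k" using s K by (intro mult_left_mono) auto
        finally show "norm (y s - x a) \<le> K * \<delta> k" using ab by (simp add: y_def)
      qed (auto intro!: integrable_diff yint)
      then have *: "norm (integral {a..a + \<delta> k} y - \<delta> k *\<^sub>R x a) \<le> K * \<delta> k * \<delta> k"
      proof -
        have "integral {a..a + \<delta> k} (\<lambda>s. y s - x a) = integral {a..a + \<delta> k} y - \<delta> k *\<^sub>R x a"
          using \<delta>[of k] by (subst integral_diff) (auto intro: yint)
        then show ?thesis
          using \<open>norm (integral {a..a + \<delta> k} (\<lambda>s. y s - x a)) \<le> _\<close> \<delta>[of k] by (simp add: mult_ac)
      qed
      have "(1 / \<delta> k) *\<^sub>R integral {a..a + \<delta> k} y - x a = (1 / \<delta> k) *\<^sub>R (integral {a..a + \<delta> k} y - \<delta> k *\<^sub>R x a)"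
        using \<delta>[of k] by (simp add: scaleR_diff_right)
      then show ?thesis using * \<delta>[of k] by (simp add: divide_le_eq)
    qed
    then have "eventually (\<lambda>k. norm ((1 / \<delta> k) *\<^sub>R integral {a..a + \<delta> k} y - x a) \<le> K * \<delta> k) sequentially"
      by (intro always_eventually allI)
    moreover have "(\<lambda>k. K * \<delta> k) \<longlonglongrightarrow> 0" by (rule tendsto_mult_right_zero[OF \<delta>0])
    ultimately have "(\<lambda>k. (1 / \<delta> k) *\<^sub>R integral {a..a + \<delta> k} y - x a) \<longlonglongrightarrow> 0"
      by (rule Lim_null_comparison)
    then show ?thesis unfolding val by (intro tendsto_diff[OF tendsto_const LIM_zero_cancel])
  qed
  then have "integral {a..b} g = x b - x a" using dc(2) unfolding Qeq by (rule LIMSEQ_unique[rotated])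
  then have "(g has_integral (x b - x a)) {a..b}" using integrable_integral[OF dc(1)] by (simp only:)
  then show ?thesis by (rule has_integral_spike[OF Z, rotated]) (auto simp: g_def)
qed

text \<open>\<open>ennreal\<close> cuts off negative values, so the positive and the negative part
  of \<open>k\<close> serve as densities. The two measures agree on all half-lines, hence
  everywhere, and by uniqueness of densities the two parts coincide a.e.; as they are never both
  positive, they vanish.\<close>

lemma AE_eq_0_if_integral_Ioi_eq_0:
  fixes k :: "real \<Rightarrow> real"
  assumes k: "integrable lborel k" and 0: "\<And>x. (LINT s:{x<..}|lborel. k s) = 0"
  shows "AE s in lborel. k s = 0"
proof -
  have [measurable]: "k \<in> borel_measurable borel" using k by auto
  have fin: "(\<integral>\<^sup>+s\<in>{x<..}. ennreal (k s) \<partial>lborel) < \<infinity> \<and> (\<integral>\<^sup>+s\<in>{x<..}. ennreal (- k s) \<partial>lborel) < \<infinity>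
    \<and> (\<integral>\<^sup>+s\<in>{x<..}. ennreal (k s) \<partial>lborel) = (\<integral>\<^sup>+s\<in>{x<..}. ennreal (- k s) \<partial>lborel)" for x
  proof -
    let ?f = "\<lambda>s. indicator {x<..} s *\<^sub>R k s"
    have i: "integrable lborel ?f" using k by (intro integrable_mult_indicator) auto
    have e1: "(\<integral>\<^sup>+s\<in>{x<..}. ennreal (k s) \<partial>lborel) = (\<integral>\<^sup>+s. ennreal (?f s) \<partial>lborel)"
      by (intro nn_integral_cong) (auto simp: indicator_def)
    have e2: "(\<integral>\<^sup>+s\<in>{x<..}. ennreal (- k s) \<partial>lborel) = (\<integral>\<^sup>+s. ennreal (- ?f s) \<partial>lborel)"
      by (intro nn_integral_cong) (auto simp: indicator_def)
    have f1: "(\<integral>\<^sup>+s. ennreal (?f s) \<partial>lborel) < \<infinity>" "(\<integral>\<^sup>+s. ennreal (- ?f s) \<partial>lborel) < \<infinity>"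
      using i unfolding real_integrable_def by (auto simp: less_top)
    have "enn2real (\<integral>\<^sup>+s. ennreal (?f s) \<partial>lborel) - enn2real (\<integral>\<^sup>+s. ennreal (- ?f s) \<partial>lborel) = 0"
      using 0[of x] real_lebesgue_integral_def[OF i] by (simp add: set_lebesgue_integral_def)
    then have "(\<integral>\<^sup>+s. ennreal (?f s) \<partial>lborel) = (\<integral>\<^sup>+s. ennreal (- ?f s) \<partial>lborel)"
      using f1 by (metis diff_eq_diff_less_eq eq_iff_diff_eq_0 ennreal_enn2real infinity_ennreal_def)
    then show ?thesis using e1 e2 f1 by simp
  qed
  have "density lborel (\<lambda>s. ennreal (k s)) = density lborel (\<lambda>s. ennreal (- k s))"
    by (rule measure_eqI_lessThan) (use fin in \<open>auto simp: emeasure_density\<close>)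
  then have "AE s in lborel. ennreal (k s) = ennreal (- k s)"
    by (intro sigma_finite_measure.density_unique[OF sigma_finite_lborel]) auto
  then show ?thesis
  proof eventually_elim
    case (elim s)
    then show ?case by (cases "k s \<ge> 0") (auto simp: ennreal_neg)
  qed
qed

text \<open>\<open>k\<close> is extended by 0 and replaced by a Borel function equal to it a.e.,
  which moves the question from the completed measure to \<open>lborel\<close>. Integrals over
  half-lines are then differences of integrals over initial segments.\<close>

lemma AE_eq_0_if_integral_eq_0:
  fixes k :: "real \<Rightarrow> real"
  assumes k: "k absolutely_integrable_on {a..b}" and 0: "\<And>u. u \<in> {a..b} \<Longrightarrow> integral {a..u} k = 0"
  shows "AE s in lebesgue. s \<in> {a..b} \<longrightarrow> k s = 0"
proof (cases "a \<le> b")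
  case True
  define f where "f s = indicator {a..b} s *\<^sub>R k s" for s
  have f: "integrable lebesgue f" using k unfolding f_def set_integrable_def .
  obtain g where g: "g \<in> borel_measurable lborel" "AE s in lborel. f s = g s"
    using completion_ex_borel_measurable_real[of f lborel] f by auto
  have fg: "AE s in lebesgue. f s = g s" using g(2) AE_completion by blast
  have gi: "integrable lebesgue g" using f fg g integrable_cong_AE[of f lebesgue g]
    by (metis borel_measurable_integrable measurable_completion)
  then have gl: "integrable lborel g" using g(1) integrable_completion by blast
  have "AE s in lborel. g s = 0"
  proof (rule AE_eq_0_if_integral_Ioi_eq_0[OF gl])
    fix x :: real
    \<comment> \<open>Within \<open>{a..b}\<close> the half-line \<open>{x<..}\<close> is
      \<open>{c<..b}\<close>, except that for \<open>x < a\<close> the single point \<open>a\<close>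
      is lost.\<close>
    define c where "c = max a (min b x)"
    have c: "a \<le> c" "c \<le> b" using True by (auto simp: c_def)
    have ki: "k integrable_on {a..b}" using k set_lebesgue_integral_eq_integral(1) by blast
    have "(LINT s:{x<..}|lborel. g s) = (LINT s:{x<..}|lebesgue. g s)"
      unfolding set_lebesgue_integral_def using g(1) by (intro integral_completion[symmetric]) auto
    also have "\<dots> = (LINT s:{x<..}|lebesgue. f s)"
      using fg by (intro set_lebesgue_integral_cong_AE) (use f gi in auto)
    also have "\<dots> = (LINT s:{c<..b}|lebesgue. k s)"
      unfolding set_lebesgue_integral_def f_def
    proof (rule Bochner_Integration.integral_cong_AE)
      show "AE s in lebesgue. indicat_real {x<..} s *\<^sub>R indicat_real {a..b} s *\<^sub>R k s = indicat_real {c<..b} s *\<^sub>R k s"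
      proof (rule AE_I'[of "{a}"])
        show "{s \<in> space lebesgue. indicat_real {x<..} s *\<^sub>R indicat_real {a..b} s *\<^sub>R k s \<noteq> indicat_real {c<..b} s *\<^sub>R k s} \<subseteq> {a}"
          using True by (auto simp: c_def indicator_def split: if_splits)
      qed auto
      have fm: "f \<in> borel_measurable lebesgue" using f by auto
      have "(\<lambda>s. indicat_real {c<..b} s *\<^sub>R (indicat_real {a..b} s *\<^sub>R k s)) \<in> borel_measurable lebesgue"
        using fm unfolding f_def[symmetric] by (intro borel_measurable_scaleR borel_measurable_indicator) auto
      moreover have "(\<lambda>s. indicat_real {c<..b} s *\<^sub>R (indicat_real {a..b} s *\<^sub>R k s)) = (\<lambda>s. indicat_real {c<..b} s *\<^sub>R k s)"
        using c by (auto simp: indicator_def)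
      ultimately show "(\<lambda>s. indicat_real {c<..b} s *\<^sub>R k s) \<in> borel_measurable lebesgue" by simp
      show "(\<lambda>s. indicat_real {x<..} s *\<^sub>R indicat_real {a..b} s *\<^sub>R k s) \<in> borel_measurable lebesgue"
        using fm unfolding f_def[symmetric] by (intro borel_measurable_scaleR borel_measurable_indicator) auto
    qed
    also have "\<dots> = integral {c<..b} k"
      by (rule set_lebesgue_integral_eq_integral(2)) (rule set_integrable_subset[OF k], use c in auto)
    also have "\<dots> = integral {c..b} k"
      by (rule integral_subset_negligible) (auto intro: negligible_subset[of "{c}"])
    also have "\<dots> = integral {a..b} k - integral {a..c} k"
      using Henstock_Kurzweil_Integration.integral_combine[OF c ki] by simp
    also have "\<dots> = 0" using 0 c by simp
    finally show "(LINT s:{x<..}|lborel. g s) = 0" .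
  qed
  then have "AE s in lebesgue. g s = 0" using AE_completion by blast
  with fg show ?thesis by eventually_elim (auto simp: f_def)
qed auto

section \<open>Differentiation of indefinite integrals of bounded functions\<close>

lemma bounded_integrable_abs_integrable:
  fixes h :: "real \<Rightarrow> 'a::euclidean_space"
  assumes h: "h integrable_on {a..b}" and b: "\<And>s. s \<in> {a..b} \<Longrightarrow> norm (h s) \<le> M"
  shows "h absolutely_integrable_on {a..b}"
  by (rule measurable_bounded_by_integrable_imp_absolutely_integrable[where g="\<lambda>_. M"])
    (use assms in \<open>auto intro: integrable_imp_measurable\<close>)

text \<open>The primitive is Lipschitz, hence has a derivative \<open>D\<close> a.e. and is the
  integral of it; \<open>D\<close> and \<open>h\<close> have the same integral over every initial
  segment and so agree a.e. In the application \<open>h\<close> is the velocity under a measurable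
  control and has no continuity to rely on.\<close>

lemma indefinite_integral_derivative_AE:
  fixes h :: "real \<Rightarrow> 'a::euclidean_space"
  assumes h: "h integrable_on {a..b}" and b: "\<And>s. s \<in> {a..b} \<Longrightarrow> norm (h s) \<le> M"
  shows "AE s in lebesgue. s \<in> {a<..<b} \<longrightarrow> ((\<lambda>u. integral {a..u} h) has_vector_derivative h s) (at s)"
proof (cases "a \<le> b")
  case True
  define F where "F u = integral {a..u} h" for u
  have M: "M \<ge> 0" using order_trans[OF norm_ge_zero b[of a]] True by simp
  have hsub: "h integrable_on {u..v}" if "a \<le> u" "v \<le> b" for u v
    by (rule integrable_subinterval_real[OF h]) (use that in auto)
  have lip: "lipschitz_on M {a..b} F"
  proof (rule lipschitz_on_leI)
    fix u v assume uv: "u \<in> {a..b}" "v \<in> {a..b}" "u \<le> v"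
    have "F v - F u = integral {u..v} h"
      using Henstock_Kurzweil_Integration.integral_combine[of a u v h] hsub[of a v] uv by (simp add: F_def algebra_simps)
    also have "norm \<dots> \<le> integral {u..v} (\<lambda>_. M)"
      using uv b hsub by (intro integral_norm_bound_integral) auto
    finally show "dist (F u) (F v) \<le> M * dist u v" using uv by (simp add: dist_norm norm_minus_commute mult.commute)
  qed (fact M)
  define D where "D s = vector_derivative F (at s)" for s
  have dF: "AE s in lebesgue. s \<in> {a<..<b} \<longrightarrow> (F has_vector_derivative D s) (at s)"
    using lipschitz_differentiable_AE[OF lip] unfolding D_def by (simp add: vector_derivative_works)
  have Dint: "(D has_integral F u - F a) {a..u}" if "u \<in> {a..b}" for u
  proof (rule lipschitz_has_integral_derivative)
    show "lipschitz_on M {a..u} F" using lip by (rule lipschitz_on_subset) (use that in auto)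
    show "AE s in lebesgue. s \<in> {a<..<u} \<longrightarrow> (F has_vector_derivative D s) (at s)"
      using dF by eventually_elim (use that in auto)
  qed (use that in auto)
  \<comment> \<open>Where \<open>F\<close> is not differentiable, \<open>D\<close> is an arbitrary
    value. The truncation changes \<open>D\<close> only on a null set of the open interval, since
    \<open>M\<close> is a Lipschitz constant of \<open>F\<close>, and makes it bounded, so that
    \<open>E - h\<close> is absolutely integrable.\<close>
  define E where "E s = (if norm (D s) \<le> M then D s else 0)" for s
  have DE: "AE s in lebesgue. s \<in> {a<..<b} \<longrightarrow> D s = E s"
    using dF
  proof eventually_elim
    case (elim s)
    show ?case
    proof
      assume s: "s \<in> {a<..<b}"
      then have "((\<lambda>e. norm (F (s + e) - F s - e *\<^sub>R D s) / norm e) \<longlongrightarrow> 0) (at 0)"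
        using elim by (simp add: has_vector_derivative_def has_derivative_at)
      have "norm (D s) \<le> M + e" if e: "e > 0" for e
      proof -
        obtain d where d: "d > 0" "\<And>v. v \<noteq> 0 \<Longrightarrow> \<bar>v\<bar> < d \<Longrightarrow> norm (F (s + v) - F s - v *\<^sub>R D s) / \<bar>v\<bar> < e"
          using LIM_D[OF \<open>(_ \<longlongrightarrow> 0) (at 0)\<close> e] by auto
        define v where "v = min (d / 2) ((b - s) / 2)"
        have v: "v > 0" "v < d" "s + v \<in> {a..b}" using d s by (auto simp: v_def min_def field_simps)
        have "norm (F (s + v) - F s - v *\<^sub>R D s) < e * v" using d(2)[of v] v by (simp add: divide_less_eq)
        moreover have "norm (F (s + v) - F s) \<le> M * v"
          using lipschitz_on_normD[OF lip v(3), of s] s v(1) by simp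
        moreover have "norm (v *\<^sub>R D s) \<le> norm (F (s + v) - F s) + norm (F (s + v) - F s - v *\<^sub>R D s)"
          by (metis norm_triangle_sub norm_minus_commute add.commute)
        ultimately have "v * norm (D s) \<le> v * (M + e)" using v(1) by (simp add: algebra_simps)
        then show ?thesis using v(1) by simp
      qed
      then have "norm (D s) \<le> M" by (rule field_le_epsilon)
      then show "D s = E s" by (simp add: E_def)
    qed
  qed
  obtain N0 where N0: "negligible N0" "\<And>s. s \<notin> N0 \<Longrightarrow> s \<in> {a<..<b} \<longrightarrow> D s = E s"
    by (rule AE_lebesgue_negligibleE[OF DE]) (rule that)
  define N where "N = N0 \<union> {a, b}"
  have N: "negligible N" "\<And>s. s \<in> {a..b} - N \<Longrightarrow> D s = E s"
    using N0 by (auto simp: N_def)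
  have Eint: "(E has_integral F u - F a) {a..u}" if "u \<in> {a..b}" for u
    by (rule has_integral_spike[OF N(1) _ Dint[OF that]]) (use N(2) that in auto)
  have comp: "AE s in lebesgue. s \<in> {a..b} \<longrightarrow> (E s - h s) \<bullet> i = 0" if i: "i \<in> Basis" for i
  proof (rule AE_eq_0_if_integral_eq_0)
    have "(\<lambda>s. E s - h s) absolutely_integrable_on {a..b}"
    proof (rule bounded_integrable_abs_integrable[where M="M + M"])
      show "(\<lambda>s. E s - h s) integrable_on {a..b}" using Eint[of b] h True by (intro integrable_diff) auto
      show "norm (E s - h s) \<le> M + M" if "s \<in> {a..b}" for s
        using b[OF that] M by (intro norm_triangle_le_diff add_mono) (auto simp: E_def)
    qed
    then show "(\<lambda>s. (E s - h s) \<bullet> i) absolutely_integrable_on {a..b}"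
      using absolutely_integrable_component i by blast
    fix u assume u: "u \<in> {a..b}"
    have "((\<lambda>s. E s - h s) has_integral F u - F a - F u) {a..u}"
      using Eint[OF u] hsub[of a u] u unfolding F_def by (intro has_integral_diff integrable_integral) auto
    moreover have "F a = 0" by (simp add: F_def)
    ultimately have "((\<lambda>s. E s - h s) has_integral 0) {a..u}" by simp
    from has_integral_linear[OF this bounded_linear_inner_left[of i]]
    show "integral {a..u} (\<lambda>s. (E s - h s) \<bullet> i) = 0" by (simp add: o_def integral_unique)
  qed
  then have "AE s in lebesgue. \<forall>i\<in>Basis. s \<in> {a..b} \<longrightarrow> (E s - h s) \<bullet> i = 0" by (intro AE_finite_allI) auto
  then have Eh: "AE s in lebesgue. s \<in> {a..b} \<longrightarrow> E s = h s"
    by eventually_elim (auto intro: euclidean_eqI simp: inner_diff_left)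
  show ?thesis using dF DE Eh by eventually_elim (auto simp: F_def[abs_def])
qed auto

lemma gronwall:
  fixes e :: "real \<Rightarrow> real"
  assumes cont: "continuous_on {t..T} e" and b: "b \<ge> 0"
    and le: "\<And>s. s \<in> {t..T} \<Longrightarrow> e s \<le> a + b * integral {t..s} e"
    and s: "s \<in> {t..T}"
  shows "e s \<le> a * exp (b * (s - t))"
proof -
  define I where "I u = integral {t..u} e" for u
  have dI: "(I has_real_derivative e u) (at u within {t..T})" if "u \<in> {t..T}" for u
    using integral_has_real_derivative[OF cont that] unfolding I_def .
  \<comment> \<open>Integrating factor: the assumed inequality for \<open>e\<close> says that
    \<open>\<Psi>\<close> has a nonpositive derivative, whatever the sign of
    \<open>a\<close>.\<close>
  define \<Psi> where "\<Psi> u = (a + b * I u) * exp (- b * (u - t))" for u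
  have "\<Psi> s \<le> \<Psi> t"
  proof (rule DERIV_nonpos_imp_decreasing_open[of t s \<Psi>])
    show "t \<le> s" using s by simp
    have "continuous_on {t..T} I" using dI by (rule DERIV_continuous_on)
    then have "continuous_on {t..s} I" by (rule continuous_on_subset) (use s in auto)
    then show "continuous_on {t..s} \<Psi>" unfolding \<Psi>_def by (intro continuous_intros)
    fix u assume u: "t < u" "u < s"
    then have "(I has_real_derivative e u) (at u)"
      using dI[of u] s at_within_Icc_at[of t u T] by auto
    then have "(\<Psi> has_real_derivative (b * e u) * exp (- b * (u - t)) + (a + b * I u) * (exp (- b * (u - t)) * (- b))) (at u)"
      unfolding \<Psi>_def by (auto intro!: derivative_eq_intros)
    moreover have "(b * e u) * exp (- b * (u - t)) + (a + b * I u) * (exp (- b * (u - t)) * (- b)) = b * exp (- b * (u - t)) * (e u - (a + b * I u))"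
      by (simp add: algebra_simps)
    moreover have "\<dots> \<le> 0"
      using le[of u] u s b by (intro mult_nonneg_nonpos) (auto simp: I_def)
    ultimately show "\<exists>y. (\<Psi> has_real_derivative y) (at u) \<and> y \<le> 0" by auto
  qed
  then have "(a + b * I s) * exp (- b * (s - t)) \<le> a" by (simp add: \<Psi>_def I_def)
  then have "(a + b * I s) * exp (- b * (s - t)) * exp (b * (s - t)) \<le> a * exp (b * (s - t))"
    by (intro mult_right_mono) auto
  moreover have "(a + b * I s) * exp (- b * (s - t)) * exp (b * (s - t)) = a + b * I s"
  proof -
    have "exp (- b * (s - t)) * exp (b * (s - t)) = 1" by (simp add: mult_exp_exp)
    then show ?thesis by (simp only: mult.assoc mult_1_right)
  qed
  ultimately have "a + b * I s \<le> a * exp (b * (s - t))" by linarith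
  then show ?thesis using le[OF s] unfolding I_def by linarith
qed

section \<open>Histories and the delayed time\<close>

lemma has_integral_le_AE:
  fixes h k :: "real \<Rightarrow> real"
  assumes h: "(h has_integral I) {u..v}" and k: "(k has_integral J) {u..v}"
    and le: "AE s in lebesgue. s \<in> {u<..<v} \<longrightarrow> h s \<le> k s"
  shows "I \<le> J"
proof -
  obtain N where N: "negligible N" "\<And>s. s \<notin> N \<Longrightarrow> s \<in> {u<..<v} \<longrightarrow> h s \<le> k s"
    by (rule AE_lebesgue_negligibleE[OF le]) (rule that)
  \<comment> \<open>Passing to the maximum turns the a.e. inequality into one at every point, at the
    cost of a change on a null set.\<close>
  have "((\<lambda>s. max (h s) (k s)) has_integral J) {u..v}"
    by (rule has_integral_spike[OF _ _ k, of "N \<union> {u, v}"]) (use N in fastforce)+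
  then show ?thesis by (rule has_integral_le[OF h]) simp
qed

lemma has_integral_norm_le_AE:
  fixes h :: "real \<Rightarrow> 'a::euclidean_space"
  assumes h: "(h has_integral I) {u..v}" and R: "0 \<le> R" "u \<le> v"
    and le: "AE s in lebesgue. s \<in> {u<..<v} \<longrightarrow> norm (h s) \<le> R"
  shows "norm I \<le> R * (v - u)"
proof -
  obtain N where N: "negligible N" "\<And>s. s \<notin> N \<Longrightarrow> s \<in> {u<..<v} \<longrightarrow> norm (h s) \<le> R"
    by (rule AE_lebesgue_negligibleE[OF le]) (rule that)
  have "((\<lambda>s. if norm (h s) \<le> R then h s else 0) has_integral I) {u..v}"
    by (rule has_integral_spike[OF _ _ h, of "N \<union> {u, v}"]) (use N in fastforce)+
  from has_integral_bound_real[OF R(1) finite.emptyI this] show ?thesis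
    using R by auto
qed

lemma L1_norm_eq_integral:
  assumes "continuous_on {-taubar..0} w"
  shows "L1_norm taubar w = integral {-taubar..0} (\<lambda>\<theta>. norm (w \<theta>))"
  unfolding L1_norm_def
  by (intro set_lebesgue_integral_eq_integral(2) absolutely_integrable_continuous_real continuous_on_norm assms)

text \<open>The analogue of \<open>V_set\<close> with a Lipschitz constant in place of a bound on
  the derivative; in this form membership passes directly to the histories of a trajectory.\<close>

definition W_set :: "real \<Rightarrow> real \<Rightarrow> (real \<Rightarrow> real ^ 'n::finite) set" where
  "W_set taubar R = {w \<in> extensional {-taubar..0}. lipschitz_on R {-taubar..0} w \<and>
     (\<forall>\<theta>\<in>{-taubar..0}. norm (w \<theta>) \<le> R)}"

lemma W_setD:
  assumes "w \<in> W_set taubar R"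
  shows "w \<in> extensional {-taubar..0}" "lipschitz_on R {-taubar..0} w"
    "\<And>\<theta>. \<theta> \<in> {-taubar..0} \<Longrightarrow> norm (w \<theta>) \<le> R" "w \<in> lip_space {-taubar..0}"
    "continuous_on {-taubar..0} w"
  using assms lipschitz_on_continuous_on unfolding W_set_def lip_space_def by blast+

lemma W_set_mono: "w \<in> W_set taubar R \<Longrightarrow> R \<le> R' \<Longrightarrow> w \<in> W_set taubar R'"
  unfolding W_set_def by (auto intro: lipschitz_on_le order_trans)

lemma lip_space_bounded:
  assumes "w \<in> lip_space {-taubar..0}"
  obtains B where "\<And>\<theta>. \<theta> \<in> {-taubar..0} \<Longrightarrow> norm (w \<theta>) \<le> B"
proof -
  have "continuous_on {-taubar..0} w" using assms lipschitz_on_continuous_on unfolding lip_space_def by blast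
  then have "bounded (w ` {-taubar..0})" by (intro compact_imp_bounded compact_continuous_image) auto
  then show ?thesis using that unfolding bounded_iff by blast
qed

lemma lip_space_W_set:
  assumes "w \<in> lip_space {-taubar..0}"
  obtains R where "R > 0" "w \<in> W_set taubar R"
proof -
  obtain B where B: "\<And>\<theta>. \<theta> \<in> {-taubar..0} \<Longrightarrow> norm (w \<theta>) \<le> B" using lip_space_bounded[OF assms] by blast
  obtain C where C: "lipschitz_on C {-taubar..0} w" using assms unfolding lip_space_def by blast
  have "C \<ge> 0" using C lipschitz_on_nonneg by blast
  define R where "R = C + \<bar>B\<bar> + 1"
  have R: "R > 0" "C \<le> R" "B \<le> R" using \<open>C \<ge> 0\<close> by (auto simp: R_def)
  have "lipschitz_on R {-taubar..0} w" using C R(2) by (rule lipschitz_on_le)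
  moreover have "\<forall>\<theta>\<in>{-taubar..0}. norm (w \<theta>) \<le> R" using B R(3) by (meson order_trans)
  ultimately have "w \<in> W_set taubar R" using assms unfolding W_set_def lip_space_def by blast
  with R(1) show ?thesis by (rule that)
qed

lemma norm_le_sup_norm:
  assumes "w \<in> lip_space {-taubar..0}" "\<theta> \<in> {-taubar..0}"
  shows "norm (w \<theta>) \<le> sup_norm taubar w"
proof -
  obtain B where B: "\<And>\<theta>. \<theta> \<in> {-taubar..0} \<Longrightarrow> norm (w \<theta>) \<le> B" using lip_space_bounded[OF assms(1)] by blast
  show ?thesis unfolding sup_norm_def
    by (rule cSUP_upper[OF assms(2)]) (rule bdd_aboveI2[where M=B], rule B)
qed

lemma P_set_iff:
  assumes "0 \<le> taubar"
  shows "w \<in> P_set taubar R \<longleftrightarrow> w \<in> lip_space {-taubar..0} \<and> (\<forall>\<theta>\<in>{-taubar..0}. norm (w \<theta>) \<le> R)"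
proof
  assume "w \<in> P_set taubar R"
  then show "w \<in> lip_space {-taubar..0} \<and> (\<forall>\<theta>\<in>{-taubar..0}. norm (w \<theta>) \<le> R)"
    using norm_le_sup_norm unfolding P_set_def by (metis (mono_tags, lifting) mem_Collect_eq order_trans)
next
  assume w: "w \<in> lip_space {-taubar..0} \<and> (\<forall>\<theta>\<in>{-taubar..0}. norm (w \<theta>) \<le> R)"
  have "sup_norm taubar w \<le> R" unfolding sup_norm_def
    by (rule cSUP_least) (use w assms in auto)
  then show "w \<in> P_set taubar R" using w by (simp add: P_set_def)
qed

lemma W_set_P_set: "0 \<le> taubar \<Longrightarrow> w \<in> W_set taubar R \<Longrightarrow> w \<in> P_set taubar R"
  using P_set_iff W_setD by blast

text \<open>An a.e. bound on the derivative bounds increments because a Lipschitz function is the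
  integral of its derivative. This links the class in \<open>Phi_class\<close> with the one in which
  the estimates are made.\<close>

lemma V_set_subset_W_set:
  assumes tb: "0 \<le> taubar"
  shows "V_set taubar R \<subseteq> W_set taubar R"
proof
  fix w :: "real \<Rightarrow> real ^ 'n" assume w: "w \<in> V_set taubar R"
  have wl: "w \<in> lip_space {-taubar..0}" and wb: "\<And>\<theta>. \<theta> \<in> {-taubar..0} \<Longrightarrow> norm (w \<theta>) \<le> R"
    using w P_set_iff[OF tb, of w R] unfolding V_set_def by blast+
  have R: "0 \<le> R" using order_trans[OF norm_ge_zero wb[of 0]] tb by simp
  obtain C where C: "lipschitz_on C {-taubar..0} w" using wl unfolding lip_space_def by blast
  define D where "D s = vector_derivative w (at s)" for s
  have dw: "AE s in lebesgue. s \<in> {-taubar<..<0} \<longrightarrow> (w has_vector_derivative D s) (at s)"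
    using lipschitz_differentiable_AE[OF C] unfolding D_def by (simp add: vector_derivative_works)
  have Db: "AE s in lebesgue. s \<in> {-taubar<..<0} \<longrightarrow> norm (D s) \<le> R"
    using w unfolding V_set_def D_def by blast
  have "lipschitz_on R {-taubar..0} w"
  proof (rule lipschitz_on_leI)
    fix u v assume uv: "u \<in> {-taubar..0}" "v \<in> {-taubar..0}" "u \<le> v"
    have "lipschitz_on C {u..v} w" using C by (rule lipschitz_on_subset) (use uv in auto)
    moreover have "AE s in lebesgue. s \<in> {u<..<v} \<longrightarrow> (w has_vector_derivative D s) (at s)"
      using dw by eventually_elim (use uv in auto)
    ultimately have "(D has_integral w v - w u) {u..v}"
      by (intro lipschitz_has_integral_derivative) (use uv in auto)
    moreover have "AE s in lebesgue. s \<in> {u<..<v} \<longrightarrow> norm (D s) \<le> R"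
      using Db by eventually_elim (use uv in auto)
    ultimately have "norm (w v - w u) \<le> R * (v - u)"
      by (intro has_integral_norm_le_AE) (use R uv in auto)
    then show "dist (w u) (w v) \<le> R * dist u v" using uv(3) by (simp add: dist_norm norm_minus_commute)
  qed (fact R)
  then show "w \<in> W_set taubar R" using wl wb unfolding W_set_def lip_space_def by blast
qed

locale delay_control =
  fixes t0 T taubar lam_f C_f C_L lam_tau :: real
    and A :: "(real ^ 'm::finite) set"
    and f :: "real \<Rightarrow> real ^ 'n::finite \<Rightarrow> real ^ 'n \<Rightarrow> real ^ 'm \<Rightarrow> real ^ 'n"
    and L :: "real \<Rightarrow> real ^ 'n \<Rightarrow> real ^ 'n \<Rightarrow> real ^ 'm \<Rightarrow> real"
    and g :: "(real ^ 'n) \<times> (real \<Rightarrow> real ^ 'n) \<Rightarrow> real"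
    and \<tau> \<tau>t :: "real \<Rightarrow> real ^ 'n \<Rightarrow> real"
    and \<tau>z :: "real \<Rightarrow> real ^ 'n \<Rightarrow> real ^ 'n"
  assumes time: "t0 < T"
    and A_nonempty: "A \<noteq> {}" and A_compact: "compact A"
    and f_cont: "continuous_on ({t0..T} \<times> UNIV \<times> UNIV \<times> A) (\<lambda>(t, z, y, a). f t z y a)"
    and L_cont: "continuous_on ({t0..T} \<times> UNIV \<times> UNIV \<times> A) (\<lambda>(t, z, y, a). L t z y a)"
    and lam_f_pos: "lam_f > 0"
    and f_lip: "\<And>t z y z' y' a. t \<in> {t0..T} \<Longrightarrow> a \<in> A \<Longrightarrow>
         norm (f t z y a - f t z' y' a) \<le> lam_f * (norm (z - z') + norm (y - y'))"
    and C_f_pos: "C_f > 0"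
    and f_growth: "\<And>t z y a. t \<in> {t0..T} \<Longrightarrow> a \<in> A \<Longrightarrow> norm (f t z y a) \<le> C_f * (1 + norm z + norm y)"
    and L_lip: "\<And>R. R > 0 \<Longrightarrow> \<exists>lam>0. \<forall>t\<in>{t0..T}. \<forall>a\<in>A.
         \<forall>z\<in>cball 0 R. \<forall>y\<in>cball 0 R. \<forall>z'\<in>cball 0 R. \<forall>y'\<in>cball 0 R.
           \<bar>L t z y a - L t z' y' a\<bar> \<le> lam * (norm (z - z') + norm (y - y'))"
    and C_L_pos: "C_L > 0"
    and L_growth: "\<And>t z y a. t \<in> {t0..T} \<Longrightarrow> a \<in> A \<Longrightarrow> \<bar>L t z y a\<bar> \<le> C_L * (1 + norm z + norm y)"
    and g_lip: "\<And>R. R > 0 \<Longrightarrow> \<exists>lam>0. \<forall>z1 w1 z2 w2.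
         (z1, w1) \<in> X_space taubar \<longrightarrow> (z2, w2) \<in> X_space taubar \<longrightarrow>
         w1 \<in> P_set taubar R \<longrightarrow> w2 \<in> P_set taubar R \<longrightarrow>
           \<bar>g (z1, w1) - g (z2, w2)\<bar> \<le> lam * X_norm taubar (z1 - z2, \<lambda>\<theta>. w1 \<theta> - w2 \<theta>)"
    and tau_nonneg: "\<And>t z. t \<in> {t0..T} \<Longrightarrow> 0 \<le> \<tau> t z"
    and tau_C1: "C1_with ({t0..T} \<times> UNIV) \<tau> \<tau>t \<tau>z"
    and tau_le: "\<And>t z. t \<in> {t0..T} \<Longrightarrow> \<tau> t z \<le> taubar"
    and lam_tau_pos: "lam_tau > 0"
    and tau_lip: "\<And>t z y. t \<in> {t0..T} \<Longrightarrow> \<bar>\<tau> t z - \<tau> t y\<bar> \<le> lam_tau * norm (z - y)"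
    and monotone_delay: "\<And>r. r > 0 \<Longrightarrow> \<exists>d>0. \<forall>t\<in>{t0..T}. \<forall>w\<in>P_set taubar r. \<forall>\<alpha>\<in>controls A t T. \<forall>x.
         is_trajectory T taubar \<tau> f t w \<alpha> x \<longrightarrow>
         (AE s in lebesgue. s \<in> {t..T} \<longrightarrow>
            1 - \<tau>t s (x s) - \<tau>z s (x s) \<bullet> vector_derivative x (at s) \<ge> d)"
begin

abbreviation traj :: "real \<Rightarrow> (real \<Rightarrow> real ^ 'n) \<Rightarrow> (real \<Rightarrow> real ^ 'm) \<Rightarrow> (real \<Rightarrow> real ^ 'n) \<Rightarrow> bool" where
  "traj \<equiv> is_trajectory T taubar \<tau> f"

abbreviation ctrl :: "real \<Rightarrow> (real \<Rightarrow> real ^ 'm) set" where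
  "ctrl t \<equiv> controls A t T"

definition rtime :: "(real \<Rightarrow> real ^ 'n) \<Rightarrow> real \<Rightarrow> real" where
  "rtime x s = s - \<tau> s (x s)"

lemma taubar_nonneg: "0 \<le> taubar"
  using tau_nonneg[of t0 0] tau_le[of t0 0] time by simp

lemma rtime_bounds:
  assumes "t0 \<le> s" "s \<le> T"
  shows "s - taubar \<le> rtime x s" "rtime x s \<le> s"
  using tau_nonneg[of s "x s"] tau_le[of s "x s"] assms unfolding rtime_def by auto

lemma ctrlD: "\<alpha> \<in> ctrl t \<Longrightarrow> r \<in> {t<..<T} \<Longrightarrow> \<alpha> r \<in> A"
  unfolding controls_def by blast

lemma ctrl_const: "a \<in> A \<Longrightarrow> (\<lambda>_. a) \<in> ctrl t"
  unfolding controls_def by auto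

lemma traj_lip:
  assumes "traj t w \<alpha> x"
  obtains K where "lipschitz_on K {t - taubar..T} x"
  using assms unfolding is_trajectory_def lip_space_def by blast

lemma traj_cont: "traj t w \<alpha> x \<Longrightarrow> continuous_on {t - taubar..T} x"
  using traj_lip lipschitz_on_continuous_on by metis

lemma traj_init: "traj t w \<alpha> x \<Longrightarrow> \<theta> \<in> {-taubar..0} \<Longrightarrow> x (t + \<theta>) = w \<theta>"
  unfolding is_trajectory_def by blast

lemma traj_start: "traj t w \<alpha> x \<Longrightarrow> x t = w 0"
  using traj_init[of t w \<alpha> x 0] taubar_nonneg by simp

lemma traj_deriv:
  assumes "traj t w \<alpha> x"
  shows "AE s in lebesgue. s \<in> {t<..<T} \<longrightarrow>
    (x has_vector_derivative f s (x s) (x (rtime x s)) (\<alpha> s)) (at s)"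
  using assms unfolding is_trajectory_def rtime_def by blast

text \<open>Integral form of the state equation; the fundamental theorem for Lipschitz curves
  provides the integrability of the velocity together with its integral.\<close>

lemma traj_has_integral:
  assumes x: "traj t w \<alpha> x" and uv: "t \<le> u" "u \<le> v" "v \<le> T"
  shows "((\<lambda>s. f s (x s) (x (rtime x s)) (\<alpha> s)) has_integral x v - x u) {u..v}"
proof -
  obtain K where "lipschitz_on K {t - taubar..T} x" using traj_lip[OF x] by blast
  then have "lipschitz_on K {u..v} x"
    by (rule lipschitz_on_subset) (use uv taubar_nonneg in auto)
  moreover have "AE s in lebesgue. s \<in> {u<..<v} \<longrightarrow>
      (x has_vector_derivative f s (x s) (x (rtime x s)) (\<alpha> s)) (at s)"
    using traj_deriv[OF x] by eventually_elim (use uv in auto)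
  ultimately show ?thesis by (intro lipschitz_has_integral_derivative uv(2))
qed

lemma tau_has_derivative:
  assumes "t \<in> {t0..T}"
  shows "((\<lambda>(s, y). \<tau> s y) has_derivative (\<lambda>(h, k). \<tau>t t z * h + \<tau>z t z \<bullet> k))
    (at (t, z) within {t0..T} \<times> UNIV)"
  using tau_C1 assms unfolding C1_with_def by blast

lemma tau_continuous: "continuous_on ({t0..T} \<times> UNIV) (\<lambda>(t, z). \<tau> t z)"
  unfolding continuous_on_eq_continuous_within
  using tau_has_derivative has_derivative_continuous by fastforce

text \<open>\<open>lam_tau\<close> controls only the space variable. A joint Lipschitz constant in
  time and space comes from bounded derivatives on a compact convex set, and makes the delayed time
  Lipschitz along a trajectory.\<close>

lemma tau_lipschitz_on_cball:
  obtains M where "lipschitz_on M ({t0..T} \<times> cball 0 B) (\<lambda>(t, z). \<tau> t z)"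
proof -
  have comp: "compact ({t0..T} \<times> cball (0::real^'n) B)" by (intro compact_Times) auto
  have c: "continuous_on ({t0..T} \<times> cball 0 B) (\<lambda>(t, z). \<tau>t t z)" "continuous_on ({t0..T} \<times> cball 0 B) (\<lambda>(t, z). \<tau>z t z)"
    using tau_C1 unfolding C1_with_def by (meson continuous_on_subset Sigma_mono order_refl subset_UNIV)+
  obtain B1 where B1: "\<And>p. p \<in> {t0..T} \<times> cball 0 B \<Longrightarrow> norm ((\<lambda>(t, z). \<tau>t t z) p) \<le> B1"
    using compact_imp_bounded[OF compact_continuous_image[OF c(1) comp]] unfolding bounded_iff by blast
  obtain B2 where B2: "\<And>p. p \<in> {t0..T} \<times> cball 0 B \<Longrightarrow> norm ((\<lambda>(t, z). \<tau>z t z) p) \<le> B2"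
    using compact_imp_bounded[OF compact_continuous_image[OF c(2) comp]] unfolding bounded_iff by blast
  have "lipschitz_on (\<bar>B1\<bar> + \<bar>B2\<bar>) ({t0..T} \<times> cball 0 B) (\<lambda>(t, z). \<tau> t z)"
  proof (rule bounded_derivative_imp_lipschitz)
    show "convex ({t0..T} \<times> cball (0::real^'n) B)" by (intro convex_Times) auto
    fix p assume p: "p \<in> {t0..T} \<times> cball (0::real^'n) B"
    obtain t z where tz: "p = (t, z)" by (cases p)
    define D where "D p = (\<lambda>(h, k). \<tau>t (fst p) (snd p) * h + \<tau>z (fst p) (snd p) \<bullet> k)" for p
    show "((\<lambda>(t, z). \<tau> t z) has_derivative D p) (at p within {t0..T} \<times> cball 0 B)"
      using p unfolding tz D_def fst_conv snd_conv
      by (intro has_derivative_subset[OF tau_has_derivative]) auto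
    show "onorm (D p) \<le> \<bar>B1\<bar> + \<bar>B2\<bar>"
    proof (rule onorm_bound)
      fix q :: "real \<times> (real^'n)"
      obtain h k where hk: "q = (h, k)" by (cases q)
      have h: "\<bar>h\<bar> \<le> norm q" and k: "norm k \<le> norm q"
        using norm_fst_le[of h k] norm_snd_le[of k h] by (auto simp: hk)
      have "\<bar>\<tau>t t z\<bar> \<le> \<bar>B1\<bar>" "norm (\<tau>z t z) \<le> \<bar>B2\<bar>" using B1[OF p] B2[OF p] by (auto simp: tz)
      then have "\<bar>\<tau>t t z\<bar> * \<bar>h\<bar> \<le> \<bar>B1\<bar> * norm q" "norm (\<tau>z t z) * norm k \<le> \<bar>B2\<bar> * norm q"
        using h k by (intro mult_mono; simp)+
      moreover have "\<bar>\<tau>z t z \<bullet> k\<bar> \<le> norm (\<tau>z t z) * norm k" by (rule Cauchy_Schwarz_ineq2)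
      moreover have "\<bar>\<tau>t t z * h + \<tau>z t z \<bullet> k\<bar> \<le> \<bar>\<tau>t t z\<bar> * \<bar>h\<bar> + \<bar>\<tau>z t z \<bullet> k\<bar>"
        by (metis abs_mult abs_triangle_ineq)
      ultimately have "\<bar>\<tau>t t z * h + \<tau>z t z \<bullet> k\<bar> \<le> \<bar>B1\<bar> * norm q + \<bar>B2\<bar> * norm q" by linarith
      then show "norm (D p q) \<le> (\<bar>B1\<bar> + \<bar>B2\<bar>) * norm q"
        by (simp add: D_def hk tz distrib_right)
    qed simp
  qed simp
  then show ?thesis by (rule that)
qed

lemma rtime_lipschitz:
  assumes t: "t0 \<le> t" and x: "lipschitz_on K {t..T} x"
  obtains M where "lipschitz_on M {t..T} (rtime x)"
proof -
  have "bounded (x ` {t..T})"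
    using lipschitz_on_continuous_on[OF x] by (intro compact_imp_bounded compact_continuous_image) auto
  then obtain B where B: "\<And>s. s \<in> {t..T} \<Longrightarrow> norm (x s) \<le> B" unfolding bounded_iff by blast
  obtain M where M: "lipschitz_on M ({t0..T} \<times> cball 0 B) (\<lambda>(t, z). \<tau> t z)" using tau_lipschitz_on_cball by blast
  have "lipschitz_on (sqrt (1\<^sup>2 + K\<^sup>2)) {t..T} (\<lambda>s. (s, x s))" by (rule lipschitz_on_Pair[OF lipschitz_on_id x])
  moreover have "lipschitz_on M ((\<lambda>s. (s, x s)) ` {t..T}) (\<lambda>(t, z). \<tau> t z)"
    by (rule lipschitz_on_subset[OF M]) (use B t in auto)
  ultimately have "lipschitz_on (M * sqrt (1\<^sup>2 + K\<^sup>2)) {t..T} (\<lambda>s. (\<lambda>(t, z). \<tau> t z) (s, x s))"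
    by (rule lipschitz_on_compose2)
  then have "lipschitz_on (1 + M * sqrt (1\<^sup>2 + K\<^sup>2)) {t..T} (\<lambda>s. s - (\<lambda>(t, z). \<tau> t z) (s, x s))"
    by (rule lipschitz_on_diff[OF lipschitz_on_id])
  then show ?thesis by (intro that) (simp add: rtime_def[abs_def])
qed

text \<open>The chain rule for \<open>\<tau>\<close> along \<open>x\<close> produces exactly the
  expression that the monotone delay condition bounds from below.\<close>

lemma rtime_deriv:
  assumes s: "t0 < s" "s < T" and x: "(x has_vector_derivative v) (at s)"
  shows "(rtime x has_real_derivative 1 - \<tau>t s (x s) - \<tau>z s (x s) \<bullet> v) (at s)"
proof -
  have "((\<lambda>r. (r, x r)) has_derivative (\<lambda>h. (h, h *\<^sub>R v))) (at s within {t0..T})"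
    by (rule has_derivative_Pair[OF has_derivative_ident
          has_derivative_at_withinI[OF x[unfolded has_vector_derivative_def]]])
  moreover have "((\<lambda>(s, y). \<tau> s y) has_derivative (\<lambda>(h, k). \<tau>t s (x s) * h + \<tau>z s (x s) \<bullet> k))
      (at (s, x s) within (\<lambda>r. (r, x r)) ` {t0..T})"
    by (rule has_derivative_subset[OF tau_has_derivative]) (use s in auto)
  ultimately have "((\<lambda>r. (\<lambda>(s, y). \<tau> s y) (r, x r)) has_derivative
      (\<lambda>h. (\<lambda>(h, k). \<tau>t s (x s) * h + \<tau>z s (x s) \<bullet> k) (h, h *\<^sub>R v))) (at s within {t0..T})"
    by (rule has_derivative_in_compose)
  then have "((\<lambda>r. \<tau> r (x r)) has_derivative (\<lambda>h. \<tau>t s (x s) * h + \<tau>z s (x s) \<bullet> (h *\<^sub>R v))) (at s)"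
    using at_within_Icc_at[OF s] by simp
  then have "((\<lambda>r. \<tau> r (x r)) has_real_derivative (\<tau>t s (x s) + \<tau>z s (x s) \<bullet> v)) (at s)"
    unfolding has_field_derivative_def by (rule has_derivative_eq_rhs) (auto simp: algebra_simps)
  from DERIV_diff[OF DERIV_ident this] show ?thesis by (simp add: rtime_def[abs_def] diff_diff_eq)
qed

text \<open>A change of variable that avoids inverting \<open>rtime x\<close>: for a primitive
  \<open>G\<close> of \<open>u\<close>, the composite \<open>G (rtime x r)\<close> is Lipschitz with
  derivative at least \<open>d * u (rtime x r)\<close> a.e. Its total increase is at most that of
  \<open>G\<close> over \<open>{t - taubar..s}\<close>, because the delayed time stays in that range
  and \<open>u\<close> is nonnegative.\<close>

lemma rtime_change_of_variable:
  assumes t: "t0 \<le> t" and x: "traj t w \<alpha> x" and d: "0 < d"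
    and mono: "AE s in lebesgue. s \<in> {t..T} \<longrightarrow>
            1 - \<tau>t s (x s) - \<tau>z s (x s) \<bullet> vector_derivative x (at s) \<ge> d"
    and u: "continuous_on {t - taubar..T} u" "\<And>r. r \<in> {t - taubar..T} \<Longrightarrow> 0 \<le> (u r :: real)"
    and s: "t \<le> s" "s \<le> T"
  shows "(\<lambda>r. u (rtime x r)) integrable_on {t..s}"
    "d * integral {t..s} (\<lambda>r. u (rtime x r)) \<le> integral {t - taubar..s} u"
proof -
  obtain K where K: "lipschitz_on K {t - taubar..T} x" using traj_lip[OF x] by blast
  have "lipschitz_on K {t..T} x" by (rule lipschitz_on_subset[OF K]) (use taubar_nonneg in auto)
  then obtain M where M: "lipschitz_on M {t..T} (rtime x)" using rtime_lipschitz[OF t] by blast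
  have rb: "rtime x r \<in> {t - taubar..r}" if "r \<in> {t..T}" for r
    using rtime_bounds[of r x] that t by auto
  have rtc: "continuous_on {t..s} (rtime x)"
    using lipschitz_on_continuous_on[OF M] by (rule continuous_on_subset) (use s in auto)
  show int: "(\<lambda>r. u (rtime x r)) integrable_on {t..s}"
    by (intro integrable_continuous_real continuous_on_compose2[OF u(1) rtc]) (use rb s in fastforce)
  have "bounded (u ` {t - taubar..T})"
    using u(1) by (intro compact_imp_bounded compact_continuous_image) auto
  then obtain B where B: "\<And>r. r \<in> {t - taubar..T} \<Longrightarrow> norm (u r) \<le> B" unfolding bounded_iff by blast
  have B0: "0 \<le> B" using order_trans[OF norm_ge_zero B[of T]] s taubar_nonneg by simp
  define G where "G r = integral {t - taubar..r} u" for r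
  have uint: "u integrable_on {p..q}" if "t - taubar \<le> p" "q \<le> T" for p q
    using u(1) that by (intro integrable_continuous_real) (auto intro: continuous_on_subset)
  have Gdiff: "G q - G p = integral {p..q} u" if "t - taubar \<le> p" "p \<le> q" "q \<le> T" for p q
    using Henstock_Kurzweil_Integration.integral_combine[of "t - taubar" p q u] uint[of "t - taubar" q] that
    by (simp add: G_def)
  have Gmono: "G p \<le> G q" if "t - taubar \<le> p" "p \<le> q" "q \<le> T" for p q
    using Gdiff[OF that] integral_nonneg[OF uint[of p q]] u(2) that by auto
  have GL: "lipschitz_on B {t - taubar..T} G"
  proof (rule lipschitz_on_leI)
    fix p q assume pq: "p \<in> {t - taubar..T}" "q \<in> {t - taubar..T}" "p \<le> q"
    have "norm (integral {p..q} u) \<le> integral {p..q} (\<lambda>_. B)"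
      by (rule integral_norm_bound_integral) (use pq uint B in auto)
    then have "norm (G q - G p) \<le> B * (q - p)" using Gdiff[of p q] pq by (simp add: mult.commute)
    then show "dist (G p) (G q) \<le> B * dist p q" using pq(3) by (simp add: dist_norm norm_minus_commute)
  qed (fact B0)
  have Gd: "(G has_real_derivative u r) (at r)" if "t - taubar < r" "r < T" for r
    using integral_has_real_derivative[OF u(1), of r] that at_within_Icc_at[OF that] unfolding G_def by auto
  have "lipschitz_on (B * M) {t..s} (\<lambda>r. G (rtime x r))"
  proof -
    have "lipschitz_on M {t..s} (rtime x)" by (rule lipschitz_on_subset[OF M]) (use s in auto)
    moreover have "lipschitz_on B (rtime x ` {t..s}) G" by (rule lipschitz_on_subset[OF GL]) (use rb s in fastforce)
    ultimately show ?thesis by (rule lipschitz_on_compose2)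
  qed
  moreover have ae: "AE r in lebesgue. r \<in> {t<..<s} \<longrightarrow>
      ((\<lambda>r. G (rtime x r)) has_vector_derivative
        (1 - \<tau>t r (x r) - \<tau>z r (x r) \<bullet> vector_derivative x (at r)) * u (rtime x r)) (at r)"
    using traj_deriv[OF x]
  proof eventually_elim
    case (elim r)
    show ?case
    proof
      assume r: "r \<in> {t<..<s}"
      then have "(x has_vector_derivative vector_derivative x (at r)) (at r)"
        using elim s by (auto intro: vector_derivative_works[THEN iffD1] differentiableI_vector)
      then have 1: "(rtime x has_real_derivative 1 - \<tau>t r (x r) - \<tau>z r (x r) \<bullet> vector_derivative x (at r)) (at r)"
        using r t s by (intro rtime_deriv) auto
      \<comment> \<open>The bounds are strict, as \<open>G\<close> is differentiated only in the
        interior: \<open>r > t\<close> keeps the delayed time off the left end,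
        \<open>rtime x r \<le> r < T\<close> off the right end.\<close>
      have "t - taubar < rtime x r" "rtime x r < T" using rtime_bounds[of r x] r t s by auto
      from DERIV_chain2[OF Gd[OF this] 1]
      show "((\<lambda>r. G (rtime x r)) has_vector_derivative
        (1 - \<tau>t r (x r) - \<tau>z r (x r) \<bullet> vector_derivative x (at r)) * u (rtime x r)) (at r)"
        by (simp add: has_real_derivative_iff_has_vector_derivative mult.commute)
    qed
  qed
  ultimately have I: "((\<lambda>r. (1 - \<tau>t r (x r) - \<tau>z r (x r) \<bullet> vector_derivative x (at r)) * u (rtime x r))
      has_integral G (rtime x s) - G (rtime x t)) {t..s}"
    by (rule lipschitz_has_integral_derivative[OF _ s(1)])
  have "d * integral {t..s} (\<lambda>r. u (rtime x r)) \<le> G (rtime x s) - G (rtime x t)"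
  proof (rule has_integral_le_AE[OF _ I])
    show "((\<lambda>r. d * u (rtime x r)) has_integral d * integral {t..s} (\<lambda>r. u (rtime x r))) {t..s}"
      using has_integral_mult_right[OF integrable_integral[OF int]] .
    show "AE r in lebesgue. r \<in> {t<..<s} \<longrightarrow>
        d * u (rtime x r) \<le> (1 - \<tau>t r (x r) - \<tau>z r (x r) \<bullet> vector_derivative x (at r)) * u (rtime x r)"
      using mono
    proof eventually_elim
      case (elim r)
      show ?case
      proof
        assume r: "r \<in> {t<..<s}"
        then have "rtime x r \<in> {t - taubar..T}" using rb[of r] s by auto
        then show "d * u (rtime x r) \<le> (1 - \<tau>t r (x r) - \<tau>z r (x r) \<bullet> vector_derivative x (at r)) * u (rtime x r)"
          using elim r s u(2) by (intro mult_right_mono) auto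
      qed
    qed
  qed
  also have "\<dots> \<le> G s - G (t - taubar)"
    using Gmono[of "rtime x s" s] Gmono[of "t - taubar" "rtime x t"] rb[of s] rb[of t] s taubar_nonneg by auto
  also have "\<dots> = integral {t - taubar..s} u" by (simp add: G_def)
  finally show "d * integral {t..s} (\<lambda>r. u (rtime x r)) \<le> integral {t - taubar..s} u" .
qed

end

section \<open>A priori estimates and uniqueness of trajectories\<close>

text \<open>Bounds along trajectories hold only on the open interval, since a control has to take
  values in \<open>A\<close> only there; at the endpoints both functions are reset to 0.\<close>

lemma has_integral_norm_le_interior:
  fixes h :: "real \<Rightarrow> 'a::euclidean_space"
  assumes h: "(h has_integral I) {u..v}" and k: "k integrable_on {u..v}"
    and le: "\<And>s. s \<in> {u<..<v} \<Longrightarrow> norm (h s) \<le> k s"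
  shows "norm I \<le> integral {u..v} k"
proof -
  define h' where "h' s = (if s \<in> {u<..<v} then h s else 0)" for s
  define k' where "k' s = (if s \<in> {u<..<v} then k s else 0)" for s
  have n: "negligible {u, v}" by simp
  have h': "(h' has_integral I) {u..v}"
    by (rule has_integral_spike[OF n _ h]) (auto simp: h'_def)
  have k': "(k' has_integral integral {u..v} k) {u..v}"
    by (rule has_integral_spike[OF n _ integrable_integral[OF k]]) (auto simp: k'_def)
  have "norm (integral {u..v} h') \<le> integral {u..v} k'"
    by (rule integral_norm_bound_integral) (use h' k' le in \<open>auto simp: h'_def k'_def\<close>)
  then show ?thesis using h' k' by (simp add: integral_unique)
qed

lemma integral_shift_history:
  fixes u :: "real \<Rightarrow> real"
  assumes "continuous_on {t - b..t} u"
  shows "integral {t - b..t} u = integral {-b..0} (\<lambda>\<theta>. u (t + \<theta>))"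
  using integral_shift[of "-b" t 0 u] assms by (simp add: o_def add.commute)

context delay_control
begin

lemma rtime_cont:
  assumes t: "t0 \<le> t" and x: "traj t w \<alpha> x"
  shows "continuous_on {t..T} (rtime x)" "continuous_on {t..T} (\<lambda>r. x (rtime x r))"
proof -
  obtain K where K: "lipschitz_on K {t - taubar..T} x" using traj_lip[OF x] by blast
  have "lipschitz_on K {t..T} x" by (rule lipschitz_on_subset[OF K]) (use taubar_nonneg in auto)
  then obtain M where "lipschitz_on M {t..T} (rtime x)" using rtime_lipschitz[OF t] by blast
  then show c: "continuous_on {t..T} (rtime x)" using lipschitz_on_continuous_on by blast
  show "continuous_on {t..T} (\<lambda>r. x (rtime x r))"
  proof (rule continuous_on_compose2[OF traj_cont[OF x] c])
    show "rtime x ` {t..T} \<subseteq> {t - taubar..T}"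
    proof (rule image_subsetI)
      fix r assume "r \<in> {t..T}"
      then show "rtime x r \<in> {t - taubar..T}" using rtime_bounds[of r x] t by auto
    qed
  qed
qed

text \<open>The constant \<open>d\<close> of the monotone delay is uniform over all histories in
  \<open>P_set taubar r\<close>. The integral over the history is kept apart, as it is known from
  \<open>w\<close> and does not take part in Gronwall's inequality.\<close>

lemma delayed_integral_le:
  assumes "r > 0"
  obtains d where "d > 0"
    "\<And>t w \<alpha> x u s. t \<in> {t0..T} \<Longrightarrow> w \<in> P_set taubar r \<Longrightarrow> \<alpha> \<in> ctrl t \<Longrightarrow> traj t w \<alpha> x \<Longrightarrow>
      continuous_on {t - taubar..T} u \<Longrightarrow> \<forall>r\<in>{t - taubar..T}. 0 \<le> (u r :: real) \<Longrightarrow> s \<in> {t..T} \<Longrightarrow>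
      (\<lambda>r. u (rtime x r)) integrable_on {t..s} \<and>
      integral {t..s} (\<lambda>r. u (rtime x r)) \<le> (1 / d) * (integral {t - taubar..t} u + integral {t..s} u)"
proof -
  obtain d where d: "d > 0" and D: "\<forall>t\<in>{t0..T}. \<forall>w\<in>P_set taubar r. \<forall>\<alpha>\<in>ctrl t. \<forall>x.
         traj t w \<alpha> x \<longrightarrow> (AE s in lebesgue. s \<in> {t..T} \<longrightarrow>
            1 - \<tau>t s (x s) - \<tau>z s (x s) \<bullet> vector_derivative x (at s) \<ge> d)"
    using monotone_delay[OF assms] by blast
  show ?thesis
  proof (rule that[OF d])
    fix t w \<alpha> x s and u :: "real \<Rightarrow> real"
    assume t: "t \<in> {t0..T}" and w: "w \<in> P_set taubar r" and \<alpha>: "\<alpha> \<in> ctrl t" and x: "traj t w \<alpha> x"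
      and u: "continuous_on {t - taubar..T} u" "\<forall>r\<in>{t - taubar..T}. 0 \<le> u r" and s: "s \<in> {t..T}"
    have ae: "AE s in lebesgue. s \<in> {t..T} \<longrightarrow>
            1 - \<tau>t s (x s) - \<tau>z s (x s) \<bullet> vector_derivative x (at s) \<ge> d"
      using D t w \<alpha> x by blast
    have t': "t0 \<le> t" and s': "t \<le> s" "s \<le> T" using t s by auto
    have "u integrable_on {t - taubar..s}"
      using u(1) s by (intro integrable_continuous_real) (auto intro: continuous_on_subset)
    then have "integral {t - taubar..s} u = integral {t - taubar..t} u + integral {t..s} u"
      using Henstock_Kurzweil_Integration.integral_combine[of "t - taubar" t s u] s taubar_nonneg by simp
    then show "(\<lambda>r. u (rtime x r)) integrable_on {t..s} \<and>
      integral {t..s} (\<lambda>r. u (rtime x r)) \<le> (1 / d) * (integral {t - taubar..t} u + integral {t..s} u)"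
      using rtime_change_of_variable[OF t' x d ae u(1) bspec[OF u(2)] s'] d by (simp add: field_simps)
  qed
qed

text \<open>Linear growth bounds \<open>norm (x s)\<close> by integrals of the current and the
  delayed norm; the delayed one is traded for integrals of the norm over the history and over
  \<open>{t..s}\<close>, which leaves a Gronwall inequality. Of the history only the sup bound
  enters, not its Lipschitz constant.\<close>

lemma traj_bounded:
  assumes "r > 0"
  obtains B where "B > 0"
    "\<And>t w \<alpha> x s. t \<in> {t0..T} \<Longrightarrow> w \<in> P_set taubar r \<Longrightarrow> \<alpha> \<in> ctrl t \<Longrightarrow> traj t w \<alpha> x \<Longrightarrow>
      s \<in> {t - taubar..T} \<Longrightarrow> norm (x s) \<le> B"
proof -
  obtain d where d: "d > 0" and D: "\<And>t w \<alpha> x u s. t \<in> {t0..T} \<Longrightarrow> w \<in> P_set taubar r \<Longrightarrow> \<alpha> \<in> ctrl t \<Longrightarrow> traj t w \<alpha> x \<Longrightarrow>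
      continuous_on {t - taubar..T} u \<Longrightarrow> \<forall>r\<in>{t - taubar..T}. 0 \<le> (u r :: real) \<Longrightarrow> s \<in> {t..T} \<Longrightarrow>
      (\<lambda>r. u (rtime x r)) integrable_on {t..s} \<and>
      integral {t..s} (\<lambda>r. u (rtime x r)) \<le> (1 / d) * (integral {t - taubar..t} u + integral {t..s} u)"
    by (rule delayed_integral_le[OF assms]) (rule that)
  \<comment> \<open>\<open>a\<close> gathers the initial value, the constant part of the growth
    bound and the share \<open>taubar * r\<close> of the history in the delayed integral;
    \<open>b\<close> has one term for the current and one for the delayed state. The summand
    \<open>r\<close> in \<open>B\<close> covers times before \<open>t\<close>.\<close>
  define a where "a = r + C_f * (T - t0) + C_f * ((1 / d) * (taubar * r))"
  define b where "b = C_f * (1 + 1 / d)"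
  have b0: "0 \<le> b" using C_f_pos d by (simp add: b_def)
  have a0: "0 < a" using assms C_f_pos d time taubar_nonneg by (auto simp: a_def intro!: add_pos_nonneg)
  define B where "B = a * exp (b * (T - t0)) + r"
  show ?thesis
  proof (rule that)
    show "B > 0" using a0 assms by (simp add: B_def add_pos_pos)
    fix t w \<alpha> x s
    assume t: "t \<in> {t0..T}" and w: "w \<in> P_set taubar r" and \<alpha>: "\<alpha> \<in> ctrl t" and x: "traj t w \<alpha> x"
      and s: "s \<in> {t - taubar..T}"
    have wb: "norm (w \<theta>) \<le> r" if "\<theta> \<in> {-taubar..0}" for \<theta>
      using w P_set_iff[OF taubar_nonneg, of w r] that by blast
    have init: "norm (x s) \<le> r" if "s \<in> {t - taubar..t}" for s
      using wb[of "s - t"] traj_init[OF x, of "s - t"] that by simp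
    have cn: "continuous_on {t - taubar..T} (\<lambda>r. norm (x r))" by (intro continuous_on_norm traj_cont[OF x])
    have cn': "continuous_on {t..T} (\<lambda>r. norm (x r))"
      using cn by (rule continuous_on_subset) (use taubar_nonneg in auto)
    have I0: "integral {t - taubar..t} (\<lambda>r. norm (x r)) \<le> taubar * r"
    proof -
      have "integral {t - taubar..t} (\<lambda>r. norm (x r)) \<le> integral {t - taubar..t} (\<lambda>_. r)"
        using init t by (intro integral_le integrable_continuous_real continuous_on_subset[OF cn]) auto
      then show ?thesis using taubar_nonneg by simp
    qed
    have main: "norm (x s) \<le> a + b * integral {t..s} (\<lambda>r. norm (x r))" if s: "s \<in> {t..T}" for s
    proof -
      have ie: "(\<lambda>r. norm (x r)) integrable_on {t..s}"
        using s by (intro integrable_continuous_real continuous_on_subset[OF cn']) auto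
      have D': "(\<lambda>r. norm (x (rtime x r))) integrable_on {t..s}"
        "integral {t..s} (\<lambda>r. norm (x (rtime x r))) \<le> (1 / d) * (integral {t - taubar..t} (\<lambda>r. norm (x r)) + integral {t..s} (\<lambda>r. norm (x r)))"
        using D[OF t w \<alpha> x cn _ s] by simp_all
      have "norm (x s - x t) \<le> integral {t..s} (\<lambda>r. C_f * (1 + norm (x r) + norm (x (rtime x r))))"
      proof (rule has_integral_norm_le_interior)
        show "((\<lambda>r. f r (x r) (x (rtime x r)) (\<alpha> r)) has_integral x s - x t) {t..s}"
          using s by (intro traj_has_integral[OF x]) auto
        show "(\<lambda>r. C_f * (1 + norm (x r) + norm (x (rtime x r)))) integrable_on {t..s}"
          by (intro integrable_on_mult_right integrable_add integrable_const_ivl ie D'(1))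
        show "norm (f r (x r) (x (rtime x r)) (\<alpha> r)) \<le> C_f * (1 + norm (x r) + norm (x (rtime x r)))" if "r \<in> {t<..<s}" for r
          using that s t by (intro f_growth ctrlD[OF \<alpha>]) auto
      qed
      also have "\<dots> = C_f * ((s - t) + integral {t..s} (\<lambda>r. norm (x r)) + integral {t..s} (\<lambda>r. norm (x (rtime x r))))"
      proof -
        have i1: "(\<lambda>r. 1 + norm (x r)) integrable_on {t..s}" by (intro integrable_add integrable_const_ivl ie)
        have "integral {t..s} (\<lambda>r. 1 + norm (x r) + norm (x (rtime x r))) =
            integral {t..s} (\<lambda>r. 1 + norm (x r)) + integral {t..s} (\<lambda>r. norm (x (rtime x r)))"
          by (rule Henstock_Kurzweil_Integration.integral_add[OF i1 D'(1)])
        also have "integral {t..s} (\<lambda>r. 1 + norm (x r)) = integral {t..s} (\<lambda>r. 1) + integral {t..s} (\<lambda>r. norm (x r))"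
          by (rule Henstock_Kurzweil_Integration.integral_add[OF integrable_const_ivl ie])
        also have "integral {t..s} (\<lambda>r. 1) = s - t" using s by simp
        finally show ?thesis by (simp only: integral_mult_right)
      qed
      also have "\<dots> \<le> C_f * ((T - t0) + integral {t..s} (\<lambda>r. norm (x r)) +
          (1 / d) * (taubar * r + integral {t..s} (\<lambda>r. norm (x r))))"
      proof (intro mult_left_mono add_mono order_trans[OF D'(2)])
        show "0 \<le> 1 / d" using d by simp
      qed (use C_f_pos s t I0 in auto)
      finally have "norm (x s - x t) \<le> \<dots>" .
      moreover have "norm (x t) \<le> r" using init[of t] taubar_nonneg by simp
      moreover have "norm (x s) \<le> norm (x t) + norm (x s - x t)" by (metis norm_triangle_sub)
      ultimately have "norm (x s) \<le> r + C_f * ((T - t0) + integral {t..s} (\<lambda>r. norm (x r)) +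
          (1 / d) * (taubar * r + integral {t..s} (\<lambda>r. norm (x r))))" by linarith
      also have "\<dots> = a + b * integral {t..s} (\<lambda>r. norm (x r))"
        unfolding a_def b_def by (simp only: distrib_left distrib_right mult.assoc mult_1_left mult_1_right add_ac)
      finally show ?thesis .
    qed
    show "norm (x s) \<le> B"
    proof (cases "s \<le> t")
      case True
      have "norm (x s) \<le> r" using init s True by simp
      then show ?thesis unfolding B_def using a0 by (smt (verit) exp_gt_zero mult_pos_pos)
    next
      case False
      then have s': "s \<in> {t..T}" using s by simp
      have "norm (x s) \<le> a * exp (b * (s - t))" by (rule gronwall[OF cn' b0 main s'])
      also have "\<dots> \<le> a * exp (b * (T - t0))"
        using a0 b0 s' t by (intro mult_left_mono iffD2[OF exp_le_cancel_iff] mult_left_mono) auto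
      finally show ?thesis unfolding B_def using assms by linarith
    qed
  qed
qed

text \<open>Speeds up to time \<open>v\<close> involve the trajectory only up to \<open>v\<close>. A
  sharp \<open>B\<close> near the initial time therefore gives a sharp speed bound, as the cone
  estimate requires.\<close>

lemma traj_increment_le:
  assumes t: "t \<in> {t0..T}" and \<alpha>: "\<alpha> \<in> ctrl t" and x: "traj t w \<alpha> x"
    and uv: "t \<le> u" "u \<le> v" "v \<le> T" and B: "\<And>s. s \<in> {t - taubar..v} \<Longrightarrow> norm (x s) \<le> B"
  shows "norm (x v - x u) \<le> C_f * (1 + 2 * B) * (v - u)"
proof -
  have "norm (x v - x u) \<le> integral {u..v} (\<lambda>_. C_f * (1 + 2 * B))"
  proof (rule has_integral_norm_le_interior[OF traj_has_integral[OF x uv]])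
    fix s assume s: "s \<in> {u<..<v}"
    then have s': "s \<in> {t0..T}" "s \<in> {t<..<T}" using uv t by auto
    have "rtime x s \<in> {t - taubar..v}" "s \<in> {t - taubar..v}"
      using rtime_bounds[of s x] s s' uv taubar_nonneg by auto
    then have "norm (x s) \<le> B" "norm (x (rtime x s)) \<le> B" using B by blast+
    then have "C_f * (1 + norm (x s) + norm (x (rtime x s))) \<le> C_f * (1 + 2 * B)"
      using C_f_pos by (intro mult_left_mono) auto
    then show "norm (f s (x s) (x (rtime x s)) (\<alpha> s)) \<le> C_f * (1 + 2 * B)"
      using f_growth[OF s'(1) ctrlD[OF \<alpha> s'(2)]] order_trans by blast
  qed auto
  also have "\<dots> = (v - u) * (C_f * (1 + 2 * B))" using uv by simp
  finally show ?thesis by (simp only: mult.commute)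
qed

text \<open>Before \<open>t\<close> the Lipschitz constant of the history counts, after
  \<open>t\<close> the speed bound from the a priori estimate; increments across \<open>t\<close>
  are split there. Since \<open>K\<close> also bounds the norm, all later histories lie in
  \<open>W_set taubar K\<close>.\<close>

lemma traj_lipschitz_uniform:
  assumes "R > 0"
  obtains K where "K \<ge> R"
    "\<And>t w \<alpha> x. t \<in> {t0..T} \<Longrightarrow> w \<in> W_set taubar R \<Longrightarrow> \<alpha> \<in> ctrl t \<Longrightarrow> traj t w \<alpha> x \<Longrightarrow>
      lipschitz_on K {t - taubar..T} x \<and> (\<forall>s\<in>{t - taubar..T}. norm (x s) \<le> K)"
proof -
  obtain B where B: "B > 0" and bd: "\<And>t w \<alpha> x s. t \<in> {t0..T} \<Longrightarrow> w \<in> P_set taubar R \<Longrightarrow> \<alpha> \<in> ctrl t \<Longrightarrow>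
      traj t w \<alpha> x \<Longrightarrow> s \<in> {t - taubar..T} \<Longrightarrow> norm (x s) \<le> B"
    by (rule traj_bounded[OF assms]) (rule that)
  define K where "K = C_f * (1 + 2 * B) + B + R"
  have pos: "0 < C_f * (1 + 2 * B)" using B C_f_pos by simp
  have K: "C_f * (1 + 2 * B) \<le> K" "B \<le> K" "R \<le> K" using pos B assms by (auto simp: K_def)
  show ?thesis
  proof (rule that[OF K(3)])
    fix t w \<alpha> x
    assume t: "t \<in> {t0..T}" and w: "w \<in> W_set taubar R" and \<alpha>: "\<alpha> \<in> ctrl t" and x: "traj t w \<alpha> x"
    have bd': "norm (x s) \<le> B" if "s \<in> {t - taubar..T}" for s
      using bd[OF t W_set_P_set[OF taubar_nonneg w] \<alpha> x that] .
    have c1: "norm (x v - x u) \<le> K * (v - u)" if "t \<le> u" "u \<le> v" "v \<le> T" for u v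
    proof -
      have "norm (x v - x u) \<le> C_f * (1 + 2 * B) * (v - u)"
        by (rule traj_increment_le[OF t \<alpha> x that]) (use bd' that in auto)
      also have "\<dots> \<le> K * (v - u)" using K(1) that by (intro mult_right_mono) auto
      finally show ?thesis .
    qed
    have c2: "norm (x v - x u) \<le> K * (v - u)" if "t - taubar \<le> u" "u \<le> v" "v \<le> t" for u v
    proof -
      have "norm (w (v - t) - w (u - t)) \<le> R * norm ((v - t) - (u - t))"
        by (rule lipschitz_on_normD[OF W_setD(2)[OF w]]) (use that in auto)
      moreover have "w (v - t) = x v" "w (u - t) = x u"
        using traj_init[OF x, of "v - t"] traj_init[OF x, of "u - t"] that by auto
      ultimately have "norm (x v - x u) \<le> R * (v - u)" using that by simp
      also have "\<dots> \<le> K * (v - u)" using K(3) that by (intro mult_right_mono) auto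
      finally show ?thesis .
    qed
    have "lipschitz_on K {t - taubar..T} x"
    proof (rule lipschitz_on_leI)
      fix u v assume uv: "u \<in> {t - taubar..T}" "v \<in> {t - taubar..T}" "u \<le> v"
      have "norm (x v - x u) \<le> K * (v - u)"
      proof (cases "v \<le> t \<or> t \<le> u")
        case True
        then show ?thesis using c1[of u v] c2[of u v] uv by auto
      next
        case False
        have "norm (x v - x u) \<le> norm (x v - x t) + norm (x t - x u)" by (rule norm_diff_triangle_ineq[of "x v" "x t" "x t" "x u", simplified])
        also have "\<dots> \<le> K * (v - t) + K * (t - u)" using c1[of t v] c2[of u t] uv False by (intro add_mono) auto
        also have "\<dots> = K * (v - u)" by (simp add: algebra_simps)
        finally show ?thesis .
      qed
      then show "dist (x u) (x v) \<le> K * dist u v" using uv(3) by (simp add: dist_norm norm_minus_commute)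
    qed (use K assms in linarith)
    moreover have "\<forall>s\<in>{t - taubar..T}. norm (x s) \<le> K" using bd' K(2) by (meson order_trans)
    ultimately show "lipschitz_on K {t - taubar..T} x \<and> (\<forall>s\<in>{t - taubar..T}. norm (x s) \<le> K)" by blast
  qed
qed

lemma hist_W_set:
  assumes "lipschitz_on K {s - taubar..s} x" "\<And>r. r \<in> {s - taubar..s} \<Longrightarrow> norm (x r) \<le> K"
  shows "hist taubar x s \<in> W_set taubar K"
proof -
  have "lipschitz_on K {-taubar..0} (hist taubar x s)"
  proof (rule lipschitz_onI)
    fix u v assume uv: "u \<in> {-taubar..0}" "v \<in> {-taubar..0}"
    have "dist (x (s + u)) (x (s + v)) \<le> K * dist (s + u) (s + v)"
      by (rule lipschitz_onD[OF assms(1)]) (use uv in auto)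
    then show "dist (hist taubar x s u) (hist taubar x s v) \<le> K * dist u v" using uv by (simp add: hist_def)
  qed (rule lipschitz_on_nonneg[OF assms(1)])
  then show ?thesis using assms(2) by (auto simp: W_set_def hist_def)
qed

text \<open>This is the norm of the space of pairs \<open>(z, w)\<close> with
  \<open>z = w 0\<close>, applied to a difference of histories; the same expression occurs in
  \<open>Phi_class\<close>.\<close>

definition hdist :: "(real \<Rightarrow> real ^ 'n) \<Rightarrow> (real \<Rightarrow> real ^ 'n) \<Rightarrow> real" where
  "hdist w1 w2 = norm (w1 0 - w2 0) + L1_norm taubar (\<lambda>\<theta>. w1 \<theta> - w2 \<theta>)"

lemma hdist_eq:
  assumes "w1 \<in> W_set taubar R" "w2 \<in> W_set taubar R"
  shows "hdist w1 w2 = norm (w1 0 - w2 0) + integral {-taubar..0} (\<lambda>\<theta>. norm (w1 \<theta> - w2 \<theta>))"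
    "0 \<le> integral {-taubar..0} (\<lambda>\<theta>. norm (w1 \<theta> - w2 \<theta>))"
proof -
  have "continuous_on {-taubar..0} (\<lambda>\<theta>. w1 \<theta> - w2 \<theta>)"
    by (intro continuous_on_diff W_setD(5)[OF assms(1)] W_setD(5)[OF assms(2)])
  then show "hdist w1 w2 = norm (w1 0 - w2 0) + integral {-taubar..0} (\<lambda>\<theta>. norm (w1 \<theta> - w2 \<theta>))"
    unfolding hdist_def by (simp only: L1_norm_eq_integral)
  show "0 \<le> integral {-taubar..0} (\<lambda>\<theta>. norm (w1 \<theta> - w2 \<theta>))"
    by (rule integral_nonneg[OF integrable_continuous_real])
      (auto intro!: continuous_on_norm continuous_on_diff W_setD(5)[OF assms(1)] W_setD(5)[OF assms(2)])
qed

text \<open>The first bound is for the states, the second for the delayed values in the running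
  cost, the third for the terminal history. All follow from Gronwall's inequality for the difference
  \<open>u\<close> of the trajectories, once the integral of the delayed difference \<open>v\<close>
  is bounded by that of \<open>u\<close>.\<close>

lemma traj_stability:
  assumes "R > 0"
  obtains \<Lambda> where "\<Lambda> > 0"
    "\<And>t w1 w2 \<alpha> x1 x2. t \<in> {t0..T} \<Longrightarrow> w1 \<in> W_set taubar R \<Longrightarrow> w2 \<in> W_set taubar R \<Longrightarrow> \<alpha> \<in> ctrl t \<Longrightarrow>
      traj t w1 \<alpha> x1 \<Longrightarrow> traj t w2 \<alpha> x2 \<Longrightarrow>
      (\<forall>s\<in>{t..T}. norm (x1 s - x2 s) \<le> \<Lambda> * hdist w1 w2) \<and>
      integral {t..T} (\<lambda>r. norm (x1 (rtime x1 r) - x2 (rtime x2 r))) \<le> \<Lambda> * hdist w1 w2 \<and>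
      integral {t - taubar..T} (\<lambda>r. norm (x1 r - x2 r)) \<le> \<Lambda> * hdist w1 w2"
proof -
  obtain K where K: "K \<ge> R" and lipK: "\<And>t w \<alpha> x. t \<in> {t0..T} \<Longrightarrow> w \<in> W_set taubar R \<Longrightarrow> \<alpha> \<in> ctrl t \<Longrightarrow> traj t w \<alpha> x \<Longrightarrow>
      lipschitz_on K {t - taubar..T} x \<and> (\<forall>s\<in>{t - taubar..T}. norm (x s) \<le> K)"
    by (rule traj_lipschitz_uniform[OF assms]) (rule that)
  obtain d where d: "d > 0" and D: "\<And>t w \<alpha> x u s. t \<in> {t0..T} \<Longrightarrow> w \<in> P_set taubar R \<Longrightarrow> \<alpha> \<in> ctrl t \<Longrightarrow> traj t w \<alpha> x \<Longrightarrow>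
      continuous_on {t - taubar..T} u \<Longrightarrow> \<forall>r\<in>{t - taubar..T}. 0 \<le> (u r :: real) \<Longrightarrow> s \<in> {t..T} \<Longrightarrow>
      (\<lambda>r. u (rtime x r)) integrable_on {t..s} \<and>
      integral {t..s} (\<lambda>r. u (rtime x r)) \<le> (1 / d) * (integral {t - taubar..t} u + integral {t..s} u)"
    by (rule delayed_integral_le[OF assms]) (rule that)
  have K0: "K > 0" using K assms by linarith
  \<comment> \<open>\<open>c\<close> is the price of reading \<open>x1\<close> at the delayed time
    of \<open>x2\<close>: the delays differ by at most \<open>lam_tau * u r\<close>, and
    \<open>x1\<close> has Lipschitz constant \<open>K\<close>. In \<open>b\<close> the terms 1,
    \<open>c\<close> and \<open>1 / d\<close> stand for the current state, this shift and the
    delayed difference.\<close>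
  define c where "c = K * lam_tau"
  have c0: "0 < c" using K0 lam_tau_pos by (simp add: c_def)
  define b where "b = lam_f * (1 + c + 1 / d)"
  have b0: "0 \<le> b" using lam_f_pos c0 d by (simp add: b_def)
  define E where "E = (1 + lam_f / d) * exp (b * (T - t0))"
  have E0: "0 < E" using lam_f_pos d by (simp add: E_def add_pos_pos)
  \<comment> \<open>The three summands are the constants of the three estimates, so that one
    constant serves all of them.\<close>
  define \<Lambda> where "\<Lambda> = E + (1 + (T - t0) * E) + ((c + 1 / d) * ((T - t0) * E) + 1 / d)"
  have TE: "0 \<le> (T - t0) * E" using time E0 by simp
  have cd: "0 \<le> (c + 1 / d) * ((T - t0) * E)" "0 < 1 / d" using TE c0 d by auto
  have \<Lambda>: "E \<le> \<Lambda>" "1 + (T - t0) * E \<le> \<Lambda>" "(c + 1 / d) * ((T - t0) * E) + 1 / d \<le> \<Lambda>" "0 < \<Lambda>"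
    using E0 TE cd unfolding \<Lambda>_def by linarith+
  show ?thesis
  proof (rule that[OF \<Lambda>(4)])
    fix t w1 w2 \<alpha> x1 x2
    assume t: "t \<in> {t0..T}" and w: "w1 \<in> W_set taubar R" "w2 \<in> W_set taubar R" and \<alpha>: "\<alpha> \<in> ctrl t"
      and x: "traj t w1 \<alpha> x1" "traj t w2 \<alpha> x2"
    have t': "t0 \<le> t" using t by simp
    define u where "u r = norm (x1 r - x2 r)" for r
    define v where "v r = norm (x1 (rtime x1 r) - x2 (rtime x2 r))" for r
    define N where "N = hdist w1 w2"
    define N0 where "N0 = integral {-taubar..0} (\<lambda>\<theta>. norm (w1 \<theta> - w2 \<theta>))"
    have N: "N = norm (w1 0 - w2 0) + N0" "0 \<le> N0"
      using hdist_eq[OF w] by (simp_all add: N_def N0_def)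
    have N0N: "N0 \<le> N" "0 \<le> N" using N by auto
    have cu: "continuous_on {t - taubar..T} u"
      unfolding u_def by (intro continuous_on_norm continuous_on_diff traj_cont[OF x(1)] traj_cont[OF x(2)])
    have cu': "continuous_on {t..T} u" using cu by (rule continuous_on_subset) (use taubar_nonneg in auto)
    have cv: "continuous_on {t..T} v"
      unfolding v_def by (intro continuous_on_norm continuous_on_diff rtime_cont(2)[OF t' x(1)] rtime_cont(2)[OF t' x(2)])
    have u0: "\<forall>r\<in>{t - taubar..T}. 0 \<le> u r" by (simp add: u_def)
    have iu0: "integral {t - taubar..t} u = N0"
    proof -
      have "integral {t - taubar..t} u = integral {-taubar..0} (\<lambda>\<theta>. u (t + \<theta>))"
        by (rule integral_shift_history, rule continuous_on_subset[OF cu]) (use t in auto)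
      also have "\<dots> = N0" unfolding N0_def u_def
        by (rule integral_cong) (simp add: traj_init[OF x(1)] traj_init[OF x(2)])
      finally show ?thesis .
    qed
    have ut: "u t = norm (w1 0 - w2 0)" using traj_start[OF x(1)] traj_start[OF x(2)] by (simp add: u_def)
    have v_le: "v r \<le> c * u r + u (rtime x2 r)" if r: "r \<in> {t..T}" for r
    proof -
      have r': "t0 \<le> r" "r \<le> T" "r \<in> {t0..T}" using r t by auto
      have m: "rtime x1 r \<in> {t - taubar..T}" "rtime x2 r \<in> {t - taubar..T}"
        using rtime_bounds[OF r'(1,2), of x1] rtime_bounds[OF r'(1,2), of x2] r by auto
      have "norm (x1 (rtime x1 r) - x1 (rtime x2 r)) \<le> K * norm (rtime x1 r - rtime x2 r)"
        using lipK[OF t w(1) \<alpha> x(1)] m by (intro lipschitz_on_normD) auto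
      also have "norm (rtime x1 r - rtime x2 r) \<le> lam_tau * u r"
        using tau_lip[OF r'(3), of "x1 r" "x2 r"] by (simp add: rtime_def u_def abs_minus_commute)
      finally have "norm (x1 (rtime x1 r) - x1 (rtime x2 r)) \<le> K * (lam_tau * u r)"
        using K0 by (simp add: mult_left_mono)
      moreover have "v r \<le> norm (x1 (rtime x1 r) - x1 (rtime x2 r)) + u (rtime x2 r)"
        using norm_triangle_ineq[of "x1 (rtime x1 r) - x1 (rtime x2 r)" "x1 (rtime x2 r) - x2 (rtime x2 r)"]
        unfolding v_def u_def by simp
      ultimately show ?thesis by (simp add: c_def mult.assoc)
    qed
    have iu: "u integrable_on {t..s}" if "s \<in> {t..T}" for s
      using that by (intro integrable_continuous_real continuous_on_subset[OF cu']) auto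
    have iv: "v integrable_on {t..s}" if "s \<in> {t..T}" for s
      using that by (intro integrable_continuous_real continuous_on_subset[OF cv]) auto
    have Iv: "integral {t..s} v \<le> (c + 1 / d) * integral {t..s} u + (1 / d) * N0" if s: "s \<in> {t..T}" for s
    proof -
      have D': "(\<lambda>r. u (rtime x2 r)) integrable_on {t..s}"
        "integral {t..s} (\<lambda>r. u (rtime x2 r)) \<le> (1 / d) * (N0 + integral {t..s} u)"
        using D[OF t W_set_P_set[OF taubar_nonneg w(2)] \<alpha> x(2) cu u0 s] iu0 by auto
      have "integral {t..s} v \<le> integral {t..s} (\<lambda>r. c * u r + u (rtime x2 r))"
        using v_le s by (intro integral_le iv[OF s] integrable_add integrable_on_mult_right iu[OF s] D'(1)) auto
      also have "\<dots> = c * integral {t..s} u + integral {t..s} (\<lambda>r. u (rtime x2 r))"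
        using iu[OF s] D'(1) by (subst Henstock_Kurzweil_Integration.integral_add) (auto intro: integrable_on_mult_right)
      also have "\<dots> \<le> c * integral {t..s} u + (1 / d) * (N0 + integral {t..s} u)" using D'(2) by simp
      finally show ?thesis by (simp add: algebra_simps)
    qed
    have main: "u s \<le> (1 + lam_f / d) * N + b * integral {t..s} u" if s: "s \<in> {t..T}" for s
    proof -
      have h: "((\<lambda>r. f r (x1 r) (x1 (rtime x1 r)) (\<alpha> r) - f r (x2 r) (x2 (rtime x2 r)) (\<alpha> r))
          has_integral (x1 s - x1 t) - (x2 s - x2 t)) {t..s}"
        using s by (intro has_integral_diff traj_has_integral[OF x(1)] traj_has_integral[OF x(2)]) auto
      have "norm ((x1 s - x1 t) - (x2 s - x2 t)) \<le> integral {t..s} (\<lambda>r. lam_f * (u r + v r))"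
      proof (rule has_integral_norm_le_interior[OF h])
        show "(\<lambda>r. lam_f * (u r + v r)) integrable_on {t..s}"
          by (intro integrable_on_mult_right integrable_add iu iv s)
        fix r assume r: "r \<in> {t<..<s}"
        show "norm (f r (x1 r) (x1 (rtime x1 r)) (\<alpha> r) - f r (x2 r) (x2 (rtime x2 r)) (\<alpha> r)) \<le> lam_f * (u r + v r)"
          unfolding u_def v_def using r s t by (intro f_lip ctrlD[OF \<alpha>]) auto
      qed
      also have "\<dots> = lam_f * (integral {t..s} u + integral {t..s} v)"
        using iu[OF s] iv[OF s] by (simp add: Henstock_Kurzweil_Integration.integral_add)
      also have "\<dots> \<le> lam_f * (integral {t..s} u + ((c + 1 / d) * integral {t..s} u + (1 / d) * N0))"
        using Iv[OF s] lam_f_pos by (intro mult_left_mono add_left_mono) auto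
      also have "\<dots> = b * integral {t..s} u + (lam_f / d) * N0"
        by (simp add: b_def distrib_left distrib_right add_ac mult.assoc)
      finally have 1: "norm ((x1 s - x1 t) - (x2 s - x2 t)) \<le> b * integral {t..s} u + (lam_f / d) * N0" .
      have "x1 s - x2 s = (x1 t - x2 t) + ((x1 s - x1 t) - (x2 s - x2 t))" by simp
      then have "u s \<le> u t + norm ((x1 s - x1 t) - (x2 s - x2 t))"
        unfolding u_def by (metis norm_triangle_ineq)
      moreover have "(lam_f / d) * N0 \<le> (lam_f / d) * N" using N0N lam_f_pos d by (intro mult_left_mono) auto
      moreover have "u t \<le> N" using N ut by simp
      ultimately have "u s \<le> N + (b * integral {t..s} u + (lam_f / d) * N)" using 1 by linarith
      then show ?thesis by (simp add: distrib_right)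
    qed
    have us: "u s \<le> E * N" if s: "s \<in> {t..T}" for s
    proof -
      have "u s \<le> ((1 + lam_f / d) * N) * exp (b * (s - t))" by (rule gronwall[OF cu' b0 main s])
      also have "\<dots> \<le> ((1 + lam_f / d) * N) * exp (b * (T - t0))"
        using N0N lam_f_pos d b0 s t by (intro mult_left_mono iffD2[OF exp_le_cancel_iff] mult_left_mono) auto
      finally show ?thesis by (simp add: E_def mult_ac)
    qed
    have tT: "T \<in> {t..T}" using t by simp
    have Iu: "integral {t..T} u \<le> (T - t0) * E * N"
    proof -
      have "integral {t..T} u \<le> integral {t..T} (\<lambda>_. E * N)"
        using us by (intro integral_le iu tT) auto
      also have "\<dots> = (T - t) * (E * N)" using t by simp
      also have "\<dots> \<le> (T - t0) * (E * N)" using t E0 N0N by (intro mult_right_mono) auto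
      finally show ?thesis by (simp add: mult.assoc)
    qed
    have \<Lambda>N: "k * N \<le> \<Lambda> * N" if "k \<le> \<Lambda>" for k using that N0N by (intro mult_right_mono) auto
    have r1: "\<forall>s\<in>{t..T}. u s \<le> \<Lambda> * N" using us \<Lambda>N[OF \<Lambda>(1)] by (meson order_trans)
    have r2: "integral {t..T} v \<le> \<Lambda> * N"
    proof -
      have "(c + 1 / d) * integral {t..T} u \<le> (c + 1 / d) * ((T - t0) * E * N)"
        using Iu c0 d by (intro mult_left_mono) auto
      moreover have "(1 / d) * N0 \<le> (1 / d) * N" using N0N d by (intro mult_left_mono) auto
      ultimately have "integral {t..T} v \<le> (c + 1 / d) * ((T - t0) * E * N) + (1 / d) * N" using Iv[OF tT] by linarith
      also have "\<dots> = ((c + 1 / d) * ((T - t0) * E) + 1 / d) * N" by (simp only: distrib_right mult.assoc)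
      also have "\<dots> \<le> \<Lambda> * N" by (rule \<Lambda>N[OF \<Lambda>(3)])
      finally show ?thesis .
    qed
    have r3: "integral {t - taubar..T} u \<le> \<Lambda> * N"
    proof -
      have "integral {t - taubar..T} u = N0 + integral {t..T} u"
        using Henstock_Kurzweil_Integration.integral_combine[of "t - taubar" t T u] integrable_continuous_real[OF cu] iu0 t taubar_nonneg by simp
      also have "\<dots> \<le> N + (T - t0) * E * N" using Iu N0N by linarith
      also have "\<dots> = (1 + (T - t0) * E) * N" by (simp add: distrib_right)
      also have "\<dots> \<le> \<Lambda> * N" by (rule \<Lambda>N[OF \<Lambda>(2)])
      finally show ?thesis .
    qed
    show "(\<forall>s\<in>{t..T}. norm (x1 s - x2 s) \<le> \<Lambda> * hdist w1 w2) \<and>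
      integral {t..T} (\<lambda>r. norm (x1 (rtime x1 r) - x2 (rtime x2 r))) \<le> \<Lambda> * hdist w1 w2 \<and>
      integral {t - taubar..T} (\<lambda>r. norm (x1 r - x2 r)) \<le> \<Lambda> * hdist w1 w2"
      using r1 r2 r3 by (simp only: u_def[abs_def] v_def[abs_def] N_def)
  qed
qed

text \<open>Equal histories have distance 0, so stability with \<open>w1 = w2\<close> identifies the
  trajectories on \<open>{t..T}\<close>; earlier values are given by \<open>w\<close>, and outside
  the interval both are \<open>undefined\<close>.\<close>

lemma traj_unique:
  assumes t: "t \<in> {t0..T}" and w: "w \<in> lip_space {-taubar..0}" and \<alpha>: "\<alpha> \<in> ctrl t"
    and x: "traj t w \<alpha> x1" "traj t w \<alpha> x2"
  shows "x1 = x2"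
proof -
  obtain R where R: "R > 0" and wR: "w \<in> W_set taubar R" using lip_space_W_set[OF w] by blast
  obtain \<Lambda> where "\<Lambda> > 0" and L: "\<And>t w1 w2 \<alpha> x1 x2. t \<in> {t0..T} \<Longrightarrow> w1 \<in> W_set taubar R \<Longrightarrow> w2 \<in> W_set taubar R \<Longrightarrow> \<alpha> \<in> ctrl t \<Longrightarrow>
      traj t w1 \<alpha> x1 \<Longrightarrow> traj t w2 \<alpha> x2 \<Longrightarrow>
      (\<forall>s\<in>{t..T}. norm (x1 s - x2 s) \<le> \<Lambda> * hdist w1 w2) \<and>
      integral {t..T} (\<lambda>r. norm (x1 (rtime x1 r) - x2 (rtime x2 r))) \<le> \<Lambda> * hdist w1 w2 \<and>
      integral {t - taubar..T} (\<lambda>r. norm (x1 r - x2 r)) \<le> \<Lambda> * hdist w1 w2"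
    by (rule traj_stability[OF R]) (rule that)
  have "hdist w w = 0" using hdist_eq(1)[OF wR wR] by simp
  then have eq: "x1 s = x2 s" if "s \<in> {t..T}" for s using L[OF t wR wR \<alpha> x] that by simp
  show ?thesis
  proof (rule extensionalityI[of _ "{t - taubar..T}"])
    show "x1 \<in> extensional {t - taubar..T}" "x2 \<in> extensional {t - taubar..T}"
      using x unfolding is_trajectory_def lip_space_def by blast+
    fix s assume s: "s \<in> {t - taubar..T}"
    show "x1 s = x2 s"
      using eq[of s] traj_init[OF x(1), of "s - t"] traj_init[OF x(2), of "s - t"] s
      by (cases "s \<le> t") auto
  qed
qed

end

section \<open>Existence of trajectories\<close>

lemma has_integral_exp:
  assumes "t \<le> (s::real)" "c \<noteq> 0"
  shows "((\<lambda>r. exp (c * (r - t))) has_integral (exp (c * (s - t)) - 1) / c) {t..s}"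
proof -
  have "((\<lambda>r. exp (c * (r - t))) has_integral exp (c * (s - t)) / c - exp (c * (t - t)) / c) {t..s}"
  proof (rule fundamental_theorem_of_calculus[OF assms(1)])
    fix r
    have "((\<lambda>r. exp (c * (r - t)) / c) has_real_derivative exp (c * (r - t))) (at r within {t..s})"
      using assms(2) by (auto intro!: derivative_eq_intros)
    then show "((\<lambda>r. exp (c * (r - t)) / c) has_vector_derivative exp (c * (r - t))) (at r within {t..s})"
      by (simp add: has_real_derivative_iff_has_vector_derivative)
  qed
  then show ?thesis by (simp add: diff_divide_distrib)
qed

lemma divide_power2_tendsto_0: "(\<lambda>k. c / 2 ^ k) \<longlonglongrightarrow> (0::real)"
proof -
  have "(\<lambda>k. c * (1 / 2) ^ k) \<longlonglongrightarrow> (0::real)"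
    by (rule tendsto_mult_right_zero[OF LIMSEQ_power_zero]) simp
  then show ?thesis by (simp add: power_one_over)
qed

lemma geometric_limit:
  fixes X :: "nat \<Rightarrow> 'a::banach"
  assumes "\<And>k. norm (X (Suc k) - X k) \<le> c / 2 ^ k"
  obtains Y where "X \<longlonglongrightarrow> Y" "\<And>k. norm (Y - X k) \<le> 2 * c / 2 ^ k"
proof -
  have step: "norm (X (k + n) - X k) \<le> 2 * c / 2 ^ k - 2 * c / 2 ^ (k + n)" for k n
  proof (induction n)
    case (Suc n)
    have "norm (X (k + Suc n) - X k) \<le> norm (X (Suc (k + n)) - X (k + n)) + norm (X (k + n) - X k)"
      using norm_triangle_ineq[of "X (Suc (k + n)) - X (k + n)" "X (k + n) - X k"] by simp
    also have "\<dots> \<le> c / 2 ^ (k + n) + (2 * c / 2 ^ k - 2 * c / 2 ^ (k + n))"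
      by (intro add_mono assms Suc)
    also have "\<dots> = 2 * c / 2 ^ k - 2 * c / 2 ^ (k + Suc n)" by (simp add: field_simps)
    finally show ?case .
  qed simp
  have c0: "0 \<le> c" using order_trans[OF norm_ge_zero assms[of 0]] by simp
  have le: "norm (X n - X k) \<le> 2 * c / 2 ^ k" if "k \<le> n" for k n
  proof -
    have "0 \<le> 2 * c / 2 ^ n" using c0 by simp
    then show ?thesis using step[of k "n - k"] that by simp
  qed
  have lim0: "(\<lambda>k. 2 * c / 2 ^ k) \<longlonglongrightarrow> 0"
    by (rule divide_power2_tendsto_0)
  have "Cauchy X"
  proof (rule CauchyI')
    fix e :: real assume "0 < e"
    then obtain N where "\<And>n. n \<ge> N \<Longrightarrow> norm (2 * c / 2 ^ n - 0) < e" using LIMSEQ_D[OF lim0] by blast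
    then have N: "2 * c / 2 ^ N < e" using c0 by force
    have "norm (X m - X n) < e" if "N \<le> m" "m < n" for m n
    proof -
      have "norm (X n - X m) \<le> 2 * c / 2 ^ m" using le that by simp
      also have "\<dots> \<le> 2 * c / 2 ^ N" using c0 that by (intro divide_left_mono power_increasing) auto
      finally show ?thesis using N by (simp add: norm_minus_commute)
    qed
    then show "\<exists>M. \<forall>m\<ge>M. \<forall>n>m. dist (X m) (X n) < e" by (auto simp: dist_norm)
  qed
  then obtain Y where Y: "X \<longlonglongrightarrow> Y" using Cauchy_convergent convergent_def by blast
  show ?thesis
  proof (rule that[OF Y])
    fix k
    show "norm (Y - X k) \<le> 2 * c / 2 ^ k"
    proof (rule tendsto_upperbound)
      show "(\<lambda>n. norm (X n - X k)) \<longlonglongrightarrow> norm (Y - X k)" by (intro tendsto_norm tendsto_diff Y tendsto_const)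
      show "\<forall>\<^sub>F n in sequentially. norm (X n - X k) \<le> 2 * c / 2 ^ k"
        using le eventually_sequentially by blast
    qed simp
  qed
qed

context delay_control
begin

text \<open>\<open>F\<close> is continuous only where the control variable lies in \<open>A\<close>,
  so measurability is obtained by composing through the Borel space restricted to that set.\<close>

lemma integrand_measurable:
  fixes F :: "real \<Rightarrow> real ^ 'n \<Rightarrow> real ^ 'n \<Rightarrow> real ^ 'm \<Rightarrow> 'b::euclidean_space"
  assumes F: "continuous_on ({t0..T} \<times> UNIV \<times> UNIV \<times> A) (\<lambda>(t, z, y, a). F t z y a)"
    and t: "t0 \<le> t" and \<alpha>: "\<alpha> \<in> ctrl t" and X: "continuous_on {t..T} X" and Y: "continuous_on {t..T} Y"
  shows "(\<lambda>r. F r (X r) (Y r) (\<alpha> r)) \<in> borel_measurable (lebesgue_on {t<..<T})"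
proof -
  let ?M = "lebesgue_on {t<..<T}" and ?S = "{t0..T} \<times> (UNIV :: (real^'n) set) \<times> (UNIV :: (real^'n) set) \<times> A"
  have m: "h \<in> borel_measurable ?M" if "continuous_on {t..T} h" for h :: "real \<Rightarrow> 'c::euclidean_space"
    by (rule continuous_imp_measurable_on_sets_lebesgue) (auto intro: continuous_on_subset[OF that])
  have \<alpha>m: "\<alpha> \<in> borel_measurable ?M" using \<alpha> unfolding controls_def by blast
  have "(\<lambda>r. (r, X r, Y r, \<alpha> r)) \<in> borel_measurable ?M"
    by (intro borel_measurable_Pair m X Y \<alpha>m continuous_on_id)
  moreover have "(r, X r, Y r, \<alpha> r) \<in> ?S" if "r \<in> space ?M" for r
    using that t ctrlD[OF \<alpha>, of r] by simp
  ultimately have "(\<lambda>r. (r, X r, Y r, \<alpha> r)) \<in> measurable ?M (restrict_space borel ?S)"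
    by (intro measurable_restrict_space2) auto
  from measurable_compose[OF this borel_measurable_continuous_on_restrict[OF F]]
  show ?thesis by simp
qed

lemma integrand_integrable:
  fixes F :: "real \<Rightarrow> real ^ 'n \<Rightarrow> real ^ 'n \<Rightarrow> real ^ 'm \<Rightarrow> 'b::euclidean_space"
  assumes F: "continuous_on ({t0..T} \<times> UNIV \<times> UNIV \<times> A) (\<lambda>(t, z, y, a). F t z y a)"
    and t: "t0 \<le> t" and \<alpha>: "\<alpha> \<in> ctrl t" and X: "continuous_on {t..T} X" and Y: "continuous_on {t..T} Y"
    and bd: "\<And>r. r \<in> {t<..<T} \<Longrightarrow> norm (F r (X r) (Y r) (\<alpha> r)) \<le> M"
  shows "(\<lambda>r. F r (X r) (Y r) (\<alpha> r)) absolutely_integrable_on {t..T}"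
proof (rule absolutely_integrable_spike_set)
  show "(\<lambda>r. F r (X r) (Y r) (\<alpha> r)) absolutely_integrable_on {t<..<T}"
  proof (rule measurable_bounded_by_integrable_imp_absolutely_integrable)
    show "(\<lambda>_. M) integrable_on {t<..<T}"
      using integrable_on_open_interval[of "\<lambda>_. M" t T] integrable_const_ivl[of M t T] by (simp add: box_real)
  qed (use integrand_measurable[OF F t \<alpha> X Y] bd in auto)
  show "negligible {r \<in> {t<..<T} - {t..T}. F r (X r) (Y r) (\<alpha> r) \<noteq> 0}"
    by (rule negligible_subset[of "{}"]) auto
  show "negligible {r \<in> {t..T} - {t<..<T}. F r (X r) (Y r) (\<alpha> r) \<noteq> 0}"
    by (rule negligible_subset[of "{t, T}"]) auto
qed

text \<open>The value 0 outside the open interval makes the bounds hold everywhere, although the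
  control is constrained only inside.\<close>

definition picard_rhs :: "real \<Rightarrow> (real \<Rightarrow> real ^ 'm) \<Rightarrow> (real \<Rightarrow> real ^ 'n) \<Rightarrow> real \<Rightarrow> real ^ 'n" where
  "picard_rhs t \<alpha> X r = (if r \<in> {t<..<T} then f r (X r) (X (rtime X r)) (\<alpha> r) else 0)"

text \<open>\<open>W\<close> stands for the history extended to the whole line, constant on the
  nonnegative half-line. Before \<open>t\<close> the integral vanishes and \<open>W (s - t)\<close>
  reproduces the history; after \<open>t\<close> the first term is the fixed value
  \<open>W 0\<close>, so one formula covers both.\<close>

definition picard :: "real \<Rightarrow> (real \<Rightarrow> real ^ 'n) \<Rightarrow> (real \<Rightarrow> real ^ 'm) \<Rightarrow> (real \<Rightarrow> real ^ 'n) \<Rightarrow> real \<Rightarrow> real ^ 'n" where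
  "picard t W \<alpha> X s = W (s - t) + integral {t..s} (picard_rhs t \<alpha> X)"

text \<open>For \<open>s \<ge> t\<close> the weight
  \<open>m s = (1 + R) * exp (3 * C_f * (s - t))\<close> is at least 1, so
  \<open>C_f * (1 + 2 * m s) \<le> 3 * C_f * m s\<close>, which is the derivative of
  \<open>m\<close>; an initial value of norm at most \<open>R\<close> plus the integrated velocity
  thus stays below \<open>m\<close>. The fixed Lipschitz constant \<open>K\<close> is carried along
  for the contraction estimate.\<close>

definition picard_invariant :: "real \<Rightarrow> (real \<Rightarrow> real ^ 'n) \<Rightarrow> real \<Rightarrow> real \<Rightarrow> (real \<Rightarrow> real ^ 'n) \<Rightarrow> bool" where
  "picard_invariant t W R K X \<longleftrightarrow> lipschitz_on K {..T} X \<and> (\<forall>s\<le>t. X s = W (s - t)) \<and>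
     (\<forall>s\<le>T. norm (X s) \<le> (1 + R) * exp (3 * C_f * (max s t - t)))"

text \<open>The uniform bound yields the Lipschitz constant of the next iterate, the exponential
  bound its growth.\<close>

lemma picard_invariant_integrable:
  assumes t: "t \<in> {t0..T}" and \<alpha>: "\<alpha> \<in> ctrl t" and R: "0 < R" and X: "picard_invariant t W R K X"
  shows "\<And>r. norm (picard_rhs t \<alpha> X r) \<le> C_f * (1 + 2 * ((1 + R) * exp (3 * C_f * (T - t0))))"
    "\<And>r. r \<in> {t..T} \<Longrightarrow> norm (picard_rhs t \<alpha> X r) \<le> 3 * C_f * (1 + R) * exp (3 * C_f * (r - t))"
    "\<And>u v. t \<le> u \<Longrightarrow> v \<le> T \<Longrightarrow> picard_rhs t \<alpha> X integrable_on {u..v}"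
proof -
  define m where "m s = (1 + R) * exp (3 * C_f * (max s t - t))" for s
  have lip: "lipschitz_on K {..T} X" and bd: "\<And>s. s \<le> T \<Longrightarrow> norm (X s) \<le> m s"
    using X unfolding picard_invariant_def m_def by blast+
  have mono: "m r \<le> m s" if "r \<le> s" for r s
    using R C_f_pos that by (auto simp: m_def)
  have m1: "1 \<le> m s" for s
  proof -
    have "1 * 1 \<le> (1 + R) * exp (3 * C_f * (max s t - t))"
      using R C_f_pos by (intro mult_mono) auto
    then show ?thesis by (simp add: m_def)
  qed
  have mT: "m s \<le> (1 + R) * exp (3 * C_f * (T - t0))" if "s \<le> T" for s
    using R C_f_pos that t by (auto simp: m_def intro!: mult_left_mono)
  have h: "norm (picard_rhs t \<alpha> X r) \<le> C_f * (1 + 2 * m r)" if r: "r \<in> {t<..<T}" for r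
  proof -
    have r': "r \<in> {t0..T}" "t0 \<le> r" "r \<le> T" using r t by auto
    have "norm (X r) \<le> m r" using bd r by simp
    moreover have "norm (X (rtime X r)) \<le> m r"
      using bd[of "rtime X r"] mono[of "rtime X r" r] rtime_bounds[OF r'(2,3), of X] r by force
    ultimately have "C_f * (1 + norm (X r) + norm (X (rtime X r))) \<le> C_f * (1 + 2 * m r)"
      using C_f_pos by (intro mult_left_mono) auto
    then show ?thesis using f_growth[OF r'(1) ctrlD[OF \<alpha> r], of "X r" "X (rtime X r)"] r
      unfolding picard_rhs_def by simp
  qed
  show b1: "norm (picard_rhs t \<alpha> X r) \<le> C_f * (1 + 2 * ((1 + R) * exp (3 * C_f * (T - t0))))" for r
  proof (cases "r \<in> {t<..<T}")
    case True
    have "C_f * (1 + 2 * m r) \<le> C_f * (1 + 2 * ((1 + R) * exp (3 * C_f * (T - t0))))"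
      using mT[of r] True C_f_pos by (intro mult_left_mono) auto
    then show ?thesis using h[OF True] by linarith
  next
    case False
    then have "picard_rhs t \<alpha> X r = 0" by (simp only: picard_rhs_def if_False)
    then show ?thesis using C_f_pos R by simp
  qed
  show "norm (picard_rhs t \<alpha> X r) \<le> 3 * C_f * (1 + R) * exp (3 * C_f * (r - t))" if "r \<in> {t..T}" for r
  proof (cases "r \<in> {t<..<T}")
    case True
    have "C_f * (1 + 2 * m r) \<le> C_f * (3 * m r)" using m1[of r] C_f_pos by (intro mult_left_mono) auto
    also have "\<dots> = 3 * C_f * (1 + R) * exp (3 * C_f * (r - t))" using True by (simp add: m_def)
    finally show ?thesis using h[OF True] by linarith
  next
    case False
    then have "picard_rhs t \<alpha> X r = 0" by (simp only: picard_rhs_def if_False)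
    then show ?thesis using C_f_pos R by simp
  qed
  have Xc: "continuous_on {t..T} X"
    by (rule continuous_on_subset[OF lipschitz_on_continuous_on[OF lip]]) auto
  have "lipschitz_on K {t..T} X" by (rule lipschitz_on_subset[OF lip]) auto
  then obtain M where "lipschitz_on M {t..T} (rtime X)" using rtime_lipschitz[of t K X] t by auto
  then have Yc: "continuous_on {t..T} (\<lambda>r. X (rtime X r))"
  proof (intro continuous_on_compose2[OF lipschitz_on_continuous_on[OF lip]])
    show "rtime X ` {t..T} \<subseteq> {..T}"
    proof (rule image_subsetI)
      fix r assume "r \<in> {t..T}"
      then show "rtime X r \<in> {..T}" using rtime_bounds[of r X] t by auto
    qed
  qed (rule lipschitz_on_continuous_on)
  have "(\<lambda>r. f r (X r) (X (rtime X r)) (\<alpha> r)) absolutely_integrable_on {t..T}"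
  proof (rule integrand_integrable[OF f_cont _ \<alpha> Xc Yc])
    show "norm (f r (X r) (X (rtime X r)) (\<alpha> r)) \<le> C_f * (1 + 2 * ((1 + R) * exp (3 * C_f * (T - t0))))"
      if "r \<in> {t<..<T}" for r using b1[of r] that by (simp add: picard_rhs_def)
  qed (use t in auto)
  then have "(\<lambda>r. f r (X r) (X (rtime X r)) (\<alpha> r)) integrable_on {t..T}"
    using set_lebesgue_integral_eq_integral(1) by blast
  then have "picard_rhs t \<alpha> X integrable_on {t..T}"
    by (rule integrable_spike[of _ _ "{t, T}"]) (auto simp: picard_rhs_def)
  then show "picard_rhs t \<alpha> X integrable_on {u..v}" if "t \<le> u" "v \<le> T" for u v
    by (rule integrable_subinterval_real) (use that in auto)
qed

lemma picard_preserves_invariant: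
  assumes t: "t \<in> {t0..T}" and \<alpha>: "\<alpha> \<in> ctrl t" and R: "0 < R" and X: "picard_invariant t W R K X"
    and W: "lipschitz_on R UNIV W" "\<And>s. norm (W s) \<le> R" "\<And>s. 0 \<le> s \<Longrightarrow> W s = W 0"
    and K: "K = R + C_f * (1 + 2 * ((1 + R) * exp (3 * C_f * (T - t0))))"
  shows "picard_invariant t W R K (picard t W \<alpha> X)"
proof -
  note hb = picard_invariant_integrable(1)[OF t \<alpha> R X] and he = picard_invariant_integrable(2)[OF t \<alpha> R X]
    and hi = picard_invariant_integrable(3)[OF t \<alpha> R X]
  define Q where "Q = C_f * (1 + 2 * ((1 + R) * exp (3 * C_f * (T - t0))))"
  have Q0: "0 \<le> Q" using C_f_pos R by (simp add: Q_def)
  have hb: "norm (picard_rhs t \<alpha> X r) \<le> Q" for r using hb by (simp only: Q_def)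
  let ?I = "\<lambda>s. integral {t..s} (picard_rhs t \<alpha> X)"
  have Idiff: "norm (?I v - ?I u) \<le> Q * (v - u)" if uv: "u \<le> v" "v \<le> T" for u v
  proof (cases "t \<le> u")
    case True
    have "?I v - ?I u = integral {u..v} (picard_rhs t \<alpha> X)"
      using Henstock_Kurzweil_Integration.integral_combine[OF True uv(1) hi[OF order_refl uv(2)]] by (metis add_diff_cancel_left')
    also have "norm \<dots> \<le> integral {u..v} (\<lambda>_. Q)"
      using hb uv True by (intro integral_norm_bound_integral hi) auto
    finally show ?thesis using uv by (simp add: mult.commute)
  next
    case u: False
    then have "?I u = 0" by simp
    show ?thesis
    proof (cases "t \<le> v")
      case True
      have "norm (?I v) \<le> integral {t..v} (\<lambda>_. Q)"
        using hb uv by (intro integral_norm_bound_integral hi) auto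
      also have "\<dots> = Q * (v - t)" using True by simp
      also have "\<dots> \<le> Q * (v - u)" using Q0 u by (intro mult_left_mono) auto
      finally show ?thesis using \<open>?I u = 0\<close> by simp
    next
      case False
      then have "?I v = 0" by simp
      then show ?thesis using \<open>?I u = 0\<close> Q0 uv by simp
    qed
  qed
  have lip: "lipschitz_on K {..T} (picard t W \<alpha> X)"
  proof (rule lipschitz_on_leI)
    show "0 \<le> K" using Q0 R by (simp add: K Q_def)
    fix u v assume uv: "u \<in> {..T}" "v \<in> {..T}" "u \<le> v"
    have "picard t W \<alpha> X v - picard t W \<alpha> X u = (W (v - t) - W (u - t)) + (?I v - ?I u)" by (simp add: picard_def)
    then have "norm (picard t W \<alpha> X v - picard t W \<alpha> X u) \<le> norm (W (v - t) - W (u - t)) + norm (?I v - ?I u)"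
      by (metis norm_triangle_ineq)
    also have "norm (W (v - t) - W (u - t)) \<le> R * (v - u)"
      using lipschitz_on_normD[OF W(1), of "v - t" "u - t"] uv(3) by simp
    also have "norm (?I v - ?I u) \<le> Q * (v - u)" using Idiff uv by simp
    finally have "norm (picard t W \<alpha> X v - picard t W \<alpha> X u) \<le> K * (v - u)"
      by (simp add: K Q_def distrib_right)
    then show "dist (picard t W \<alpha> X u) (picard t W \<alpha> X v) \<le> K * dist u v"
      using uv(3) by (simp add: dist_norm norm_minus_commute)
  qed
  have start: "picard t W \<alpha> X s = W (s - t)" if "s \<le> t" for s
    using that by (cases "s = t") (auto simp: picard_def)
  have bd: "norm (picard t W \<alpha> X s) \<le> (1 + R) * exp (3 * C_f * (max s t - t))" if s: "s \<le> T" for s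
  proof (cases "s \<le> t")
    case True
    then show ?thesis using start[OF True] W(2)[of "s - t"] by (simp add: max_def)
  next
    case False
    have "norm (?I s) \<le> integral {t..s} (\<lambda>r. 3 * C_f * (1 + R) * exp (3 * C_f * (r - t)))"
    proof (rule integral_norm_bound_integral)
      show "(\<lambda>r. 3 * C_f * (1 + R) * exp (3 * C_f * (r - t))) integrable_on {t..s}"
        by (intro integrable_continuous_real continuous_intros)
    qed (use hi he s in auto)
    also have "\<dots> = 3 * C_f * (1 + R) * ((exp (3 * C_f * (s - t)) - 1) / (3 * C_f))"
      using has_integral_exp[of t s "3 * C_f"] False C_f_pos by (simp add: integral_unique)
    also have "\<dots> = (1 + R) * exp (3 * C_f * (s - t)) - (1 + R)" using C_f_pos by (simp add: field_simps)
    finally have "norm (?I s) \<le> (1 + R) * exp (3 * C_f * (s - t)) - (1 + R)" .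
    moreover have "norm (picard t W \<alpha> X s) \<le> norm (W (s - t)) + norm (?I s)"
      unfolding picard_def by (rule norm_triangle_ineq)
    ultimately show ?thesis using W(2)[of "s - t"] False by (simp add: max_def)
  qed
  show ?thesis unfolding picard_invariant_def using lip start bd by blast
qed

text \<open>Among functions with Lipschitz constant \<open>K\<close> the right-hand side has the
  constant \<open>c = lam_f * (2 + K * lam_tau)\<close>: 2 for the current and the delayed state,
  \<open>K * lam_tau\<close> for the shift of the delayed time. Integrating
  \<open>c * D * exp (B * (r - t))\<close> gains the factor \<open>c / B = 1 / 2\<close>, so the
  exponential weight gives a contraction on the whole interval at once.\<close>

lemma picard_contraction:
  assumes t: "t \<in> {t0..T}" and \<alpha>: "\<alpha> \<in> ctrl t" and R: "0 < R" and K0: "0 \<le> K"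
    and X: "picard_invariant t W R K X" and Y: "picard_invariant t W R K Y"
    and B: "B = 2 * (lam_f * (2 + K * lam_tau))" and D: "0 \<le> D"
    and XY: "\<And>s. s \<le> T \<Longrightarrow> norm (X s - Y s) \<le> D * exp (B * (max s t - t))"
    and s: "s \<le> T"
  shows "norm (picard t W \<alpha> X s - picard t W \<alpha> Y s) \<le> D / 2 * exp (B * (max s t - t))"
proof (cases "s \<le> t")
  case True
  then have "integral {t..s} (picard_rhs t \<alpha> X) = 0" "integral {t..s} (picard_rhs t \<alpha> Y) = 0"
    by (cases "s = t"; simp)+
  then show ?thesis using D by (simp add: picard_def)
next
  case False
  define c where "c = lam_f * (2 + K * lam_tau)"
  have c0: "0 < c" using lam_f_pos lam_tau_pos K0 unfolding c_def by (simp add: add_pos_nonneg)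
  have B': "B = 2 * c" using B by (simp add: c_def)
  have lip: "lipschitz_on K {..T} X" using X unfolding picard_invariant_def by blast
  have iX: "picard_rhs t \<alpha> X integrable_on {t..s}" and iY: "picard_rhs t \<alpha> Y integrable_on {t..s}"
    using picard_invariant_integrable(3)[OF t \<alpha> R X, of t s] picard_invariant_integrable(3)[OF t \<alpha> R Y, of t s] s by auto
  have hd: "norm (picard_rhs t \<alpha> X r - picard_rhs t \<alpha> Y r) \<le> c * D * exp (B * (r - t))" if r: "r \<in> {t..s}" for r
  proof (cases "r \<in> {t<..<T}")
    case True
    then have r': "r \<in> {t0..T}" "t0 \<le> r" "r \<le> T" "t \<le> r" using t by auto
    define e where "e = D * exp (B * (r - t))"
    have e1: "norm (X r - Y r) \<le> e" using XY[of r] r' by (simp add: e_def max_def)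
    have ry: "rtime Y r \<le> r" "rtime X r \<le> r" using rtime_bounds[OF r'(2,3)] by auto
    have e2: "norm (X (rtime Y r) - Y (rtime Y r)) \<le> e"
    proof -
      have "norm (X (rtime Y r) - Y (rtime Y r)) \<le> D * exp (B * (max (rtime Y r) t - t))"
        using XY ry r' by simp
      also have "\<dots> \<le> e" unfolding e_def B' using ry r' c0 D by (intro mult_left_mono) auto
      finally show ?thesis .
    qed
    have e3: "norm (X (rtime X r) - X (rtime Y r)) \<le> K * lam_tau * e"
    proof -
      have "norm (X (rtime X r) - X (rtime Y r)) \<le> K * norm (rtime X r - rtime Y r)"
        by (rule lipschitz_on_normD[OF lip]) (use ry r' in auto)
      also have "norm (rtime X r - rtime Y r) \<le> lam_tau * norm (X r - Y r)"
        using tau_lip[OF r'(1), of "X r" "Y r"] by (simp add: rtime_def abs_minus_commute)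
      also have "lam_tau * norm (X r - Y r) \<le> lam_tau * e" using e1 lam_tau_pos by simp
      finally show ?thesis using K0 by (simp add: mult_left_mono mult.assoc)
    qed
    have "norm (picard_rhs t \<alpha> X r - picard_rhs t \<alpha> Y r) \<le> lam_f * (norm (X r - Y r) + norm (X (rtime X r) - Y (rtime Y r)))"
      using True f_lip[OF r'(1) ctrlD[OF \<alpha> True]] by (simp add: picard_rhs_def)
    also have "\<dots> \<le> lam_f * (e + (K * lam_tau * e + e))"
    proof (intro mult_left_mono add_mono e1)
      have "norm (X (rtime X r) - Y (rtime Y r)) \<le> norm (X (rtime X r) - X (rtime Y r)) + norm (X (rtime Y r) - Y (rtime Y r))"
        using norm_triangle_ineq[of "X (rtime X r) - X (rtime Y r)" "X (rtime Y r) - Y (rtime Y r)"] by simp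
      then show "norm (X (rtime X r) - Y (rtime Y r)) \<le> K * lam_tau * e + e" using e2 e3 by linarith
    qed (use lam_f_pos in auto)
    also have "\<dots> = c * e" unfolding c_def by (simp add: algebra_simps)
    finally show ?thesis by (simp add: e_def mult.assoc)
  next
    case False
    then have "picard_rhs t \<alpha> X r = 0" "picard_rhs t \<alpha> Y r = 0" by (simp_all only: picard_rhs_def if_False)
    then show ?thesis using c0 D by simp
  qed
  have "norm (integral {t..s} (\<lambda>r. picard_rhs t \<alpha> X r - picard_rhs t \<alpha> Y r)) \<le> integral {t..s} (\<lambda>r. c * D * exp (B * (r - t)))"
  proof (rule integral_norm_bound_integral[OF _ _ hd])
    show "(\<lambda>r. c * D * exp (B * (r - t))) integrable_on {t..s}"
      by (intro integrable_continuous_real continuous_intros)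
  qed (auto intro: integrable_diff iX iY)
  also have "\<dots> = c * D * ((exp (B * (s - t)) - 1) / B)"
    using has_integral_exp[of t s B] False c0 B' by (simp add: integral_unique)
  also have "\<dots> = D / 2 * (exp (B * (s - t)) - 1)" using c0 B' by simp
  also have "\<dots> \<le> D / 2 * exp (B * (s - t))" using D by (intro mult_left_mono) auto
  finally have "norm (integral {t..s} (\<lambda>r. picard_rhs t \<alpha> X r - picard_rhs t \<alpha> Y r)) \<le> D / 2 * exp (B * (s - t))" .
  moreover have "picard t W \<alpha> X s - picard t W \<alpha> Y s = integral {t..s} (\<lambda>r. picard_rhs t \<alpha> X r - picard_rhs t \<alpha> Y r)"
    using Henstock_Kurzweil_Integration.integral_diff[OF iX iY] by (simp add: picard_def)
  ultimately show ?thesis using False by (simp add: max_def)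
qed

lemma picard_invariant_limit:
  assumes X: "\<And>k. picard_invariant t W R K (X k)" and lim: "\<And>s. s \<le> T \<Longrightarrow> (\<lambda>k. X k s) \<longlonglongrightarrow> Y s" and tT: "t \<le> T"
  shows "picard_invariant t W R K Y"
  unfolding picard_invariant_def
proof (intro conjI allI impI)
  have XD: "lipschitz_on K {..T} (X k)" "\<forall>s\<le>t. X k s = W (s - t)"
    "\<forall>s\<le>T. norm (X k s) \<le> (1 + R) * exp (3 * C_f * (max s t - t))" for k
    using X unfolding picard_invariant_def by blast+
  show "lipschitz_on K {..T} Y"
  proof (rule lipschitz_onI)
    fix u v assume uv: "u \<in> {..T}" "v \<in> {..T}"
    show "dist (Y u) (Y v) \<le> K * dist u v"
    proof (rule tendsto_upperbound)
      show "(\<lambda>k. dist (X k u) (X k v)) \<longlonglongrightarrow> dist (Y u) (Y v)" using uv by (intro tendsto_dist lim) auto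
      show "\<forall>\<^sub>F k in sequentially. dist (X k u) (X k v) \<le> K * dist u v"
        using lipschitz_onD[OF XD(1)] uv by (intro always_eventually allI) auto
    qed simp
  qed (rule lipschitz_on_nonneg[OF XD(1)[of 0]])
  show "Y s = W (s - t)" if "s \<le> t" for s
  proof (rule LIMSEQ_unique[OF lim])
    show "(\<lambda>k. X k s) \<longlonglongrightarrow> W (s - t)" using XD(2) that by simp
  qed (use that tT in auto)
  show "norm (Y s) \<le> (1 + R) * exp (3 * C_f * (max s t - t))" if "s \<le> T" for s
  proof (rule tendsto_upperbound)
    show "(\<lambda>k. norm (X k s)) \<longlonglongrightarrow> norm (Y s)" using that by (intro tendsto_norm lim)
    show "\<forall>\<^sub>F k in sequentially. norm (X k s) \<le> (1 + R) * exp (3 * C_f * (max s t - t))"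
      using XD(3) that by (intro always_eventually allI) auto
  qed simp
qed

text \<open>The first two iterates differ by at most \<open>2 * M\<close> and each step halves the
  weighted distance, so the iterates converge geometrically at every time. The limit inherits the
  invariant, and the contraction, applied to the limit and an iterate, shows that it is a fixed
  point.\<close>

lemma picard_fixpoint:
  assumes t: "t \<in> {t0..T}" and \<alpha>: "\<alpha> \<in> ctrl t" and R: "0 < R"
    and W: "lipschitz_on R UNIV W" "\<And>s. norm (W s) \<le> R" "\<And>s. 0 \<le> s \<Longrightarrow> W s = W 0"
  obtains K X where "picard_invariant t W R K X" "\<And>s. s \<le> T \<Longrightarrow> X s = picard t W \<alpha> X s"
proof -
  define M where "M = (1 + R) * exp (3 * C_f * (T - t0))"
  define K where "K = R + C_f * (1 + 2 * ((1 + R) * exp (3 * C_f * (T - t0))))"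
  define B where "B = 2 * (lam_f * (2 + K * lam_tau))"
  have M0: "0 < M" using R by (simp add: M_def)
  have "0 \<le> C_f * (1 + 2 * M)" using C_f_pos M0 by simp
  then have RK: "R \<le> K" unfolding K_def M_def by linarith
  have K0: "0 \<le> K" using RK R by simp
  have B0: "0 < B" using lam_f_pos lam_tau_pos K0 unfolding B_def by (simp add: add_pos_nonneg)
  \<comment> \<open>An upper bound of the weight; as the weight is also at least 1, weighted and
    unweighted bounds can be exchanged.\<close>
  define E where "E = exp (B * (T - t0))"
  have E: "exp (B * (max s t - t)) \<le> E" "1 \<le> exp (B * (max s t - t))" if "s \<le> T" for s
    using that t B0 by (auto simp: E_def)
  define X where "X k = (picard t W \<alpha> ^^ k) (\<lambda>s. W (s - t))" for k
  have XS: "X (Suc k) = picard t W \<alpha> (X k)" for k by (simp add: X_def)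
  have inv: "picard_invariant t W R K (X k)" for k
  proof (induction k)
    case 0
    have "lipschitz_on K {..T} (\<lambda>s. W (s - t))"
    proof (rule lipschitz_onI[OF _ K0])
      fix u v
      have "dist (W (u - t)) (W (v - t)) \<le> R * dist u v"
        using lipschitz_onD[OF W(1), of "u - t" "v - t"] by (simp add: dist_norm)
      also have "\<dots> \<le> K * dist u v" using RK by (intro mult_right_mono) auto
      finally show "dist (W (u - t)) (W (v - t)) \<le> K * dist u v" .
    qed
    moreover have "norm (W (s - t)) \<le> (1 + R) * exp (3 * C_f * (max s t - t))" for s
    proof -
      have "(1 + R) * 1 \<le> (1 + R) * exp (3 * C_f * (max s t - t))"
        using R C_f_pos by (intro mult_left_mono) auto
      moreover have "norm (W (s - t)) \<le> (1 + R) * 1" using W(2)[of "s - t"] by simp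
      ultimately show ?thesis by (rule order_trans[rotated])
    qed
    ultimately show ?case by (simp add: picard_invariant_def X_def)
  next
    case (Suc k)
    show ?case unfolding XS by (rule picard_preserves_invariant[OF t \<alpha> R Suc W K_def])
  qed
  have bdM: "norm (Z s) \<le> M" if "picard_invariant t W R K Z" "s \<le> T" for Z s
  proof -
    have "norm (Z s) \<le> (1 + R) * exp (3 * C_f * (max s t - t))" using that unfolding picard_invariant_def by blast
    also have "\<dots> \<le> M" unfolding M_def using R C_f_pos that(2) t by (intro mult_left_mono) auto
    finally show ?thesis .
  qed
  have diff: "norm (X (Suc k) s - X k s) \<le> 2 * M / 2 ^ k * exp (B * (max s t - t))" if "s \<le> T" for k s
    using that
  proof (induction k arbitrary: s)
    case 0
    have "norm (X (Suc 0) s - X 0 s) \<le> norm (X (Suc 0) s) + norm (X 0 s)" by (rule norm_triangle_ineq4)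
    also have "\<dots> \<le> 2 * M" using bdM[OF inv 0, of "Suc 0"] bdM[OF inv 0, of 0] by simp
    also have "\<dots> = 2 * M * 1" by simp
    also have "\<dots> \<le> 2 * M * exp (B * (max s t - t))" using E(2)[OF 0] M0 by (intro mult_left_mono) auto
    finally show ?case by simp
  next
    case (Suc k)
    have "norm (picard t W \<alpha> (X (Suc k)) s - picard t W \<alpha> (X k) s) \<le> (2 * M / 2 ^ k) / 2 * exp (B * (max s t - t))"
      by (rule picard_contraction[OF t \<alpha> R K0 inv inv B_def _ Suc.IH Suc.prems]) (use M0 in auto)
    then show ?case by (simp add: XS mult.commute)
  qed
  have diff': "norm (X (Suc k) s - X k s) \<le> (2 * M * E) / 2 ^ k" if "s \<le> T" for k s
  proof -
    have "2 * M / 2 ^ k * exp (B * (max s t - t)) \<le> 2 * M / 2 ^ k * E"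
      using E(1)[OF that] M0 by (intro mult_left_mono) auto
    then show ?thesis using diff[OF that, of k] by simp
  qed
  have "\<exists>y. (\<lambda>k. X k s) \<longlonglongrightarrow> y \<and> (\<forall>k. norm (y - X k s) \<le> 2 * (2 * M * E) / 2 ^ k)" if "s \<le> T" for s
    by (rule geometric_limit[OF diff'[OF that]]) blast
  then obtain Y where Y: "\<And>s. s \<le> T \<Longrightarrow> (\<lambda>k. X k s) \<longlonglongrightarrow> Y s"
    "\<And>s k. s \<le> T \<Longrightarrow> norm (Y s - X k s) \<le> 2 * (2 * M * E) / 2 ^ k" by metis
  have tT: "t \<le> T" using t by simp
  have invY: "picard_invariant t W R K Y" by (rule picard_invariant_limit[OF inv Y(1) tT])
  have fixY: "Y s = picard t W \<alpha> Y s" if s: "s \<le> T" for s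
  proof (rule LIMSEQ_unique)
    show "(\<lambda>k. X (Suc k) s) \<longlonglongrightarrow> Y s" using Y(1)[OF s] by (rule LIMSEQ_Suc)
    have E0: "0 < E" by (simp add: E_def)
    have "norm (X (Suc k) s - picard t W \<alpha> Y s) \<le> (2 * M * E * E) / 2 ^ k" for k
    proof -
      have D0: "0 \<le> 2 * (2 * M * E) / 2 ^ k" using M0 E0 by simp
      have "norm (picard t W \<alpha> Y s - picard t W \<alpha> (X k) s) \<le> (2 * (2 * M * E) / 2 ^ k) / 2 * exp (B * (max s t - t))"
      proof (rule picard_contraction[OF t \<alpha> R K0 invY inv B_def D0 _ s])
        fix r assume r: "r \<le> T"
        have "2 * (2 * M * E) / 2 ^ k * 1 \<le> 2 * (2 * M * E) / 2 ^ k * exp (B * (max r t - t))"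
          using D0 E(2)[OF r] by (intro mult_left_mono) auto
        then show "norm (Y r - X k r) \<le> 2 * (2 * M * E) / 2 ^ k * exp (B * (max r t - t))"
          using Y(2)[OF r, of k] by linarith
      qed
      also have "\<dots> \<le> (2 * (2 * M * E) / 2 ^ k) / 2 * E" using M0 E0 E(1)[OF s] by (intro mult_left_mono) auto
      also have "\<dots> = (2 * M * E * E) / 2 ^ k" by simp
      finally show ?thesis by (simp add: XS norm_minus_commute)
    qed
    then have "eventually (\<lambda>k. norm (X (Suc k) s - picard t W \<alpha> Y s) \<le> (2 * M * E * E) / 2 ^ k) sequentially"
      by (intro always_eventually allI)
    moreover have "(\<lambda>k. (2 * M * E * E) / 2 ^ k) \<longlonglongrightarrow> 0"
      by (rule divide_power2_tendsto_0)
    ultimately have "(\<lambda>k. X (Suc k) s - picard t W \<alpha> Y s) \<longlonglongrightarrow> 0" by (rule Lim_null_comparison)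
    then show "(\<lambda>k. X (Suc k) s) \<longlonglongrightarrow> picard t W \<alpha> Y s" by (rule LIM_zero_cancel)
  qed
  show ?thesis by (rule that[OF invY fixY])
qed

text \<open>The fixed point is cut down to \<open>{t - taubar..T}\<close> to be extensional. It
  satisfies the differential equation only a.e., through the differentiation of the indefinite
  integral of a bounded function.\<close>

lemma traj_exists:
  assumes t: "t \<in> {t0..T}" and w: "w \<in> lip_space {-taubar..0}" and \<alpha>: "\<alpha> \<in> ctrl t"
  obtains x where "traj t w \<alpha> x"
proof -
  obtain R where R: "R > 0" and wR: "w \<in> W_set taubar R" using lip_space_W_set[OF w] by blast
  define W where "W s = w (max (-taubar) (min 0 s))" for s
  have W1: "lipschitz_on R UNIV W" unfolding W_def
    by (rule clamp_lipschitz[OF W_setD(2)[OF wR]]) (use taubar_nonneg in simp)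
  have W2: "norm (W s) \<le> R" for s unfolding W_def
    by (rule W_setD(3)[OF wR]) (use taubar_nonneg in auto)
  have W3: "W s = W 0" if "0 \<le> s" for s using that by (simp add: W_def min_def)
  obtain K X where X: "picard_invariant t W R K X" and fp: "\<And>s. s \<le> T \<Longrightarrow> X s = picard t W \<alpha> X s"
    by (rule picard_fixpoint[OF t \<alpha> R W1 W2 W3]) (assumption | rule that)+
  define x where "x = restrict X {t - taubar..T}"
  have xX: "x s = X s" if "s \<in> {t - taubar..T}" for s using that by (simp add: x_def)
  \<comment> \<open>The delayed time stays in \<open>{t - taubar..T}\<close>, so the restriction is
    invisible to the equation.\<close>
  have rt: "rtime x s = rtime X s" "x (rtime x s) = X (rtime X s)" if "s \<in> {t..T}" for s
  proof -
    show 1: "rtime x s = rtime X s" using that taubar_nonneg xX[of s] by (simp add: rtime_def)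
    show "x (rtime x s) = X (rtime X s)"
      unfolding 1 by (rule xX) (use rtime_bounds[of s X] that t in auto)
  qed
  have lipX: "lipschitz_on K {..T} X" and initX: "\<And>s. s \<le> t \<Longrightarrow> X s = W (s - t)"
    using X unfolding picard_invariant_def by blast+
  have "lipschitz_on K {t - taubar..T} x"
  proof (rule lipschitz_on_transform)
    show "lipschitz_on K {t - taubar..T} X" by (rule lipschitz_on_subset[OF lipX]) auto
  qed (simp add: xX)
  then have "x \<in> lip_space {t - taubar..T}" unfolding lip_space_def x_def by auto
  moreover have "x (t + \<theta>) = w \<theta>" if "\<theta> \<in> {-taubar..0}" for \<theta>
  proof -
    have "x (t + \<theta>) = W \<theta>" using that t xX[of "t + \<theta>"] initX[of "t + \<theta>"] by simp
    moreover have "max (- taubar) (min 0 \<theta>) = \<theta>" using that by simp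
    ultimately show ?thesis by (simp only: W_def)
  qed
  moreover have "AE s in lebesgue. s \<in> {t<..<T} \<longrightarrow>
        (x has_vector_derivative f s (x s) (x (s - \<tau> s (x s))) (\<alpha> s)) (at s)"
    using indefinite_integral_derivative_AE[OF picard_invariant_integrable(3)[OF t \<alpha> R X order_refl order_refl] picard_invariant_integrable(1)[OF t \<alpha> R X]]
  proof eventually_elim
    case (elim s)
    show ?case
    proof
      assume s: "s \<in> {t<..<T}"
      have "((\<lambda>u. W 0 + integral {t..u} (picard_rhs t \<alpha> X)) has_vector_derivative picard_rhs t \<alpha> X s) (at s)"
        using has_vector_derivative_add[OF has_vector_derivative_const elim[rule_format, OF s]] by simp
      then have "(x has_vector_derivative picard_rhs t \<alpha> X s) (at s)"
      proof (rule has_vector_derivative_transform_within_open[of _ _ _ "{t<..<T}"])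
        fix u assume u: "u \<in> {t<..<T}"
        have "x u = X u" using u taubar_nonneg by (intro xX) auto
        also have "\<dots> = W (u - t) + integral {t..u} (picard_rhs t \<alpha> X)" using fp[of u] u by (simp add: picard_def)
        also have "W (u - t) = W 0" using u by (intro W3) simp
        finally show "W 0 + integral {t..u} (picard_rhs t \<alpha> X) = x u" by simp
      qed (use s in auto)
      moreover have "picard_rhs t \<alpha> X s = f s (x s) (x (s - \<tau> s (x s))) (\<alpha> s)"
        using rt[of s] xX[of s] s taubar_nonneg by (simp add: picard_rhs_def rtime_def)
      ultimately show "(x has_vector_derivative f s (x s) (x (s - \<tau> s (x s))) (\<alpha> s)) (at s)" by simp
    qed
  qed
  ultimately have "traj t w \<alpha> x" unfolding is_trajectory_def by blast
  then show ?thesis by (rule that)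
qed

text \<open>Existence and uniqueness together give meaning to the definite description in
  \<open>trajectory\<close>.\<close>

lemma trajectory_is_traj:
  assumes "t \<in> {t0..T}" "w \<in> lip_space {-taubar..0}" "\<alpha> \<in> ctrl t"
  shows "traj t w \<alpha> (trajectory T taubar \<tau> f t w \<alpha>)"
proof -
  obtain x where x: "traj t w \<alpha> x" by (rule traj_exists[OF assms])
  have "traj t w \<alpha> (The (traj t w \<alpha>))"
    by (rule theI[where P="traj t w \<alpha>", OF x]) (rule traj_unique[OF assms _ x])
  then show ?thesis unfolding trajectory_def .
qed

lemma trajectory_eq:
  assumes "t \<in> {t0..T}" "w \<in> lip_space {-taubar..0}" "\<alpha> \<in> ctrl t" "traj t w \<alpha> x"
  shows "trajectory T taubar \<tau> f t w \<alpha> = x"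
  using traj_unique[OF assms(1-3) trajectory_is_traj[OF assms(1-3)] assms(4)] .

end

section \<open>Dynamic programming\<close>

context delay_control
begin

abbreviation val :: "real \<Rightarrow> (real \<Rightarrow> real ^ 'n) \<Rightarrow> real" where
  "val \<equiv> value_functional T taubar \<tau> A f L g"

abbreviation J :: "real \<Rightarrow> (real \<Rightarrow> real ^ 'n) \<Rightarrow> (real \<Rightarrow> real ^ 'm) \<Rightarrow> real" where
  "J \<equiv> cost T taubar \<tau> f L g"

section \<open>Running cost, terminal cost and the distance of histories\<close>

definition running :: "(real \<Rightarrow> real ^ 'm) \<Rightarrow> (real \<Rightarrow> real ^ 'n) \<Rightarrow> real \<Rightarrow> real" where
  "running \<alpha> x r = L r (x r) (x (rtime x r)) (\<alpha> r)"

lemma running_bound: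
  assumes t: "t \<in> {t0..T}" and \<alpha>: "\<alpha> \<in> ctrl t" and r: "r \<in> {t<..<T}"
    and B: "\<And>s. s \<in> {t - taubar..T} \<Longrightarrow> norm (x s) \<le> B"
  shows "\<bar>running \<alpha> x r\<bar> \<le> C_L * (1 + 2 * B)"
proof -
  have r': "r \<in> {t0..T}" "t0 \<le> r" "r \<le> T" using r t by auto
  have "rtime x r \<in> {t - taubar..T}" "r \<in> {t - taubar..T}"
    using rtime_bounds[OF r'(2,3), of x] r taubar_nonneg by auto
  then have "norm (x r) \<le> B" "norm (x (rtime x r)) \<le> B" using B by blast+
  then have "C_L * (1 + norm (x r) + norm (x (rtime x r))) \<le> C_L * (1 + 2 * B)"
    using C_L_pos by (intro mult_left_mono) auto
  then show ?thesis using L_growth[OF r'(1) ctrlD[OF \<alpha> r], of "x r" "x (rtime x r)"]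
    unfolding running_def by linarith
qed

lemma running_integrable:
  assumes t: "t \<in> {t0..T}" and \<alpha>: "\<alpha> \<in> ctrl t" and x: "traj t w \<alpha> x"
  shows "running \<alpha> x absolutely_integrable_on {t..T}"
    "\<And>u v. t \<le> u \<Longrightarrow> v \<le> T \<Longrightarrow> running \<alpha> x integrable_on {u..v}"
proof -
  have t': "t0 \<le> t" using t by simp
  have c: "continuous_on {t..T} x" by (rule continuous_on_subset[OF traj_cont[OF x]]) (use taubar_nonneg in auto)
  have "bounded (x ` {t - taubar..T})"
    using traj_cont[OF x] by (intro compact_imp_bounded compact_continuous_image) auto
  then obtain B where B: "\<And>r. r \<in> {t - taubar..T} \<Longrightarrow> norm (x r) \<le> B" unfolding bounded_iff by blast
  show ai: "running \<alpha> x absolutely_integrable_on {t..T}"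
    unfolding running_def[abs_def]
  proof (rule integrand_integrable[OF L_cont t' \<alpha> c rtime_cont(2)[OF t' x]])
    show "norm (L r (x r) (x (rtime x r)) (\<alpha> r)) \<le> C_L * (1 + 2 * B)" if "r \<in> {t<..<T}" for r
      using running_bound[where B=B and x=x, OF t \<alpha> that B] by (simp add: running_def)
  qed
  have "running \<alpha> x integrable_on {t..T}" using ai set_lebesgue_integral_eq_integral(1) by blast
  then show "running \<alpha> x integrable_on {u..v}" if "t \<le> u" "v \<le> T" for u v
    by (rule integrable_subinterval_real) (use that in auto)
qed

lemma running_integral_bound:
  assumes t: "t \<in> {t0..T}" and \<alpha>: "\<alpha> \<in> ctrl t" and x: "traj t w \<alpha> x"
    and B: "\<And>s. s \<in> {t - taubar..T} \<Longrightarrow> norm (x s) \<le> B" and s: "s \<in> {t..T}"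
  shows "\<bar>integral {t..s} (running \<alpha> x)\<bar> \<le> C_L * (1 + 2 * B) * (s - t)"
proof -
  have "norm (integral {t..s} (running \<alpha> x)) \<le> integral {t..s} (\<lambda>_. C_L * (1 + 2 * B))"
  proof (rule has_integral_norm_le_interior)
    show "(running \<alpha> x has_integral integral {t..s} (running \<alpha> x)) {t..s}"
      using running_integrable(2)[OF t \<alpha> x, of t s] s by auto
    show "norm (running \<alpha> x r) \<le> C_L * (1 + 2 * B)" if "r \<in> {t<..<s}" for r
      using running_bound[where B=B and x=x, OF t \<alpha> _ B, of r] that s by simp
  qed auto
  also have "\<dots> = (s - t) * (C_L * (1 + 2 * B))" using s by simp
  finally show ?thesis by (simp add: mult.commute)
qed

text \<open>The cost is defined by a Lebesgue set integral; absolute integrability of the running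
  cost identifies it with the gauge integral in which all estimates are made.\<close>

lemma cost_eq:
  assumes t: "t \<in> {t0..T}" and w: "w \<in> lip_space {-taubar..0}" and \<alpha>: "\<alpha> \<in> ctrl t" and x: "traj t w \<alpha> x"
  shows "J t w \<alpha> = integral {t..T} (running \<alpha> x) + g (x T, hist taubar x T)"
proof -
  have "(LINT s:{t..T}|lebesgue. running \<alpha> x s) = integral {t..T} (running \<alpha> x)"
    by (rule set_lebesgue_integral_eq_integral(2)[OF running_integrable(1)[OF t \<alpha> x]])
  then show ?thesis
    unfolding cost_def trajectory_eq[OF t w \<alpha> x] Let_def by (simp add: running_def[abs_def] rtime_def)
qed

lemma hist_traj:
  assumes "traj t w \<alpha> x" "t \<le> s" "s \<le> T"
  shows "hist taubar x s \<in> lip_space {-taubar..0}" "hist taubar x s 0 = x s"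
proof -
  obtain K where K: "lipschitz_on K {t - taubar..T} x" using traj_lip[OF assms(1)] by blast
  have "lipschitz_on K {-taubar..0} (hist taubar x s)"
  proof (rule lipschitz_onI)
    fix u v assume uv: "u \<in> {-taubar..0}" "v \<in> {-taubar..0}"
    have "dist (x (s + u)) (x (s + v)) \<le> K * dist (s + u) (s + v)"
      by (rule lipschitz_onD[OF K]) (use uv assms in auto)
    then show "dist (hist taubar x s u) (hist taubar x s v) \<le> K * dist u v" using uv by (simp add: hist_def)
  qed (rule lipschitz_on_nonneg[OF K])
  then show "hist taubar x s \<in> lip_space {-taubar..0}" unfolding lip_space_def hist_def by auto
  show "hist taubar x s 0 = x s" using taubar_nonneg by (simp add: hist_def)
qed

lemma terminal_lipschitz:
  assumes "R > 0"
  obtains lam where "lam > 0" "\<And>w1 w2. w1 \<in> W_set taubar R \<Longrightarrow> w2 \<in> W_set taubar R \<Longrightarrow>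
    \<bar>g (w1 0, w1) - g (w2 0, w2)\<bar> \<le> lam * hdist w1 w2"
proof -
  obtain lam where lam: "lam > 0" "\<forall>z1 w1 z2 w2.
         (z1, w1) \<in> X_space taubar \<longrightarrow> (z2, w2) \<in> X_space taubar \<longrightarrow>
         w1 \<in> P_set taubar R \<longrightarrow> w2 \<in> P_set taubar R \<longrightarrow>
           \<bar>g (z1, w1) - g (z2, w2)\<bar> \<le> lam * X_norm taubar (z1 - z2, \<lambda>\<theta>. w1 \<theta> - w2 \<theta>)"
    using g_lip[OF assms] by blast
  show ?thesis
  proof (rule that[OF lam(1)])
    fix w1 w2 :: "real \<Rightarrow> real ^ 'n" assume w: "w1 \<in> W_set taubar R" "w2 \<in> W_set taubar R"
    have "(w1 0, w1) \<in> X_space taubar" "(w2 0, w2) \<in> X_space taubar"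
      using W_setD(4)[OF w(1)] W_setD(4)[OF w(2)] by (auto simp: X_space_def)
    then have "\<bar>g (w1 0, w1) - g (w2 0, w2)\<bar> \<le> lam * X_norm taubar (w1 0 - w2 0, \<lambda>\<theta>. w1 \<theta> - w2 \<theta>)"
      using lam(2) W_set_P_set[OF taubar_nonneg w(1)] W_set_P_set[OF taubar_nonneg w(2)] by blast
    then show "\<bar>g (w1 0, w1) - g (w2 0, w2)\<bar> \<le> lam * hdist w1 w2"
      by (simp add: X_norm_def hdist_def)
  qed
qed

lemma hdist_nonneg: "w1 \<in> W_set taubar R \<Longrightarrow> w2 \<in> W_set taubar R \<Longrightarrow> 0 \<le> hdist w1 w2"
  using hdist_eq[of w1 R w2] norm_ge_zero[of "w1 0 - w2 0"] by linarith

lemma hdist_commute: "hdist w1 w2 = hdist w2 w1"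
  unfolding hdist_def L1_norm_def by (simp add: norm_minus_commute)

lemma hdist_integrable:
  assumes "w1 \<in> W_set taubar R" "w2 \<in> W_set taubar R"
  shows "(\<lambda>\<theta>. norm (w1 \<theta> - w2 \<theta>)) integrable_on {-taubar..0}"
  by (intro integrable_continuous_real continuous_on_norm continuous_on_diff W_setD(5)[OF assms(1)] W_setD(5)[OF assms(2)])

lemma hdist_triangle:
  assumes w: "w1 \<in> W_set taubar R" "w2 \<in> W_set taubar R" "w3 \<in> W_set taubar R"
  shows "hdist w1 w3 \<le> hdist w1 w2 + hdist w2 w3"
proof -
  have tri: "norm (w1 \<theta> - w3 \<theta>) \<le> norm (w1 \<theta> - w2 \<theta>) + norm (w2 \<theta> - w3 \<theta>)" for \<theta>
    using norm_triangle_ineq[of "w1 \<theta> - w2 \<theta>" "w2 \<theta> - w3 \<theta>"] by simp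
  have "integral {-taubar..0} (\<lambda>\<theta>. norm (w1 \<theta> - w3 \<theta>)) \<le>
      integral {-taubar..0} (\<lambda>\<theta>. norm (w1 \<theta> - w2 \<theta>) + norm (w2 \<theta> - w3 \<theta>))"
    by (rule integral_le[OF hdist_integrable[OF w(1,3)] integrable_add[OF hdist_integrable[OF w(1,2)] hdist_integrable[OF w(2,3)]] tri])
  also have "\<dots> = integral {-taubar..0} (\<lambda>\<theta>. norm (w1 \<theta> - w2 \<theta>)) + integral {-taubar..0} (\<lambda>\<theta>. norm (w2 \<theta> - w3 \<theta>))"
    by (rule Henstock_Kurzweil_Integration.integral_add[OF hdist_integrable[OF w(1,2)] hdist_integrable[OF w(2,3)]])
  finally show ?thesis
    using tri[of 0] hdist_eq(1)[OF w(1) w(2)] hdist_eq(1)[OF w(2) w(3)] hdist_eq(1)[OF w(1) w(3)] by linarith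
qed

lemma hdist_bound:
  assumes w: "w1 \<in> W_set taubar R" "w2 \<in> W_set taubar R"
    and e: "\<And>\<theta>. \<theta> \<in> {-taubar..0} \<Longrightarrow> norm (w1 \<theta> - w2 \<theta>) \<le> e"
  shows "hdist w1 w2 \<le> (1 + taubar) * e"
proof -
  have "integral {-taubar..0} (\<lambda>\<theta>. norm (w1 \<theta> - w2 \<theta>)) \<le> integral {-taubar..0} (\<lambda>_. e)"
    by (rule integral_le[OF hdist_integrable[OF w] integrable_const_ivl e])
  also have "\<dots> = taubar * e" using taubar_nonneg by simp
  finally show ?thesis using hdist_eq(1)[OF w] e[of 0] taubar_nonneg by (simp add: distrib_right)
qed

text \<open>An infimum of reals is informative only for sets bounded below. The running cost is
  bounded along uniformly bounded trajectories, and the terminal cost is compared with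
  \<open>g (w 0, w)\<close>, since \<open>g\<close> is controlled only through differences.\<close>

lemma cost_bdd_below:
  assumes t: "t \<in> {t0..T}" and w: "w \<in> lip_space {-taubar..0}"
  shows "bdd_below (J t w ` ctrl t)"
proof -
  obtain R where R: "R > 0" and wR: "w \<in> W_set taubar R" using lip_space_W_set[OF w] by blast
  obtain K where K: "K \<ge> R" and lipK: "\<And>t w \<alpha> x. t \<in> {t0..T} \<Longrightarrow> w \<in> W_set taubar R \<Longrightarrow> \<alpha> \<in> ctrl t \<Longrightarrow> traj t w \<alpha> x \<Longrightarrow>
      lipschitz_on K {t - taubar..T} x \<and> (\<forall>s\<in>{t - taubar..T}. norm (x s) \<le> K)"
    by (rule traj_lipschitz_uniform[OF R]) (rule that)
  have K0: "K > 0" using K R by linarith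
  obtain lam where lam: "lam > 0" "\<And>w1 w2. w1 \<in> W_set taubar K \<Longrightarrow> w2 \<in> W_set taubar K \<Longrightarrow>
    \<bar>g (w1 0, w1) - g (w2 0, w2)\<bar> \<le> lam * hdist w1 w2"
    by (rule terminal_lipschitz[OF K0]) (rule that)
  have wK: "w \<in> W_set taubar K" by (rule W_set_mono[OF wR K])
  have "g (w 0, w) - lam * ((1 + taubar) * (2 * K)) - C_L * (1 + 2 * K) * (T - t) \<le> J t w \<alpha>" if \<alpha>: "\<alpha> \<in> ctrl t" for \<alpha>
  proof -
    obtain x where x: "traj t w \<alpha> x" by (rule traj_exists[OF t w \<alpha>])
    have lipx: "lipschitz_on K {t - taubar..T} x" and bx: "\<And>s. s \<in> {t - taubar..T} \<Longrightarrow> norm (x s) \<le> K"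
      using lipK[OF t wR \<alpha> x] by blast+
    have hK: "hist taubar x T \<in> W_set taubar K"
      by (rule hist_W_set) (auto intro!: lipschitz_on_subset[OF lipx] bx, use t in auto)
    have "hdist (hist taubar x T) w \<le> (1 + taubar) * (2 * K)"
    proof (rule hdist_bound[OF hK wK])
      fix \<theta> assume "\<theta> \<in> {-taubar..0}"
      then show "norm (hist taubar x T \<theta> - w \<theta>) \<le> 2 * K"
        using W_setD(3)[OF hK] W_setD(3)[OF wK] norm_triangle_ineq4[of "hist taubar x T \<theta>" "w \<theta>"] by fastforce
    qed
    then have "lam * hdist (hist taubar x T) w \<le> lam * ((1 + taubar) * (2 * K))" using lam(1) by simp
    moreover have "\<bar>g (x T, hist taubar x T) - g (w 0, w)\<bar> \<le> lam * hdist (hist taubar x T) w"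
      using lam(2)[OF hK wK] hist_traj(2)[OF x, of T] t by simp
    moreover have "\<bar>integral {t..T} (running \<alpha> x)\<bar> \<le> C_L * (1 + 2 * K) * (T - t)"
      by (rule running_integral_bound[OF t \<alpha> x bx]) (use t in auto)
    ultimately show ?thesis unfolding cost_eq[OF t w \<alpha> x] by linarith
  qed
  then show ?thesis by (rule bdd_belowI2)
qed

lemma ctrl_nonempty: "ctrl t \<noteq> {}"
  using A_nonempty ctrl_const by blast

lemma val_le_cost:
  assumes "t \<in> {t0..T}" "t < T" "w \<in> lip_space {-taubar..0}" "\<alpha> \<in> ctrl t"
  shows "val t w \<le> J t w \<alpha>"
  using cINF_lower[OF cost_bdd_below[OF assms(1,3)] assms(4)] assms(2)
  unfolding value_functional_def by simp

lemma val_approx: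
  assumes "t \<in> {t0..T}" "t < T" "w \<in> lip_space {-taubar..0}" "0 < e"
  obtains \<alpha> where "\<alpha> \<in> ctrl t" "J t w \<alpha> < val t w + e"
proof -
  have "(INF \<alpha>\<in>ctrl t. J t w \<alpha>) < val t w + e" using assms unfolding value_functional_def by simp
  then show ?thesis
    using cINF_less_iff[OF ctrl_nonempty cost_bdd_below[OF assms(1,3)]] that by blast
qed

section \<open>Restriction and concatenation of controls and trajectories\<close>

lemma ctrl_mono:
  assumes "\<alpha> \<in> ctrl t" "t \<le> s"
  shows "\<alpha> \<in> ctrl s"
proof -
  have "\<alpha> \<in> borel_measurable (lebesgue_on {t<..<T})" using assms unfolding controls_def by blast
  then have "\<alpha> \<in> borel_measurable (lebesgue_on {s<..<T})"
    by (rule measurable_restrict_mono) (use assms in auto)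
  then show ?thesis using assms unfolding controls_def by auto
qed

text \<open>After \<open>s\<close> the equation reads only states at times at least
  \<open>s - taubar\<close>, and those up to \<open>s\<close> are recorded in the history at
  \<open>s\<close>.\<close>

lemma traj_restart:
  assumes x: "traj t w \<alpha> x" and s: "t \<le> s" "s \<le> T" "t0 \<le> t"
  shows "traj s (hist taubar x s) \<alpha> (restrict x {s - taubar..T})"
proof -
  let ?y = "restrict x {s - taubar..T}"
  obtain K where K: "lipschitz_on K {t - taubar..T} x" using traj_lip[OF x] by blast
  have yx: "?y r = x r" if "r \<in> {s - taubar..T}" for r using that by simp
  have "lipschitz_on K {s - taubar..T} ?y"
  proof (rule lipschitz_on_transform)
    show "lipschitz_on K {s - taubar..T} x" by (rule lipschitz_on_subset[OF K]) (use s in auto)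
  qed simp
  then have "?y \<in> lip_space {s - taubar..T}" unfolding lip_space_def by auto
  moreover have "?y (s + \<theta>) = hist taubar x s \<theta>" if "\<theta> \<in> {-taubar..0}" for \<theta>
    using that s by (simp add: hist_def)
  moreover have "AE r in lebesgue. r \<in> {s<..<T} \<longrightarrow>
        (?y has_vector_derivative f r (?y r) (?y (r - \<tau> r (?y r))) (\<alpha> r)) (at r)"
    using traj_deriv[OF x]
  proof eventually_elim
    case (elim r)
    show ?case
    proof
      assume r: "r \<in> {s<..<T}"
      have y1: "?y r = x r" using r taubar_nonneg by simp
      have "rtime x r \<in> {s - taubar..T}" using rtime_bounds[of r x] r s by auto
      then have y2: "?y (r - \<tau> r (x r)) = x (rtime x r)" by (simp add: rtime_def)
      have "(x has_vector_derivative f r (x r) (x (rtime x r)) (\<alpha> r)) (at r)" using elim r s by auto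
      then have "(?y has_vector_derivative f r (x r) (x (rtime x r)) (\<alpha> r)) (at r)"
        by (rule has_vector_derivative_transform_within_open[of _ _ _ "{s<..<T}"]) (use r taubar_nonneg in auto)
      then show "(?y has_vector_derivative f r (?y r) (?y (r - \<tau> r (?y r))) (\<alpha> r)) (at r)" unfolding y1 y2 .
    qed
  qed
  ultimately show ?thesis unfolding is_trajectory_def by blast
qed

lemma ctrl_concat:
  assumes \<alpha>: "\<alpha> \<in> ctrl t" and \<beta>: "\<beta> \<in> ctrl s" and s: "t < s" "s < T"
  shows "(\<lambda>r. if r \<le> s then \<alpha> r else \<beta> r) \<in> ctrl t"
proof -
  let ?\<gamma> = "\<lambda>r. if r \<le> s then \<alpha> r else \<beta> r"
  have \<alpha>m: "\<alpha> \<in> borel_measurable (lebesgue_on {t<..s})"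
    using \<alpha> s unfolding controls_def by (auto intro: measurable_restrict_mono[of _ _ "{t<..<T}"])
  have \<beta>m: "\<beta> \<in> borel_measurable (lebesgue_on {s<..<T})" using \<beta> unfolding controls_def by blast
  have "?\<gamma> \<in> borel_measurable (lebesgue_on {t<..<T})"
  proof (rule measurable_piecewise_restrict[of "{{..s}, {s<..}}"])
    fix \<Omega> :: "real set" assume \<Omega>: "\<Omega> \<in> {{..s}, {s<..}}"
    show "\<Omega> \<inter> space (lebesgue_on {t<..<T}) \<in> sets (lebesgue_on {t<..<T})"
      using \<Omega> by (auto simp: sets_restrict_space)
    have i: "{t<..<T} \<inter> {..s} = {t<..s}" "{t<..<T} \<inter> {s<..} = {s<..<T}" using s by auto
    show "?\<gamma> \<in> measurable (restrict_space (lebesgue_on {t<..<T}) \<Omega>) borel"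
    proof (cases "\<Omega> = {..s}")
      case True
      have "?\<gamma> \<in> borel_measurable (lebesgue_on {t<..s})"
        by (rule measurable_cong[THEN iffD1, OF _ \<alpha>m]) auto
      then show ?thesis using True by (simp add: restrict_restrict_space i)
    next
      case False
      then have \<Omega>': "\<Omega> = {s<..}" using \<Omega> by auto
      have "?\<gamma> \<in> borel_measurable (lebesgue_on {s<..<T})"
        by (rule measurable_cong[THEN iffD1, OF _ \<beta>m]) auto
      then show ?thesis using \<Omega>' by (simp add: restrict_restrict_space i)
    qed
  qed auto
  then show ?thesis using \<alpha> \<beta> s unfolding controls_def by auto
qed

text \<open>Before \<open>s\<close> the delayed time is before \<open>s\<close> as well, so only
  \<open>x\<close> is read; after \<open>s\<close> it is at least \<open>s - taubar\<close>, where
  \<open>y\<close> is defined and, up to \<open>s\<close>, agrees with \<open>x\<close>. The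
  possible corner at \<open>s\<close> is a null set.\<close>

lemma traj_concat:
  assumes x: "traj t w \<alpha> x" and y: "traj s (hist taubar x s) \<beta> y" and s: "t < s" "s < T" "t0 \<le> t"
  defines "z \<equiv> restrict (\<lambda>r. if r \<le> s then x r else y r) {t - taubar..T}"
  shows "traj t w (\<lambda>r. if r \<le> s then \<alpha> r else \<beta> r) z"
    "\<And>r. r \<in> {t - taubar..s} \<Longrightarrow> z r = x r" "\<And>r. r \<in> {s - taubar..T} \<Longrightarrow> z r = y r"
proof -
  have yx: "y r = x r" if "r \<in> {s - taubar..s}" for r
    using traj_init[OF y, of "r - s"] that by (simp add: hist_def)
  show zx: "z r = x r" if "r \<in> {t - taubar..s}" for r using that s by (simp add: z_def)
  show zy: "z r = y r" if "r \<in> {s - taubar..T}" for r using that s yx[of r] by (simp add: z_def)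
  obtain K1 where K1: "lipschitz_on K1 {t - taubar..T} x" using traj_lip[OF x] by blast
  obtain K2 where K2: "lipschitz_on K2 {s - taubar..T} y" using traj_lip[OF y] by blast
  define K where "K = max K1 K2"
  have "lipschitz_on K {t - taubar..T} (\<lambda>r. if r \<le> s then x r else y r)"
  proof (rule lipschitz_on_concat)
    show "lipschitz_on K {t - taubar..s} x" by (rule lipschitz_on_mono[OF K1]) (use s in \<open>auto simp: K_def\<close>)
    show "lipschitz_on K {s..T} y" by (rule lipschitz_on_mono[OF K2]) (use taubar_nonneg in \<open>auto simp: K_def\<close>)
    show "x s = y s" using yx[of s] taubar_nonneg by simp
  qed
  then have "lipschitz_on K {t - taubar..T} z"
    by (rule lipschitz_on_transform) (simp add: z_def)
  then have "z \<in> lip_space {t - taubar..T}" unfolding lip_space_def z_def by auto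
  moreover have "z (t + \<theta>) = w \<theta>" if "\<theta> \<in> {-taubar..0}" for \<theta>
    using zx[of "t + \<theta>"] traj_init[OF x that] that s by simp
  moreover have "AE r in lebesgue. r \<in> {t<..<T} \<longrightarrow>
        (z has_vector_derivative f r (z r) (z (r - \<tau> r (z r))) (if r \<le> s then \<alpha> r else \<beta> r)) (at r)"
  proof -
    have "AE r in lebesgue. r \<noteq> s" by (rule AE_I'[of "{s}"]) auto
    then show ?thesis using traj_deriv[OF x] traj_deriv[OF y]
    proof eventually_elim
      case (elim r)
      show ?case
      proof
        assume r: "r \<in> {t<..<T}"
        have r': "t0 \<le> r" "r \<le> T" using r s by auto
        show "(z has_vector_derivative f r (z r) (z (r - \<tau> r (z r))) (if r \<le> s then \<alpha> r else \<beta> r)) (at r)"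
        proof (cases "r < s")
          case True
          have z1: "z r = x r" using r True taubar_nonneg by (intro zx) auto
          have "z (rtime x r) = x (rtime x r)" by (rule zx) (use rtime_bounds[OF r', of x] r True in auto)
          then have z2: "z (r - \<tau> r (x r)) = x (rtime x r)" unfolding rtime_def .
          have "(x has_vector_derivative f r (x r) (x (rtime x r)) (\<alpha> r)) (at r)" using elim(2) r by blast
          then have "(z has_vector_derivative f r (x r) (x (rtime x r)) (\<alpha> r)) (at r)"
            by (rule has_vector_derivative_transform_within_open[of _ _ _ "{t<..<s}"])
              (use r True taubar_nonneg zx in auto)
          then show ?thesis using True unfolding z1 z2 by simp
        next
          case False
          then have rs: "s < r" using elim(1) by simp
          have z1: "z r = y r" using r rs taubar_nonneg by (intro zy) auto
          have "z (rtime y r) = y (rtime y r)" by (rule zy) (use rtime_bounds[OF r', of y] r rs in auto)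
          then have z2: "z (r - \<tau> r (y r)) = y (rtime y r)" unfolding rtime_def .
          have "(y has_vector_derivative f r (y r) (y (rtime y r)) (\<beta> r)) (at r)" using elim(3) r rs by auto
          then have "(z has_vector_derivative f r (y r) (y (rtime y r)) (\<beta> r)) (at r)"
            by (rule has_vector_derivative_transform_within_open[of _ _ _ "{s<..<T}"])
              (use r rs taubar_nonneg zy in auto)
          then show ?thesis using rs unfolding z1 z2 by simp
        qed
      qed
    qed
  qed
  ultimately show "traj t w (\<lambda>r. if r \<le> s then \<alpha> r else \<beta> r) z" unfolding is_trajectory_def by blast
qed

lemma val_terminal: "val T w = g (w 0, w)"
  by (simp add: value_functional_def)

text \<open>The given control up to \<open>s\<close>, followed by a nearly optimal one for the
  history reached at \<open>s\<close>, is admissible from \<open>t\<close>, and its cost is the sum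
  of the two parts. The case \<open>s = T\<close> is separate because the value there is the
  terminal cost.\<close>

lemma dynamic_programming_le:
  assumes t: "t \<in> {t0..T}" and w: "w \<in> lip_space {-taubar..0}" and \<alpha>: "\<alpha> \<in> ctrl t" and x: "traj t w \<alpha> x"
    and s: "t < s" "s \<le> T"
  shows "val t w \<le> integral {t..s} (running \<alpha> x) + val s (hist taubar x s)"
proof (cases "s = T")
  case True
  have "val t w \<le> J t w \<alpha>" using val_le_cost[OF t _ w \<alpha>] s by simp
  then show ?thesis using cost_eq[OF t w \<alpha> x] hist_traj(2)[OF x, of T] s True by (simp add: val_terminal)
next
  case False
  then have sT: "s < T" using s by simp
  have s': "s \<in> {t0..T}" "t0 \<le> t" "t \<le> s" using t s by auto
  let ?h = "hist taubar x s"
  have h: "?h \<in> lip_space {-taubar..0}" using hist_traj(1)[OF x s'(3) s(2)] .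
  show ?thesis
  proof (rule field_le_epsilon)
    fix e :: real assume "0 < e"
    then obtain \<beta> where \<beta>: "\<beta> \<in> ctrl s" "J s ?h \<beta> < val s ?h + e" using val_approx[OF s'(1) sT h] by blast
    obtain y where y: "traj s ?h \<beta> y" by (rule traj_exists[OF s'(1) h \<beta>(1)])
    define \<gamma> where "\<gamma> r = (if r \<le> s then \<alpha> r else \<beta> r)" for r
    define z where "z = restrict (\<lambda>r. if r \<le> s then x r else y r) {t - taubar..T}"
    have \<gamma>: "\<gamma> \<in> ctrl t" unfolding \<gamma>_def[abs_def] by (rule ctrl_concat[OF \<alpha> \<beta>(1) s(1) sT])
    have z: "traj t w \<gamma> z" and zx: "\<And>r. r \<in> {t - taubar..s} \<Longrightarrow> z r = x r" and zy: "\<And>r. r \<in> {s - taubar..T} \<Longrightarrow> z r = y r"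
      using traj_concat[OF x y s(1) sT s'(2)] unfolding \<gamma>_def[abs_def] z_def by blast+
    have i1: "integral {t..s} (running \<gamma> z) = integral {t..s} (running \<alpha> x)"
    proof (rule integral_cong)
      fix r assume r: "r \<in> {t..s}"
      have z1: "z r = x r" using r taubar_nonneg by (intro zx) auto
      have "z (rtime x r) = x (rtime x r)" by (rule zx) (use rtime_bounds[of r x] r s s' in auto)
      then show "running \<gamma> z r = running \<alpha> x r"
        using r z1 by (simp add: running_def rtime_def \<gamma>_def)
    qed
    \<comment> \<open>At \<open>r = s\<close> the concatenated control still has the value of
      \<open>\<alpha>\<close>, so the integrands may differ at this one point.\<close>
    have i2: "integral {s..T} (running \<gamma> z) = integral {s..T} (running \<beta> y)"
    proof (rule integral_spike[of "{s}"])
      fix r assume r: "r \<in> {s..T} - {s}"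
      have z1: "z r = y r" using r taubar_nonneg by (intro zy) auto
      have "z (rtime y r) = y (rtime y r)" by (rule zy) (use rtime_bounds[of r y] r s s' in auto)
      then show "running \<beta> y r = running \<gamma> z r"
        using r z1 by (simp add: running_def rtime_def \<gamma>_def)
    qed simp
    have hz: "hist taubar z T = hist taubar y T" unfolding hist_def
      by (rule restrict_ext) (use zy sT in auto)
    have zT: "z T = y T" using zy[of T] sT taubar_nonneg by simp
    have "val t w \<le> J t w \<gamma>" using val_le_cost[OF t _ w \<gamma>] s by simp
    also have "\<dots> = integral {t..T} (running \<gamma> z) + g (y T, hist taubar y T)"
      using cost_eq[OF t w \<gamma> z] by (simp only: hz zT)
    also have "integral {t..T} (running \<gamma> z) = integral {t..s} (running \<gamma> z) + integral {s..T} (running \<gamma> z)"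
      using Henstock_Kurzweil_Integration.integral_combine[OF s'(3) s(2) running_integrable(2)[OF t \<gamma> z order_refl order_refl]] by simp
    finally have "val t w \<le> integral {t..s} (running \<alpha> x) + J s ?h \<beta>"
      using cost_eq[OF s'(1) h \<beta>(1) y] i1 i2 by simp
    then show "val t w \<le> integral {t..s} (running \<alpha> x) + val s ?h + e" using \<beta>(2) by linarith
  qed
qed

text \<open>A control that is nearly optimal from \<open>t\<close> is admissible from
  \<open>s\<close> for the history it has reached, so its remaining cost is at least the value
  there.\<close>

lemma dynamic_programming_ge:
  assumes t: "t \<in> {t0..T}" and w: "w \<in> lip_space {-taubar..0}" and s: "t < s" "s \<le> T" and e: "0 < e"
  obtains \<alpha> x where "\<alpha> \<in> ctrl t" "traj t w \<alpha> x"
    "integral {t..s} (running \<alpha> x) + val s (hist taubar x s) \<le> val t w + e"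
proof -
  have tT: "t < T" using s by simp
  obtain \<alpha> where \<alpha>: "\<alpha> \<in> ctrl t" "J t w \<alpha> < val t w + e" using val_approx[OF t tT w e] by blast
  obtain x where x: "traj t w \<alpha> x" by (rule traj_exists[OF t w \<alpha>(1)])
  have s': "s \<in> {t0..T}" "t0 \<le> t" "t \<le> s" using t s by auto
  let ?h = "hist taubar x s"
  have h: "?h \<in> lip_space {-taubar..0}" using hist_traj(1)[OF x s'(3) s(2)] .
  have "integral {t..s} (running \<alpha> x) + val s ?h \<le> J t w \<alpha>"
  proof (cases "s = T")
    case True
    then show ?thesis using cost_eq[OF t w \<alpha>(1) x] hist_traj(2)[OF x, of T] s by (simp add: val_terminal)
  next
    case False
    then have sT: "s < T" using s by simp
    define y where "y = restrict x {s - taubar..T}"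
    have y: "traj s ?h \<alpha> y" unfolding y_def by (rule traj_restart[OF x s'(3) s(2) s'(2)])
    have \<alpha>s: "\<alpha> \<in> ctrl s" by (rule ctrl_mono[OF \<alpha>(1) s'(3)])
    have yx: "y r = x r" if "r \<in> {s - taubar..T}" for r using that by (simp add: y_def)
    have i2: "integral {s..T} (running \<alpha> y) = integral {s..T} (running \<alpha> x)"
    proof (rule integral_cong)
      fix r assume r: "r \<in> {s..T}"
      have z1: "y r = x r" using r taubar_nonneg by (intro yx) auto
      have "y (rtime x r) = x (rtime x r)" by (rule yx) (use rtime_bounds[of r x] r s s' in auto)
      then show "running \<alpha> y r = running \<alpha> x r" using z1 by (simp add: running_def rtime_def)
    qed
    have hy: "hist taubar y T = hist taubar x T" unfolding hist_def
      by (rule restrict_ext) (use yx sT in auto)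
    have yT: "y T = x T" using yx[of T] sT taubar_nonneg by simp
    have "val s ?h \<le> J s ?h \<alpha>" by (rule val_le_cost[OF s'(1) sT h \<alpha>s])
    also have "\<dots> = integral {s..T} (running \<alpha> x) + g (x T, hist taubar x T)"
      using cost_eq[OF s'(1) h \<alpha>s y] by (simp only: i2 hy yT)
    finally have "integral {t..s} (running \<alpha> x) + val s ?h \<le>
        integral {t..s} (running \<alpha> x) + integral {s..T} (running \<alpha> x) + g (x T, hist taubar x T)" by simp
    also have "integral {t..s} (running \<alpha> x) + integral {s..T} (running \<alpha> x) = integral {t..T} (running \<alpha> x)"
      by (rule Henstock_Kurzweil_Integration.integral_combine[OF s'(3) s(2) running_integrable(2)[OF t \<alpha>(1) x order_refl order_refl]])
    finally show ?thesis using cost_eq[OF t w \<alpha>(1) x] by simp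
  qed
  then show ?thesis using \<alpha> by (intro that[OF \<alpha>(1) x]) linarith
qed

text \<open>The costs of one and the same control from two histories differ by at most
  \<open>\<Lambda> * hdist w1 w2\<close>, and a bound uniform in the control passes to the
  infimum.\<close>

lemma val_lipschitz:
  assumes R: "R > 0"
  obtains \<Lambda> where "\<Lambda> > 0" "\<And>t w1 w2. t \<in> {t0..T} \<Longrightarrow> w1 \<in> W_set taubar R \<Longrightarrow> w2 \<in> W_set taubar R \<Longrightarrow>
    \<bar>val t w1 - val t w2\<bar> \<le> \<Lambda> * hdist w1 w2"
proof -
  obtain K where K: "K \<ge> R" and lipK: "\<And>t w \<alpha> x. t \<in> {t0..T} \<Longrightarrow> w \<in> W_set taubar R \<Longrightarrow> \<alpha> \<in> ctrl t \<Longrightarrow> traj t w \<alpha> x \<Longrightarrow>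
      lipschitz_on K {t - taubar..T} x \<and> (\<forall>s\<in>{t - taubar..T}. norm (x s) \<le> K)"
    by (rule traj_lipschitz_uniform[OF R]) (rule that)
  have K0: "K > 0" using K R by linarith
  obtain lg where lg: "lg > 0" "\<And>w1 w2. w1 \<in> W_set taubar K \<Longrightarrow> w2 \<in> W_set taubar K \<Longrightarrow>
    \<bar>g (w1 0, w1) - g (w2 0, w2)\<bar> \<le> lg * hdist w1 w2"
    by (rule terminal_lipschitz[OF K0]) (rule that)
  obtain lL where lL: "lL > 0" and lL': "\<forall>t\<in>{t0..T}. \<forall>a\<in>A.
         \<forall>z\<in>cball 0 K. \<forall>y\<in>cball 0 K. \<forall>z'\<in>cball 0 K. \<forall>y'\<in>cball 0 K.
           \<bar>L t z y a - L t z' y' a\<bar> \<le> lL * (norm (z - z') + norm (y - y'))"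
    using L_lip[OF K0] by blast
  obtain S where S: "S > 0" and St: "\<And>t w1 w2 \<alpha> x1 x2. t \<in> {t0..T} \<Longrightarrow> w1 \<in> W_set taubar R \<Longrightarrow> w2 \<in> W_set taubar R \<Longrightarrow> \<alpha> \<in> ctrl t \<Longrightarrow>
      traj t w1 \<alpha> x1 \<Longrightarrow> traj t w2 \<alpha> x2 \<Longrightarrow>
      (\<forall>s\<in>{t..T}. norm (x1 s - x2 s) \<le> S * hdist w1 w2) \<and>
      integral {t..T} (\<lambda>r. norm (x1 (rtime x1 r) - x2 (rtime x2 r))) \<le> S * hdist w1 w2 \<and>
      integral {t - taubar..T} (\<lambda>r. norm (x1 r - x2 r)) \<le> S * hdist w1 w2"
    by (rule traj_stability[OF R]) (rule that)
  \<comment> \<open>The first summand is for the running cost (current and delayed states), the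
    second for the terminal cost (final state and final history); the last one settles
    \<open>t = T\<close>, where the value is \<open>g\<close> itself.\<close>
  define \<Lambda> where "\<Lambda> = lL * (2 * S) + lg * (2 * S) + lg"
  have \<Lambda>0: "\<Lambda> > 0" using lL S lg(1) by (simp add: \<Lambda>_def add_pos_pos)
  have costs: "J t w1 \<alpha> \<le> J t w2 \<alpha> + \<Lambda> * hdist w1 w2"
    if t: "t \<in> {t0..T}" and w: "w1 \<in> W_set taubar R" "w2 \<in> W_set taubar R" and \<alpha>: "\<alpha> \<in> ctrl t" for t w1 w2 \<alpha>
  proof -
    have wl: "w1 \<in> lip_space {-taubar..0}" "w2 \<in> lip_space {-taubar..0}" using W_setD(4) w by blast+
    obtain x1 where x1: "traj t w1 \<alpha> x1" by (rule traj_exists[OF t wl(1) \<alpha>])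
    obtain x2 where x2: "traj t w2 \<alpha> x2" by (rule traj_exists[OF t wl(2) \<alpha>])
    have t': "t0 \<le> t" using t by simp
    define N where "N = hdist w1 w2"
    have N0: "0 \<le> N" unfolding N_def by (rule hdist_nonneg[OF w])
    define u where "u r = norm (x1 r - x2 r)" for r
    define v where "v r = norm (x1 (rtime x1 r) - x2 (rtime x2 r))" for r
    have st: "\<And>s. s \<in> {t..T} \<Longrightarrow> u s \<le> S * N" "integral {t..T} v \<le> S * N" "integral {t - taubar..T} u \<le> S * N"
      using St[OF t w \<alpha> x1 x2] unfolding u_def[abs_def] v_def[abs_def] N_def by blast+
    have cu: "continuous_on {t - taubar..T} u"
      unfolding u_def by (intro continuous_on_norm continuous_on_diff traj_cont[OF x1] traj_cont[OF x2])
    have iu: "u integrable_on {p..q}" if "t - taubar \<le> p" "q \<le> T" for p q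
      using that by (intro integrable_continuous_real continuous_on_subset[OF cu]) auto
    have iv: "v integrable_on {t..T}"
      unfolding v_def by (intro integrable_continuous_real continuous_on_norm continuous_on_diff rtime_cont(2)[OF t' x1] rtime_cont(2)[OF t' x2])
    have usub: "integral {p..q} u \<le> S * N" if "t - taubar \<le> p" "q \<le> T" for p q
    proof -
      have "integral {p..q} u \<le> integral {t - taubar..T} u"
        by (rule integral_subset_le) (use that iu in \<open>auto simp: u_def\<close>)
      then show ?thesis using st(3) by linarith
    qed
    have b1: "\<And>s. s \<in> {t - taubar..T} \<Longrightarrow> norm (x1 s) \<le> K" and b2: "\<And>s. s \<in> {t - taubar..T} \<Longrightarrow> norm (x2 s) \<le> K"
      and l1: "lipschitz_on K {t - taubar..T} x1" and l2: "lipschitz_on K {t - taubar..T} x2"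
      using lipK[OF t w(1) \<alpha> x1] lipK[OF t w(2) \<alpha> x2] by blast+
    have ir1: "running \<alpha> x1 integrable_on {t..T}" and ir2: "running \<alpha> x2 integrable_on {t..T}"
      using running_integrable(2)[OF t \<alpha> x1 order_refl order_refl] running_integrable(2)[OF t \<alpha> x2 order_refl order_refl] .
    have "norm (integral {t..T} (running \<alpha> x1) - integral {t..T} (running \<alpha> x2)) \<le> integral {t..T} (\<lambda>r. lL * (u r + v r))"
    proof (rule has_integral_norm_le_interior)
      show "((\<lambda>r. running \<alpha> x1 r - running \<alpha> x2 r) has_integral integral {t..T} (running \<alpha> x1) - integral {t..T} (running \<alpha> x2)) {t..T}"
        by (intro has_integral_diff integrable_integral ir1 ir2)
      show "(\<lambda>r. lL * (u r + v r)) integrable_on {t..T}"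
        by (intro integrable_on_mult_right integrable_add iu iv) (use taubar_nonneg in auto)
      fix r assume r: "r \<in> {t<..<T}"
      have r': "r \<in> {t0..T}" "t0 \<le> r" "r \<le> T" using r t by auto
      have m: "r \<in> {t - taubar..T}" "rtime x1 r \<in> {t - taubar..T}" "rtime x2 r \<in> {t - taubar..T}"
        using rtime_bounds[OF r'(2,3), of x1] rtime_bounds[OF r'(2,3), of x2] r taubar_nonneg by auto
      show "norm (running \<alpha> x1 r - running \<alpha> x2 r) \<le> lL * (u r + v r)"
        unfolding running_def u_def v_def real_norm_def
        by (rule lL'[rule_format, OF r'(1) ctrlD[OF \<alpha> r]]) (use b1 b2 m in auto)
    qed
    also have "\<dots> = lL * (integral {t..T} u + integral {t..T} v)"
      using Henstock_Kurzweil_Integration.integral_add[OF iu iv] taubar_nonneg by simp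
    also have "\<dots> \<le> lL * (2 * S * N)"
      using usub[of t T] st(2) lL taubar_nonneg by (intro mult_left_mono) auto
    finally have r1: "integral {t..T} (running \<alpha> x1) - integral {t..T} (running \<alpha> x2) \<le> lL * (2 * S) * N" by (simp add: mult.assoc)
    have h1: "hist taubar x1 T \<in> W_set taubar K"
      by (rule hist_W_set) (auto intro!: lipschitz_on_subset[OF l1] b1, use t in auto)
    have h2: "hist taubar x2 T \<in> W_set taubar K"
      by (rule hist_W_set) (auto intro!: lipschitz_on_subset[OF l2] b2, use t in auto)
    have tT: "t \<le> T" using t by simp
    have "hdist (hist taubar x1 T) (hist taubar x2 T) = u T + integral {-taubar..0} (\<lambda>\<theta>. u (T + \<theta>))"
    proof -
      have "integral {-taubar..0} (\<lambda>\<theta>. norm (hist taubar x1 T \<theta> - hist taubar x2 T \<theta>)) = integral {-taubar..0} (\<lambda>\<theta>. u (T + \<theta>))"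
        by (rule integral_cong) (simp add: hist_def u_def)
      then show ?thesis using hdist_eq(1)[OF h1 h2] hist_traj(2)[OF x1 tT] hist_traj(2)[OF x2 tT] by (simp add: u_def)
    qed
    also have "integral {-taubar..0} (\<lambda>\<theta>. u (T + \<theta>)) = integral {T - taubar..T} u"
      by (rule integral_shift_history[symmetric], rule continuous_on_subset[OF cu]) (use t in auto)
    also have "u T + integral {T - taubar..T} u \<le> 2 * S * N" using st(1)[of T] usub[of "T - taubar" T] tT by auto
    finally have "lg * hdist (hist taubar x1 T) (hist taubar x2 T) \<le> lg * (2 * S) * N"
      using lg(1) by (simp add: mult.assoc)
    then have r2: "g (x1 T, hist taubar x1 T) - g (x2 T, hist taubar x2 T) \<le> lg * (2 * S) * N"
      using lg(2)[OF h1 h2] hist_traj(2)[OF x1 tT] hist_traj(2)[OF x2 tT] by simp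
    have "\<Lambda> * N = lL * (2 * S) * N + lg * (2 * S) * N + lg * N" by (simp only: \<Lambda>_def distrib_right)
    moreover have "0 \<le> lg * N" using lg(1) N0 by simp
    ultimately show ?thesis
      using r1 r2 unfolding cost_eq[OF t wl(1) \<alpha> x1] cost_eq[OF t wl(2) \<alpha> x2] N_def[symmetric] by linarith
  qed
  have half: "val t w1 \<le> val t w2 + \<Lambda> * hdist w1 w2"
    if t: "t \<in> {t0..T}" and w: "w1 \<in> W_set taubar R" "w2 \<in> W_set taubar R" for t w1 w2
  proof (cases "t = T")
    case True
    have wK: "w1 \<in> W_set taubar K" "w2 \<in> W_set taubar K" using w K W_set_mono by blast+
    have "lg * hdist w1 w2 \<le> \<Lambda> * hdist w1 w2"
      using hdist_nonneg[OF w] lL S lg(1) by (intro mult_right_mono) (auto simp: \<Lambda>_def)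
    then show ?thesis using lg(2)[OF wK] True by (simp add: val_terminal)
  next
    case False
    then have tT: "t < T" using t by simp
    have wl: "w1 \<in> lip_space {-taubar..0}" "w2 \<in> lip_space {-taubar..0}" using W_setD(4) w by blast+
    show ?thesis
    proof (rule field_le_epsilon)
      fix e :: real assume "0 < e"
      then obtain \<alpha> where \<alpha>: "\<alpha> \<in> ctrl t" "J t w2 \<alpha> < val t w2 + e" using val_approx[OF t tT wl(2)] by blast
      have "val t w1 \<le> J t w1 \<alpha>" by (rule val_le_cost[OF t tT wl(1) \<alpha>(1)])
      then show "val t w1 \<le> val t w2 + \<Lambda> * hdist w1 w2 + e" using costs[OF t w \<alpha>(1)] \<alpha>(2) by linarith
    qed
  qed
  show ?thesis
  proof (rule that[OF \<Lambda>0])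
    fix t and w1 w2 :: "real \<Rightarrow> real ^ 'n" assume t: "t \<in> {t0..T}" and w: "w1 \<in> W_set taubar R" "w2 \<in> W_set taubar R"
    show "\<bar>val t w1 - val t w2\<bar> \<le> \<Lambda> * hdist w1 w2"
      using half[OF t w] half[OF t w(2) w(1)] unfolding hdist_commute[of w2 w1] by linarith
  qed
qed

text \<open>Regularity in time comes from following a trajectory from \<open>t1\<close> to
  \<open>t2\<close>: its running cost and the change of its history are both of order
  \<open>t2 - t1\<close>, and dynamic programming relates the two values. The histories on the way
  may leave \<open>W_set taubar R\<close> but stay in \<open>W_set taubar K\<close>, hence the
  Lipschitz constant of the value for \<open>K\<close>.\<close>

lemma val_in_Phi_class: "val \<in> Phi_class t0 T taubar"
  unfolding Phi_class_def
proof (intro CollectI allI impI)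
  fix R :: real assume R: "0 < R"
  obtain K where K: "K \<ge> R" and lipK: "\<And>t w \<alpha> x. t \<in> {t0..T} \<Longrightarrow> w \<in> W_set taubar R \<Longrightarrow> \<alpha> \<in> ctrl t \<Longrightarrow> traj t w \<alpha> x \<Longrightarrow>
      lipschitz_on K {t - taubar..T} x \<and> (\<forall>s\<in>{t - taubar..T}. norm (x s) \<le> K)"
    by (rule traj_lipschitz_uniform[OF R]) (rule that)
  have K0: "K > 0" using K R by linarith
  obtain \<Lambda> where \<Lambda>: "\<Lambda> > 0" and vl: "\<And>t w1 w2. t \<in> {t0..T} \<Longrightarrow> w1 \<in> W_set taubar K \<Longrightarrow> w2 \<in> W_set taubar K \<Longrightarrow>
    \<bar>val t w1 - val t w2\<bar> \<le> \<Lambda> * hdist w1 w2"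
    by (rule val_lipschitz[OF K0]) (rule that)
  define c where "c = C_L * (1 + 2 * K) + \<Lambda> * ((1 + taubar) * K)"
  have c0: "0 \<le> c" using C_L_pos K0 \<Lambda> taubar_nonneg by (simp add: c_def)
  \<comment> \<open>Being uniform in the control, this estimate serves an arbitrary control in one
    direction and nearly optimal ones in the other.\<close>
  have step: "\<bar>integral {t1..t2} (running \<alpha> x) + val t2 (hist taubar x t2) - val t2 w2\<bar> \<le> c * (t2 - t1) + \<Lambda> * hdist w1 w2"
    if t: "t1 \<in> {t0..T}" "t2 \<in> {t0..T}" "t1 \<le> t2" and w: "w1 \<in> W_set taubar R" "w2 \<in> W_set taubar R"
      and \<alpha>: "\<alpha> \<in> ctrl t1" and x: "traj t1 w1 \<alpha> x" for t1 t2 w1 w2 \<alpha> x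
  proof -
    have wK: "w1 \<in> W_set taubar K" "w2 \<in> W_set taubar K" using w K W_set_mono by blast+
    have lx: "lipschitz_on K {t1 - taubar..T} x" and bx: "\<And>s. s \<in> {t1 - taubar..T} \<Longrightarrow> norm (x s) \<le> K"
      using lipK[OF t(1) w(1) \<alpha> x] by blast+
    have hK: "hist taubar x t2 \<in> W_set taubar K"
      by (rule hist_W_set) (auto intro!: lipschitz_on_subset[OF lx] bx, use t in auto)
    have "hdist (hist taubar x t2) w1 \<le> (1 + taubar) * (K * (t2 - t1))"
    proof (rule hdist_bound[OF hK wK(1)])
      fix \<theta> assume \<theta>: "\<theta> \<in> {-taubar..0}"
      have "norm (x (t2 + \<theta>) - x (t1 + \<theta>)) \<le> K * norm ((t2 + \<theta>) - (t1 + \<theta>))"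
        by (rule lipschitz_on_normD[OF lx]) (use \<theta> t in auto)
      then show "norm (hist taubar x t2 \<theta> - w1 \<theta>) \<le> K * (t2 - t1)"
        using \<theta> t(3) traj_init[OF x \<theta>] by (simp add: hist_def)
    qed
    then have "hdist (hist taubar x t2) w2 \<le> (1 + taubar) * (K * (t2 - t1)) + hdist w1 w2"
      using hdist_triangle[OF hK wK] by linarith
    then have "\<Lambda> * hdist (hist taubar x t2) w2 \<le> \<Lambda> * ((1 + taubar) * (K * (t2 - t1)) + hdist w1 w2)"
      using \<Lambda> by simp
    moreover have "\<Lambda> * ((1 + taubar) * (K * (t2 - t1)) + hdist w1 w2) = \<Lambda> * ((1 + taubar) * K) * (t2 - t1) + \<Lambda> * hdist w1 w2"
      by (simp only: distrib_left mult.assoc)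
    moreover have "\<bar>val t2 (hist taubar x t2) - val t2 w2\<bar> \<le> \<Lambda> * hdist (hist taubar x t2) w2"
      by (rule vl[OF t(2) hK wK(2)])
    moreover have "\<bar>integral {t1..t2} (running \<alpha> x)\<bar> \<le> C_L * (1 + 2 * K) * (t2 - t1)"
      by (rule running_integral_bound[OF t(1) \<alpha> x bx]) (use t in auto)
    moreover have "c * (t2 - t1) = C_L * (1 + 2 * K) * (t2 - t1) + \<Lambda> * ((1 + taubar) * K) * (t2 - t1)"
      by (simp only: c_def distrib_right)
    ultimately show ?thesis by linarith
  qed
  have main: "\<bar>val t1 w1 - val t2 w2\<bar> \<le> c * (t2 - t1) + \<Lambda> * hdist w1 w2"
    if t: "t1 \<in> {t0..T}" "t2 \<in> {t0..T}" "t1 \<le> t2" and w: "w1 \<in> W_set taubar R" "w2 \<in> W_set taubar R" for t1 t2 w1 w2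
  proof (cases "t1 = t2")
    case True
    have wK: "w1 \<in> W_set taubar K" "w2 \<in> W_set taubar K" using w K W_set_mono by blast+
    then show ?thesis using vl[OF t(1) wK] True by simp
  next
    case False
    then have lt: "t1 < t2" "t2 \<le> T" using t by auto
    have wl: "w1 \<in> lip_space {-taubar..0}" using W_setD(4) w by blast
    obtain \<alpha> where \<alpha>: "\<alpha> \<in> ctrl t1" using ctrl_nonempty by blast
    obtain x where x: "traj t1 w1 \<alpha> x" by (rule traj_exists[OF t(1) wl \<alpha>])
    have le: "val t1 w1 \<le> val t2 w2 + (c * (t2 - t1) + \<Lambda> * hdist w1 w2)"
      using dynamic_programming_le[OF t(1) wl \<alpha> x lt] step[OF t w \<alpha> x] by linarith
    have "val t2 w2 \<le> val t1 w1 + (c * (t2 - t1) + \<Lambda> * hdist w1 w2)"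
    proof (rule field_le_epsilon)
      fix e :: real assume e: "0 < e"
      obtain \<beta> y where "\<beta> \<in> ctrl t1" "traj t1 w1 \<beta> y"
        "integral {t1..t2} (running \<beta> y) + val t2 (hist taubar y t2) \<le> val t1 w1 + e"
        by (rule dynamic_programming_ge[OF t(1) wl lt e])
      then show "val t2 w2 \<le> val t1 w1 + (c * (t2 - t1) + \<Lambda> * hdist w1 w2) + e"
        using step[OF t w, of \<beta> y] by linarith
    qed
    with le show ?thesis by linarith
  qed
  have all: "\<bar>val t1 w1 - val t2 w2\<bar> \<le> (c + \<Lambda>) * (\<bar>t1 - t2\<bar> + hdist w1 w2)"
    if t: "t1 \<in> {t0..T}" "t2 \<in> {t0..T}" and w: "w1 \<in> W_set taubar R" "w2 \<in> W_set taubar R" for t1 t2 w1 w2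
  proof -
    have "\<bar>val t1 w1 - val t2 w2\<bar> \<le> c * \<bar>t1 - t2\<bar> + \<Lambda> * hdist w1 w2"
    proof (cases "t1 \<le> t2")
      case True
      then show ?thesis using main[OF t True w] by simp
    next
      case False
      then have le: "t2 \<le> t1" by simp
      show ?thesis using main[OF t(2,1) le w(2,1)] le unfolding hdist_commute[of w2 w1] by (simp add: abs_minus_commute)
    qed
    moreover have "0 \<le> \<Lambda> * \<bar>t1 - t2\<bar>" "0 \<le> c * hdist w1 w2" using \<Lambda> c0 hdist_nonneg[OF w] by auto
    ultimately show ?thesis by (simp add: distrib_left distrib_right)
  qed
  show "\<exists>lam>0. \<forall>t1\<in>{t0..T}. \<forall>t2\<in>{t0..T}. \<forall>w1\<in>V_set taubar R. \<forall>w2\<in>V_set taubar R.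
       \<bar>val t1 w1 - val t2 w2\<bar>
         \<le> lam * (\<bar>t1 - t2\<bar> + norm (w1 0 - w2 0) + L1_norm taubar (\<lambda>\<theta>. w1 \<theta> - w2 \<theta>))"
  proof (intro exI[of _ "c + \<Lambda>"] conjI ballI)
    show "0 < c + \<Lambda>" using c0 \<Lambda> by simp
    fix t1 t2 and w1 w2 :: "real \<Rightarrow> real ^ 'n"
    assume t: "t1 \<in> {t0..T}" "t2 \<in> {t0..T}" and w: "w1 \<in> V_set taubar R" "w2 \<in> V_set taubar R"
    have "w1 \<in> W_set taubar R" "w2 \<in> W_set taubar R" using w V_set_subset_W_set[OF taubar_nonneg] by blast+
    from all[OF t this]
    show "\<bar>val t1 w1 - val t2 w2\<bar> \<le> (c + \<Lambda>) * (\<bar>t1 - t2\<bar> + norm (w1 0 - w2 0) + L1_norm taubar (\<lambda>\<theta>. w1 \<theta> - w2 \<theta>))"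
      unfolding hdist_def by (simp only: add.assoc)
  qed
qed

end

section \<open>The viscosity inequalities\<close>

lemma dist_Pair_le: "dist (a, b) (c, d) \<le> dist a c + dist b d"
  unfolding dist_Pair_Pair by (rule sqrt_sum_squares_le_sum) auto

context delay_control
begin

section \<open>Short-time estimates uniform over all controls\<close>

lemma traj_local_bounds:
  assumes t: "t \<in> {t0..T}" and w: "w \<in> lip_space {-taubar..0}"
  obtains K where "K > 0" "w \<in> W_set taubar K" "\<And>\<alpha> x. \<alpha> \<in> ctrl t \<Longrightarrow> traj t w \<alpha> x \<Longrightarrow>
      lipschitz_on K {t - taubar..T} x \<and> (\<forall>s\<in>{t - taubar..T}. norm (x s) \<le> K)"
proof -
  obtain R where R: "R > 0" and wR: "w \<in> W_set taubar R" using lip_space_W_set[OF w] by blast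
  obtain K where K: "K \<ge> R" and lipK: "\<And>t w \<alpha> x. t \<in> {t0..T} \<Longrightarrow> w \<in> W_set taubar R \<Longrightarrow> \<alpha> \<in> ctrl t \<Longrightarrow> traj t w \<alpha> x \<Longrightarrow>
      lipschitz_on K {t - taubar..T} x \<and> (\<forall>s\<in>{t - taubar..T}. norm (x s) \<le> K)"
    by (rule traj_lipschitz_uniform[OF R]) (rule that)
  show ?thesis
  proof (rule that)
    show "K > 0" using K R by linarith
    show "w \<in> W_set taubar K" by (rule W_set_mono[OF wR K])
  qed (rule lipK[OF t wR])
qed

text \<open>At the initial time both state arguments of \<open>f\<close> are bounded by
  \<open>sup_norm taubar w\<close>, so speeds are at most
  \<open>C_f * (1 + 2 * sup_norm taubar w)\<close>. During a time \<open>\<eta>\<close> this norm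
  bound grows by at most \<open>K * \<eta>\<close>, which the strict inequality for \<open>C\<close>
  absorbs.\<close>

lemma traj_in_cone:
  assumes t: "t \<in> {t0..T}" "t < T" and w: "w \<in> lip_space {-taubar..0}"
    and C: "C > C_f * (1 + 2 * sup_norm taubar w)"
  obtains \<eta> where "\<eta> > 0" "t + \<eta> \<le> T" "\<And>\<alpha> x s. \<alpha> \<in> ctrl t \<Longrightarrow> traj t w \<alpha> x \<Longrightarrow> s \<in> {t..t + \<eta>} \<Longrightarrow>
    norm (x s - w 0) \<le> C * (s - t)"
proof -
  obtain K where K: "K > 0" "w \<in> W_set taubar K" and lipK: "\<And>\<alpha> x. \<alpha> \<in> ctrl t \<Longrightarrow> traj t w \<alpha> x \<Longrightarrow>
      lipschitz_on K {t - taubar..T} x \<and> (\<forall>s\<in>{t - taubar..T}. norm (x s) \<le> K)"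
    by (rule traj_local_bounds[OF t(1) w]) (rule that)
  define S where "S = sup_norm taubar w"
  \<comment> \<open>The second entry solves \<open>C_f * (1 + 2 * (S + K * \<eta>)) = C\<close> for
    \<open>\<eta>\<close>.\<close>
  define \<eta> where "\<eta> = min (T - t) ((C - C_f * (1 + 2 * S)) / (2 * K * C_f))"
  have gap: "0 < C - C_f * (1 + 2 * S)" using C by (simp add: S_def)
  have \<eta>: "0 < \<eta>" using t gap K C_f_pos by (simp add: \<eta>_def)
  have "\<eta> \<le> (C - C_f * (1 + 2 * S)) / (2 * K * C_f)" by (simp add: \<eta>_def)
  then have "\<eta> * (2 * K * C_f) \<le> C - C_f * (1 + 2 * S)"
    using K C_f_pos by (simp add: pos_le_divide_eq)
  then have \<eta>C: "C_f * (1 + 2 * (S + K * \<eta>)) \<le> C" by (simp add: algebra_simps)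
  show ?thesis
  proof (rule that[OF \<eta>])
    show "t + \<eta> \<le> T" by (simp add: \<eta>_def)
    then have \<eta>T: "t + \<eta> \<le> T" .
    fix \<alpha> x s assume \<alpha>: "\<alpha> \<in> ctrl t" and x: "traj t w \<alpha> x" and s: "s \<in> {t..t + \<eta>}"
    have lx: "lipschitz_on K {t - taubar..T} x" using lipK[OF \<alpha> x] by blast
    have b: "norm (x r) \<le> S + K * \<eta>" if r: "r \<in> {t - taubar..s}" for r
    proof (cases "r \<le> t")
      case True
      have "norm (w (r - t)) \<le> S" unfolding S_def by (rule norm_le_sup_norm[OF w]) (use r True in auto)
      then show ?thesis using traj_init[OF x, of "r - t"] r True K \<eta> by (smt (verit) atLeastAtMost_iff mult_pos_pos add_diff_cancel_left' add.commute diff_add_cancel)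
    next
      case False
      have "norm (x r - x t) \<le> K * norm (r - t)"
        by (rule lipschitz_on_normD[OF lx]) (use r s \<eta>T False taubar_nonneg in auto)
      also have "\<dots> \<le> K * \<eta>" using r s False K by (intro mult_left_mono) auto
      finally have "norm (x r - x t) \<le> K * \<eta>" .
      moreover have "norm (x t) \<le> S"
        unfolding traj_start[OF x] S_def by (rule norm_le_sup_norm[OF w]) (use taubar_nonneg in auto)
      moreover have "norm (x r) \<le> norm (x t) + norm (x r - x t)" by (rule norm_triangle_sub)
      ultimately show ?thesis by linarith
    qed
    have "norm (x s - x t) \<le> C_f * (1 + 2 * (S + K * \<eta>)) * (s - t)"
      by (rule traj_increment_le[OF t(1) \<alpha> x order_refl _ _ b]) (use s \<eta>T in auto)
    also have "\<dots> \<le> C * (s - t)" using \<eta>C s by (intro mult_right_mono) auto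
    finally show "norm (x s - w 0) \<le> C * (s - t)" unfolding traj_start[OF x] .
  qed
qed

text \<open>Compactness of \<open>A\<close> gives uniform continuity on bounded sets of states,
  hence one \<open>d\<close> for all values of the control.\<close>

lemma continuous_data_near:
  fixes F :: "real \<Rightarrow> real ^ 'n \<Rightarrow> real ^ 'n \<Rightarrow> real ^ 'm \<Rightarrow> 'b::euclidean_space"
  assumes F: "continuous_on ({t0..T} \<times> UNIV \<times> UNIV \<times> A) (\<lambda>(t, z, y, a). F t z y a)"
    and t: "t \<in> {t0..T}" and e: "0 < e"
  obtains d where "d > 0" "\<And>r z' y' a. r \<in> {t0..T} \<Longrightarrow> norm z' \<le> K \<Longrightarrow> norm y' \<le> K \<Longrightarrow> norm z \<le> K \<Longrightarrow> norm y \<le> K \<Longrightarrow> a \<in> A \<Longrightarrow>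
    \<bar>r - t\<bar> + norm (z' - z) + norm (y' - y) < d \<Longrightarrow> norm (F r z' y' a - F t z y a) \<le> e"
proof -
  let ?Q = "{t0..T} \<times> cball (0::real^'n) K \<times> cball (0::real^'n) K \<times> A"
  have "compact ?Q" using A_compact by (intro compact_Times) auto
  moreover have "continuous_on ?Q (\<lambda>(t, z, y, a). F t z y a)" by (rule continuous_on_subset[OF F]) auto
  ultimately have "uniformly_continuous_on ?Q (\<lambda>(t, z, y, a). F t z y a)" by (rule compact_uniformly_continuous[rotated])
  then obtain d where d: "d > 0" "\<And>p q. p \<in> ?Q \<Longrightarrow> q \<in> ?Q \<Longrightarrow> dist q p < d \<Longrightarrow>
      dist ((\<lambda>(t, z, y, a). F t z y a) q) ((\<lambda>(t, z, y, a). F t z y a) p) < e"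
    using e unfolding uniformly_continuous_on_def by metis
  show ?thesis
  proof (rule that[OF d(1)])
    fix r z' y' a
    assume r: "r \<in> {t0..T}" and b: "norm z' \<le> K" "norm y' \<le> K" "norm z \<le> K" "norm y \<le> K" and a: "a \<in> A"
      and lt: "\<bar>r - t\<bar> + norm (z' - z) + norm (y' - y) < d"
    have "dist (r, z', y', a) (t, z, y, a) \<le> dist r t + (dist z' z + (dist y' y + dist a a))"
      by (intro order_trans[OF dist_Pair_le] add_left_mono order_refl)
    also have "\<dots> < d" using lt by (simp add: dist_norm)
    finally have "dist (F r z' y' a) (F t z y a) < e" using d(2)[of "(t, z, y, a)" "(r, z', y', a)"] r b a t by simp
    then show "norm (F r z' y' a - F t z y a) \<le> e" by (simp add: dist_norm)
  qed
qed

lemma traj_data_near: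
  assumes t: "t \<in> {t0..T}" "t < T" and w: "w \<in> lip_space {-taubar..0}" and d: "0 < d"
  obtains \<eta> where "\<eta> > 0" "t + \<eta> \<le> T" "\<And>\<alpha> x r. \<alpha> \<in> ctrl t \<Longrightarrow> traj t w \<alpha> x \<Longrightarrow> r \<in> {t..t + \<eta>} \<Longrightarrow>
    \<bar>r - t\<bar> + norm (x r - w 0) + norm (x (rtime x r) - w (- \<tau> t (w 0))) < d"
proof -
  obtain K where K: "K > 0" "w \<in> W_set taubar K" and lipK: "\<And>\<alpha> x. \<alpha> \<in> ctrl t \<Longrightarrow> traj t w \<alpha> x \<Longrightarrow>
      lipschitz_on K {t - taubar..T} x \<and> (\<forall>s\<in>{t - taubar..T}. norm (x s) \<le> K)"
    by (rule traj_local_bounds[OF t(1) w]) (rule that)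
  have dK: "0 < d / (4 * K)" using d K by simp
  have tw: "(t, w 0) \<in> {t0..T} \<times> UNIV" using t by simp
  obtain d1 where d1: "d1 > 0" "\<And>p. p \<in> {t0..T} \<times> UNIV \<Longrightarrow> dist p (t, w 0) < d1 \<Longrightarrow>
      dist ((\<lambda>(t, z). \<tau> t z) p) ((\<lambda>(t, z). \<tau> t z) (t, w 0)) < d / (4 * K)"
    using tau_continuous[unfolded continuous_on_iff, rule_format, OF tw dK] by blast
  \<comment> \<open>The second entry keeps \<open>(r, x r)\<close> within \<open>d1\<close> of
    \<open>(t, w 0)\<close>, so the delays differ by less than \<open>d / (4 * K)\<close> and the
    delayed states by at most \<open>K * \<eta> + d / 4\<close>; the third makes the total
    \<open>\<eta> * (1 + 2 * K) + d / 4\<close> at most \<open>d / 2\<close>.\<close>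
  define \<eta> where "\<eta> = min (T - t) (min (d1 / (2 * (1 + K))) (d / (2 * (1 + 2 * K)) / 2))"
  have \<eta>: "0 < \<eta>" using t d d1 K by (simp add: \<eta>_def)
  have "\<eta> \<le> d1 / (2 * (1 + K))" "\<eta> \<le> d / (2 * (1 + 2 * K)) / 2" by (simp_all add: \<eta>_def)
  then have \<eta>1: "\<eta> * (2 * (1 + K)) \<le> d1" and \<eta>2: "\<eta> * (4 * (1 + 2 * K)) \<le> d"
    using K by (simp_all add: pos_le_divide_eq)
  have \<eta>3: "(1 + K) * \<eta> < d1"
  proof -
    have "0 < (1 + K) * \<eta>" using K \<eta> by simp
    then show ?thesis using \<eta>1 by (simp add: algebra_simps)
  qed
  show ?thesis
  proof (rule that[OF \<eta>])
    show \<eta>T: "t + \<eta> \<le> T" by (simp add: \<eta>_def)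
    fix \<alpha> x r assume \<alpha>: "\<alpha> \<in> ctrl t" and x: "traj t w \<alpha> x" and r: "r \<in> {t..t + \<eta>}"
    have lx: "lipschitz_on K {t - taubar..T} x" using lipK[OF \<alpha> x] by blast
    have r': "r \<in> {t0..T}" "t0 \<le> r" "r \<le> T" "t \<le> r" using r t \<eta>T by auto
    have "norm (x r - x t) \<le> K * norm (r - t)"
      by (rule lipschitz_on_normD[OF lx]) (use r' t taubar_nonneg in auto)
    also have "\<dots> \<le> K * \<eta>" using r K by (intro mult_left_mono) auto
    finally have xr: "norm (x r - w 0) \<le> K * \<eta>" unfolding traj_start[OF x] .
    have "dist (r, x r) (t, w 0) \<le> dist r t + dist (x r) (w 0)" by (rule dist_Pair_le)
    also have "\<dots> \<le> \<eta> + K * \<eta>" using xr r by (intro add_mono) (auto simp: dist_norm)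
    also have "\<dots> < d1" using \<eta>3 by (simp add: distrib_right)
    finally have \<tau>d: "\<bar>\<tau> r (x r) - \<tau> t (w 0)\<bar> < d / (4 * K)"
      using d1(2)[of "(r, x r)"] r' by (simp add: dist_real_def)
    have m: "- \<tau> t (w 0) \<in> {-taubar..0}" using tau_nonneg[OF t(1)] tau_le[OF t(1)] by simp
    have "norm (x (rtime x r) - x (t + - \<tau> t (w 0))) \<le> K * norm (rtime x r - (t + - \<tau> t (w 0)))"
      by (rule lipschitz_on_normD[OF lx]) (use rtime_bounds[OF r'(2,3), of x] r' m t in auto)
    also have "\<dots> \<le> K * (\<eta> + d / (4 * K))"
    proof (intro mult_left_mono)
      show "norm (rtime x r - (t + - \<tau> t (w 0))) \<le> \<eta> + d / (4 * K)"
        using \<tau>d r unfolding rtime_def real_norm_def by auto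
    qed (use K in auto)
    also have "\<dots> = K * \<eta> + d / 4" using K by (simp add: distrib_left)
    finally have yr: "norm (x (rtime x r) - w (- \<tau> t (w 0))) \<le> K * \<eta> + d / 4" unfolding traj_init[OF x m] .
    have "\<bar>r - t\<bar> \<le> \<eta>" using r by auto
    then have "\<bar>r - t\<bar> + norm (x r - w 0) + norm (x (rtime x r) - w (- \<tau> t (w 0))) \<le> \<eta> + K * \<eta> + (K * \<eta> + d / 4)"
      using xr yr by linarith
    also have "\<dots> = \<eta> * (1 + 2 * K) + d / 4" by (simp add: algebra_simps)
    also have "\<dots> < d" using \<eta>2 d by linarith
    finally show "\<bar>r - t\<bar> + norm (x r - w 0) + norm (x (rtime x r) - w (- \<tau> t (w 0))) < d" .
  qed
qed

text \<open>The polygonal path agrees with \<open>x\<close> up to \<open>t\<close> and at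
  \<open>s\<close>, so the term at 0 in \<open>hdist\<close> vanishes and the histories differ only
  between \<open>t\<close> and \<open>s\<close>. There both paths are within
  \<open>K * (s - t)\<close> of \<open>w 0\<close>, and the integral of their distance is of order
  \<open>(s - t)\<^sup>2\<close>; a first-order error would survive the division by the
  step.\<close>

lemma projection_close:
  assumes t: "t \<in> {t0..T}" and w: "w \<in> lip_space {-taubar..0}"
  obtains \<Lambda> where "\<Lambda> > 0" "\<And>\<alpha> x s. \<alpha> \<in> ctrl t \<Longrightarrow> traj t w \<alpha> x \<Longrightarrow> t < s \<Longrightarrow> s \<le> T \<Longrightarrow>
    \<bar>val s (hist taubar x s) - projection taubar val t w s (x s)\<bar> \<le> \<Lambda> * (s - t)\<^sup>2"
proof -
  obtain K where K: "K > 0" "w \<in> W_set taubar K" and lipK: "\<And>\<alpha> x. \<alpha> \<in> ctrl t \<Longrightarrow> traj t w \<alpha> x \<Longrightarrow>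
      lipschitz_on K {t - taubar..T} x \<and> (\<forall>s\<in>{t - taubar..T}. norm (x s) \<le> K)"
    by (rule traj_local_bounds[OF t w]) (rule that)
  obtain \<Lambda> where \<Lambda>: "\<Lambda> > 0" and vl: "\<And>t w1 w2. t \<in> {t0..T} \<Longrightarrow> w1 \<in> W_set taubar K \<Longrightarrow> w2 \<in> W_set taubar K \<Longrightarrow>
    \<bar>val t w1 - val t w2\<bar> \<le> \<Lambda> * hdist w1 w2"
    by (rule val_lipschitz[OF K(1)]) (rule that)
  have pos: "0 < \<Lambda> * (2 * K)" using \<Lambda> K by simp
  show ?thesis
  proof (rule that[OF pos])
    fix \<alpha> x s assume \<alpha>: "\<alpha> \<in> ctrl t" and x: "traj t w \<alpha> x" and s: "t < s" "s \<le> T"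
    have lx: "lipschitz_on K {t - taubar..T} x" and bx: "\<And>r. r \<in> {t - taubar..T} \<Longrightarrow> norm (x r) \<le> K"
      using lipK[OF \<alpha> x] by blast+
    have x0: "x t = w 0" by (rule traj_start[OF x])
    define v where "v = polygonal_ext t w s (x s)"
    define h where "h = s - t"
    have h: "h > 0" using s by (simp add: h_def)
    have v1: "v r = x r" if "r \<in> {t - taubar..t}" for r
    proof (cases "r < t")
      case True
      then show ?thesis using traj_init[OF x, of "r - t"] that by (simp add: v_def polygonal_ext_def)
    next
      case False
      then have "r = t" using that by simp
      then show ?thesis using s by (simp add: v_def polygonal_ext_def x0)
    qed
    have v2: "v r = w 0 + ((r - t) / h) *\<^sub>R (x s - w 0)" if "r \<in> {t..s}" for r
      using that by (simp add: v_def polygonal_ext_def h_def)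
    have vs: "v s = x s" using v2[of s] s h by (simp add: h_def)
    have xs: "norm (x s - w 0) \<le> K * h"
    proof -
      have "norm (x s - x t) \<le> K * norm (s - t)"
        by (rule lipschitz_on_normD[OF lx]) (use s taubar_nonneg in auto)
      then show ?thesis using s x0 by (simp add: h_def)
    qed
    \<comment> \<open>The chord inherits slope at most \<open>K\<close> from \<open>x\<close>, so
      the polygonal history lies in the same class and the Lipschitz bound of the value applies to
      it.\<close>
    have lv: "lipschitz_on K {t - taubar..s} v"
    proof -
      have "lipschitz_on K {t - taubar..s} (\<lambda>r. if r \<le> t then x r else w 0 + ((r - t) / h) *\<^sub>R (x s - w 0))"
      proof (rule lipschitz_on_concat)
        show "lipschitz_on K {t - taubar..t} x" by (rule lipschitz_on_subset[OF lx]) (use s in auto)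
        show "x t = w 0 + ((t - t) / h) *\<^sub>R (x s - w 0)" using x0 by simp
        show "lipschitz_on K {t..s} (\<lambda>r. w 0 + ((r - t) / h) *\<^sub>R (x s - w 0))"
        proof (rule lipschitz_onI)
          fix p q
          have "(w 0 + ((p - t) / h) *\<^sub>R (x s - w 0)) - (w 0 + ((q - t) / h) *\<^sub>R (x s - w 0)) = ((p - q) / h) *\<^sub>R (x s - w 0)"
            by (simp add: scaleR_diff_left[symmetric] diff_divide_distrib[symmetric])
          then have "dist (w 0 + ((p - t) / h) *\<^sub>R (x s - w 0)) (w 0 + ((q - t) / h) *\<^sub>R (x s - w 0)) = \<bar>p - q\<bar> / h * norm (x s - w 0)"
            using h by (simp add: dist_norm)
          also have "\<dots> \<le> \<bar>p - q\<bar> / h * (K * h)" using xs h by (intro mult_left_mono) auto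
          also have "\<dots> = K * dist p q" using h by (simp add: dist_real_def)
          finally show "dist (w 0 + ((p - t) / h) *\<^sub>R (x s - w 0)) (w 0 + ((q - t) / h) *\<^sub>R (x s - w 0)) \<le> K * dist p q" .
        qed (use K in auto)
      qed
      then show ?thesis
        by (rule lipschitz_on_transform) (use v1 v2 in auto)
    qed
    have bv: "norm (v r) \<le> K" if r: "r \<in> {t - taubar..s}" for r
    proof (cases "r \<le> t")
      case True
      then show ?thesis using v1[of r] bx[of r] r s by simp
    next
      case False
      define \<theta> where "\<theta> = (r - t) / h"
      have \<theta>: "0 \<le> \<theta>" "\<theta> \<le> 1" using False r h by (auto simp: \<theta>_def h_def)
      have "v r = (1 - \<theta>) *\<^sub>R w 0 + \<theta> *\<^sub>R x s"
        using v2[of r] False r by (simp add: \<theta>_def[symmetric] algebra_simps)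
      then have "norm (v r) \<le> (1 - \<theta>) * norm (w 0) + \<theta> * norm (x s)"
        using \<theta> norm_triangle_ineq[of "(1 - \<theta>) *\<^sub>R w 0" "\<theta> *\<^sub>R x s"] by simp
      also have "\<dots> \<le> (1 - \<theta>) * K + \<theta> * K"
        using \<theta> bx[of t] bx[of s] x0 s taubar_nonneg by (intro add_mono mult_left_mono) auto
      finally show ?thesis by (simp add: algebra_simps)
    qed
    have hx: "hist taubar x s \<in> W_set taubar K"
    proof (rule hist_W_set)
      show "lipschitz_on K {s - taubar..s} x" by (rule lipschitz_on_subset[OF lx]) (use s in auto)
      show "norm (x r) \<le> K" if "r \<in> {s - taubar..s}" for r using bx[of r] that s by simp
    qed
    have hv: "hist taubar v s \<in> W_set taubar K"
    proof (rule hist_W_set)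
      show "lipschitz_on K {s - taubar..s} v" by (rule lipschitz_on_subset[OF lv]) (use s in auto)
      show "norm (v r) \<le> K" if "r \<in> {s - taubar..s}" for r using bv[of r] that s by simp
    qed
    define u where "u r = norm (x r - v r)" for r
    have u0: "u r = 0" if "r \<in> {t - taubar..t}" for r using v1[OF that] by (simp add: u_def)
    have ub: "u r \<le> 2 * K * h" if r: "r \<in> {t..s}" for r
    proof -
      have "norm (x r - x t) \<le> K * norm (r - t)"
        by (rule lipschitz_on_normD[OF lx]) (use r s taubar_nonneg in auto)
      also have "\<dots> \<le> K * h" using r K by (intro mult_left_mono) (auto simp: h_def)
      finally have a: "norm (x r - w 0) \<le> K * h" by (simp add: x0)
      have "norm (v r - v t) \<le> K * norm (r - t)"
        by (rule lipschitz_on_normD[OF lv]) (use r s taubar_nonneg in auto)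
      also have "\<dots> \<le> K * h" using r K by (intro mult_left_mono) (auto simp: h_def)
      finally have b: "norm (v r - w 0) \<le> K * h" using v1[of t] x0 taubar_nonneg by simp
      have "norm (x r - v r) \<le> norm (x r - w 0) + norm (v r - w 0)"
        using norm_triangle_ineq4[of "x r - w 0" "v r - w 0"] by simp
      then show ?thesis using a b by (simp add: u_def)
    qed
    have cu: "continuous_on {t - taubar..s} u"
      unfolding u_def
      by (intro continuous_on_norm continuous_on_diff lipschitz_on_continuous_on[OF lv]
          continuous_on_subset[OF lipschitz_on_continuous_on[OF lx]]) (use s in auto)
    have iu: "u integrable_on {p..q}" if "t - taubar \<le> p" "q \<le> s" for p q
      using that by (intro integrable_continuous_real continuous_on_subset[OF cu]) auto
    have "integral {s - taubar..s} u \<le> integral {t - taubar..s} u"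
      by (rule integral_subset_le) (use iu s in \<open>auto simp: u_def\<close>)
    also have "\<dots> = integral {t - taubar..t} u + integral {t..s} u"
      using Henstock_Kurzweil_Integration.integral_combine[of "t - taubar" t s u] iu[of "t - taubar" s] s taubar_nonneg by simp
    also have "integral {t - taubar..t} u = integral {t - taubar..t} (\<lambda>_. 0)"
      by (rule integral_cong) (rule u0)
    also have "integral {t..s} u \<le> integral {t..s} (\<lambda>_. 2 * K * h)"
      by (rule integral_le) (use iu ub taubar_nonneg in auto)
    also have "integral {t - taubar..t} (\<lambda>_. 0) + integral {t..s} (\<lambda>_. 2 * K * h) = h * (2 * K * h)"
      using s by (simp add: h_def[symmetric])
    finally have I: "integral {s - taubar..s} u \<le> h * (2 * K * h)" by simp
    have "hdist (hist taubar x s) (hist taubar v s) = integral {-taubar..0} (\<lambda>\<theta>. u (s + \<theta>))"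
    proof -
      have "integral {-taubar..0} (\<lambda>\<theta>. norm (hist taubar x s \<theta> - hist taubar v s \<theta>)) = integral {-taubar..0} (\<lambda>\<theta>. u (s + \<theta>))"
        by (rule integral_cong) (simp add: hist_def u_def)
      moreover have "hist taubar x s 0 = hist taubar v s 0" using vs taubar_nonneg by (simp add: hist_def)
      ultimately show ?thesis using hdist_eq(1)[OF hx hv] by simp
    qed
    also have "\<dots> = integral {s - taubar..s} u"
      by (rule integral_shift_history[symmetric], rule continuous_on_subset[OF cu]) (use s in auto)
    also have "\<dots> \<le> h * (2 * K * h)" by (rule I)
    finally have hd: "hdist (hist taubar x s) (hist taubar v s) \<le> h * (2 * K * h)" .
    have st: "s \<in> {t0..T}" using s t by auto
    have "\<bar>val s (hist taubar x s) - val s (hist taubar v s)\<bar> \<le> \<Lambda> * hdist (hist taubar x s) (hist taubar v s)"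
      by (rule vl[OF st hx hv])
    also have "\<dots> \<le> \<Lambda> * (h * (2 * K * h))" using hd \<Lambda> by simp
    also have "\<dots> = \<Lambda> * (2 * K) * (s - t)\<^sup>2" by (simp add: h_def power2_eq_square)
    finally show "\<bar>val s (hist taubar x s) - projection taubar val t w s (x s)\<bar> \<le> \<Lambda> * (2 * K) * (s - t)\<^sup>2"
      using s by (simp add: projection_def v_def)
  qed
qed

text \<open>All errors are collected at one step \<open>h\<close> common to all controls. The data
  are compared for every \<open>a \<in> A\<close>, so the same statement serves a constant control
  and a nearly optimal one.\<close>

lemma local_expansion:
  assumes t: "t \<in> {t0..T}" "t < T" and w: "w \<in> lip_space {-taubar..0}"
    and \<psi>: "C1_with UNIV \<psi> \<psi>t \<psi>z" and C: "C > C_f * (1 + 2 * sup_norm taubar w)"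
    and \<delta>: "0 < \<delta>" "t + \<delta> \<le> T" and e: "0 < e"
  obtains h where "0 < h" "h \<le> \<delta>" "\<And>\<alpha> x. \<alpha> \<in> ctrl t \<Longrightarrow> traj t w \<alpha> x \<Longrightarrow>
      (t + h, x (t + h)) \<in> cone_K t (t + \<delta>) (w 0) C \<and>
      \<bar>val (t + h) (hist taubar x (t + h)) - projection taubar val t w (t + h) (x (t + h))\<bar> \<le> e * h \<and>
      \<bar>\<psi> (t + h) (x (t + h)) - \<psi> t (w 0) - \<psi>t t (w 0) * h - (x (t + h) - w 0) \<bullet> \<psi>z t (w 0)\<bar> \<le> e * h \<and>
      (\<forall>r\<in>{t..t + h}. \<forall>a\<in>A.
        norm (f r (x r) (x (rtime x r)) a - f t (w 0) (w (- \<tau> t (w 0))) a) \<le> e \<and>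
        \<bar>L r (x r) (x (rtime x r)) a - L t (w 0) (w (- \<tau> t (w 0))) a\<bar> \<le> e)"
proof -
  obtain K where K: "K > 0" "w \<in> W_set taubar K" and lipK: "\<And>\<alpha> x. \<alpha> \<in> ctrl t \<Longrightarrow> traj t w \<alpha> x \<Longrightarrow>
      lipschitz_on K {t - taubar..T} x \<and> (\<forall>s\<in>{t - taubar..T}. norm (x s) \<le> K)"
    by (rule traj_local_bounds[OF t(1) w]) (rule that)
  obtain \<eta>1 where \<eta>1: "\<eta>1 > 0" "t + \<eta>1 \<le> T" and cone: "\<And>\<alpha> x s. \<alpha> \<in> ctrl t \<Longrightarrow> traj t w \<alpha> x \<Longrightarrow> s \<in> {t..t + \<eta>1} \<Longrightarrow>
    norm (x s - w 0) \<le> C * (s - t)"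
    by (rule traj_in_cone[OF t w C]) (rule that)
  define z where "z = w 0"
  define y where "y = w (- \<tau> t z)"
  obtain d1 where d1: "d1 > 0" and near_f: "\<And>r z' y' a. r \<in> {t0..T} \<Longrightarrow> norm z' \<le> K \<Longrightarrow> norm y' \<le> K \<Longrightarrow> norm z \<le> K \<Longrightarrow> norm y \<le> K \<Longrightarrow> a \<in> A \<Longrightarrow>
    \<bar>r - t\<bar> + norm (z' - z) + norm (y' - y) < d1 \<Longrightarrow> norm (f r z' y' a - f t z y a) \<le> e"
    by (rule continuous_data_near[OF f_cont t(1) e]) (rule that)
  obtain d2 where d2: "d2 > 0" and near_L: "\<And>r z' y' a. r \<in> {t0..T} \<Longrightarrow> norm z' \<le> K \<Longrightarrow> norm y' \<le> K \<Longrightarrow> norm z \<le> K \<Longrightarrow> norm y \<le> K \<Longrightarrow> a \<in> A \<Longrightarrow>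
    \<bar>r - t\<bar> + norm (z' - z) + norm (y' - y) < d2 \<Longrightarrow> norm (L r z' y' a - L t z y a) \<le> e"
    by (rule continuous_data_near[OF L_cont t(1) e]) (rule that)
  have d12: "0 < min d1 d2" using d1 d2 by simp
  obtain \<eta>2 where \<eta>2: "\<eta>2 > 0" "t + \<eta>2 \<le> T" and near: "\<And>\<alpha> x r. \<alpha> \<in> ctrl t \<Longrightarrow> traj t w \<alpha> x \<Longrightarrow> r \<in> {t..t + \<eta>2} \<Longrightarrow>
    \<bar>r - t\<bar> + norm (x r - w 0) + norm (x (rtime x r) - w (- \<tau> t (w 0))) < min d1 d2"
    by (rule traj_data_near[OF t w d12]) (rule that)
  obtain \<Lambda> where \<Lambda>: "\<Lambda> > 0" and proj: "\<And>\<alpha> x s. \<alpha> \<in> ctrl t \<Longrightarrow> traj t w \<alpha> x \<Longrightarrow> t < s \<Longrightarrow> s \<le> T \<Longrightarrow>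
    \<bar>val s (hist taubar x s) - projection taubar val t w s (x s)\<bar> \<le> \<Lambda> * (s - t)\<^sup>2"
    by (rule projection_close[OF t(1) w]) (rule that)
  have "0 \<le> sup_norm taubar w"
    using order_trans[OF norm_ge_zero norm_le_sup_norm[OF w, of 0]] taubar_nonneg by simp
  then have "0 \<le> C_f * (1 + 2 * sup_norm taubar w)" using C_f_pos by simp
  then have C0: "0 < C" using C by linarith
  have "((\<lambda>(s, y). \<psi> s y) has_derivative (\<lambda>(h, k). \<psi>t t z * h + \<psi>z t z \<bullet> k)) (at (t, z))"
    using \<psi> unfolding C1_with_def by auto
  moreover have "0 < e / (1 + C)" using e C0 by simp
  ultimately obtain d3 where d3: "d3 > 0" and der: "\<And>p. norm (p - (t, z)) < d3 \<Longrightarrow>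
      norm ((\<lambda>(s, y). \<psi> s y) p - (\<lambda>(s, y). \<psi> s y) (t, z) - (\<lambda>(h, k). \<psi>t t z * h + \<psi>z t z \<bullet> k) (p - (t, z))) \<le> e / (1 + C) * norm (p - (t, z))"
    unfolding has_derivative_at_alt by blast
  \<comment> \<open>The entry \<open>e / \<Lambda>\<close> turns the projection error
    \<open>\<Lambda> * h * h\<close> into \<open>e * h\<close>. The last entry keeps the endpoint,
    at distance at most \<open>(1 + C) * h\<close> from \<open>(t, z)\<close>, where the first-order
    expansion of \<open>\<psi>\<close> holds with tolerance \<open>e / (1 + C)\<close>.\<close>
  define h where "h = min (min \<delta> (min \<eta>1 \<eta>2)) (min (e / \<Lambda>) (d3 / (2 * (1 + C))))"
  have h: "0 < h" using \<delta> \<eta>1 \<eta>2 e \<Lambda> d3 C0 by (simp add: h_def)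
  have h\<delta>: "h \<le> \<delta>" "h \<le> \<eta>1" "h \<le> \<eta>2" "h \<le> e / \<Lambda>" "h \<le> d3 / (2 * (1 + C))" by (simp_all add: h_def)
  have h1: "\<Lambda> * h \<le> e" using h\<delta>(4) \<Lambda> by (simp add: pos_le_divide_eq mult.commute)
  have h2: "(1 + C) * h < d3"
  proof -
    have "h * (2 * (1 + C)) \<le> d3" using h\<delta>(5) C0 by (simp add: pos_le_divide_eq)
    moreover have "0 < (1 + C) * h" using C0 h by simp
    ultimately show ?thesis by (simp add: algebra_simps)
  qed
  show ?thesis
  proof (rule that[OF h h\<delta>(1)])
    fix \<alpha> x assume \<alpha>: "\<alpha> \<in> ctrl t" and x: "traj t w \<alpha> x"
    have bx: "\<And>r. r \<in> {t - taubar..T} \<Longrightarrow> norm (x r) \<le> K" using lipK[OF \<alpha> x] by blast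
    define s where "s = t + h"
    have s: "t < s" "s \<le> T" "s \<le> t + \<delta>" "s \<in> {t..t + \<eta>1}" using h h\<delta> \<delta> by (auto simp: s_def)
    have c: "norm (x s - z) \<le> C * h" using cone[OF \<alpha> x s(4)] by (simp add: z_def s_def)
    have 1: "(s, x s) \<in> cone_K t (t + \<delta>) (w 0) C"
      using c s by (simp add: cone_K_def z_def s_def)
    have 2: "\<bar>val s (hist taubar x s) - projection taubar val t w s (x s)\<bar> \<le> e * h"
    proof -
      have "\<Lambda> * (s - t)\<^sup>2 = (\<Lambda> * h) * h" by (simp add: s_def power2_eq_square)
      also have "\<dots> \<le> e * h" using h1 h by (intro mult_right_mono) auto
      finally show ?thesis using proj[OF \<alpha> x s(1,2)] by linarith
    qed
    have 3: "\<bar>\<psi> s (x s) - \<psi> t z - \<psi>t t z * h - (x s - z) \<bullet> \<psi>z t z\<bar> \<le> e * h"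
    proof -
      have p: "(s, x s) - (t, z) = (h, x s - z)" by (simp add: s_def)
      have "norm (h, x s - z) \<le> norm h + norm (x s - z)" by (rule norm_Pair_le)
      also have "\<dots> \<le> (1 + C) * h" using c h by (simp add: distrib_right)
      finally have n: "norm (h, x s - z) \<le> (1 + C) * h" .
      have "\<bar>\<psi> s (x s) - \<psi> t z - (\<psi>t t z * h + \<psi>z t z \<bullet> (x s - z))\<bar> \<le> e / (1 + C) * norm (h, x s - z)"
        using der[of "(s, x s)"] n h2 unfolding p by simp
      also have "\<dots> \<le> e / (1 + C) * ((1 + C) * h)" using n e C0 by (intro mult_left_mono) auto
      also have "\<dots> = e * h" using C0 by simp
      finally show ?thesis by (simp add: inner_commute diff_diff_eq)
    qed
    have 4: "norm (f r (x r) (x (rtime x r)) a - f t z y a) \<le> e \<and> \<bar>L r (x r) (x (rtime x r)) a - L t z y a\<bar> \<le> e"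
      if r: "r \<in> {t..s}" and a: "a \<in> A" for r a
    proof -
      have r': "r \<in> {t0..T}" "t0 \<le> r" "r \<le> T" "r \<in> {t..t + \<eta>2}" using r s t h\<delta>(3) by (auto simp: s_def)
      have m: "- \<tau> t z \<in> {-taubar..0}" using tau_nonneg[OF t(1)] tau_le[OF t(1)] by simp
      have b: "norm (x r) \<le> K" "norm (x (rtime x r)) \<le> K" "norm z \<le> K" "norm y \<le> K"
        using bx[of r] bx[of "rtime x r"] rtime_bounds[OF r'(2,3), of x] r r' taubar_nonneg
          W_setD(3)[OF K(2), of 0] W_setD(3)[OF K(2) m] by (auto simp: z_def y_def)
      have "\<bar>r - t\<bar> + norm (x r - z) + norm (x (rtime x r) - y) < min d1 d2"
        using near[OF \<alpha> x r'(4)] by (simp only: z_def y_def)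
      then show ?thesis using near_f[OF r'(1) b a] near_L[OF r'(1) b a] by simp
    qed
    show "(t + h, x (t + h)) \<in> cone_K t (t + \<delta>) (w 0) C \<and>
      \<bar>val (t + h) (hist taubar x (t + h)) - projection taubar val t w (t + h) (x (t + h))\<bar> \<le> e * h \<and>
      \<bar>\<psi> (t + h) (x (t + h)) - \<psi> t (w 0) - \<psi>t t (w 0) * h - (x (t + h) - w 0) \<bullet> \<psi>z t (w 0)\<bar> \<le> e * h \<and>
      (\<forall>r\<in>{t..t + h}. \<forall>a\<in>A.
        norm (f r (x r) (x (rtime x r)) a - f t (w 0) (w (- \<tau> t (w 0))) a) \<le> e \<and>
        \<bar>L r (x r) (x (rtime x r)) a - L t (w 0) (w (- \<tau> t (w 0))) a\<bar> \<le> e)"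
      using 1 2 3 4 unfolding s_def[symmetric] z_def[symmetric] y_def[symmetric] by blast
  qed
qed

text \<open>A constant control \<open>a\<close> moves the state by
  \<open>h *\<^sub>R f t z y a\<close> up to a small multiple of \<open>h\<close>. Dynamic
  programming and the maximum condition at its endpoint give the inequality for each
  \<open>a\<close>, and the Hamiltonian is the infimum over \<open>a\<close>.\<close>

lemma val_subsolution_inequality:
  assumes t: "t \<in> {t0..T}" "t < T" and w: "w \<in> lip_space {-taubar..0}"
    and \<psi>: "C1_with UNIV \<psi> \<psi>t \<psi>z" and C: "C > C_f * (1 + 2 * sup_norm taubar w)"
    and \<delta>: "0 < \<delta>" "t + \<delta> \<le> T"
    and max: "\<And>s x. (s, x) \<in> cone_K t (t + \<delta>) (w 0) C \<Longrightarrow>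
      projection taubar val t w s x - \<psi> s x \<le> projection taubar val t w t (w 0) - \<psi> t (w 0)"
  shows "0 \<le> \<psi>t t (w 0) + hamiltonian A f L t (w 0) (w (- \<tau> t (w 0))) (\<psi>z t (w 0))"
proof -
  define z where "z = w 0"
  define y where "y = w (- \<tau> t z)"
  define p where "p = \<psi>z t z"
  have "- \<psi>t t z \<le> f t z y a \<bullet> p + L t z y a" if a: "a \<in> A" for a
  proof (rule field_le_epsilon)
    fix e0 :: real assume e0: "0 < e0"
    \<comment> \<open>The 3 stands for the errors of the running cost, the projection and the test
      function; the velocity error is multiplied by \<open>norm p\<close>.\<close>
    define e where "e = e0 / (3 + norm p)"
    have n3: "0 < 3 + norm p" by (simp add: add_pos_nonneg)
    have e: "0 < e" and ee: "e * (3 + norm p) = e0" using e0 n3 by (simp_all add: e_def)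
    obtain h where h: "0 < h" "h \<le> \<delta>" and H: "\<And>\<alpha> x. \<alpha> \<in> ctrl t \<Longrightarrow> traj t w \<alpha> x \<Longrightarrow>
      (t + h, x (t + h)) \<in> cone_K t (t + \<delta>) (w 0) C \<and>
      \<bar>val (t + h) (hist taubar x (t + h)) - projection taubar val t w (t + h) (x (t + h))\<bar> \<le> e * h \<and>
      \<bar>\<psi> (t + h) (x (t + h)) - \<psi> t (w 0) - \<psi>t t (w 0) * h - (x (t + h) - w 0) \<bullet> \<psi>z t (w 0)\<bar> \<le> e * h \<and>
      (\<forall>r\<in>{t..t + h}. \<forall>a\<in>A.
        norm (f r (x r) (x (rtime x r)) a - f t (w 0) (w (- \<tau> t (w 0))) a) \<le> e \<and>
        \<bar>L r (x r) (x (rtime x r)) a - L t (w 0) (w (- \<tau> t (w 0))) a\<bar> \<le> e)"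
      by (rule local_expansion[OF t w \<psi> C \<delta> e]) (rule that)
    define s where "s = t + h"
    have s: "t < s" "s \<le> T" using h \<delta> by (auto simp: s_def)
    define \<alpha> where "\<alpha> = (\<lambda>_::real. a)"
    have \<alpha>: "\<alpha> \<in> ctrl t" unfolding \<alpha>_def by (rule ctrl_const[OF a])
    obtain x where x: "traj t w \<alpha> x" by (rule traj_exists[OF t(1) w \<alpha>])
    have H1: "(s, x s) \<in> cone_K t (t + \<delta>) (w 0) C"
      and H2: "\<bar>val s (hist taubar x s) - projection taubar val t w s (x s)\<bar> \<le> e * h"
      and H3: "\<bar>\<psi> s (x s) - \<psi> t z - \<psi>t t z * h - (x s - z) \<bullet> p\<bar> \<le> e * h"
      and H4: "\<And>r. r \<in> {t..s} \<Longrightarrow> norm (f r (x r) (x (rtime x r)) a - f t z y a) \<le> e \<and> \<bar>L r (x r) (x (rtime x r)) a - L t z y a\<bar> \<le> e"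
      using H[OF \<alpha> x] a unfolding s_def[symmetric] z_def[symmetric] y_def[symmetric] p_def[symmetric] by blast+
    have i1: "integral {t..s} (running \<alpha> x) \<le> h * (L t z y a + e)"
    proof -
      have "integral {t..s} (running \<alpha> x) \<le> integral {t..s} (\<lambda>_. L t z y a + e)"
      proof (rule integral_le)
        show "running \<alpha> x integrable_on {t..s}" by (rule running_integrable(2)[OF t(1) \<alpha> x order_refl s(2)])
        fix r assume "r \<in> {t..s}"
        from H4[OF this] show "running \<alpha> x r \<le> L t z y a + e" unfolding running_def \<alpha>_def by linarith
      qed auto
      also have "\<dots> = h * (L t z y a + e)" using h by (simp add: s_def)
      finally show ?thesis .
    qed
    have i2: "(x s - z) \<bullet> p \<le> h * (f t z y a \<bullet> p) + norm p * (e * h)"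
    proof -
      have ci: "((\<lambda>_. f t z y a) has_integral h *\<^sub>R f t z y a) {t..s}"
        using has_integral_const_real[of "f t z y a" t s] h by (simp add: s_def)
      have "norm ((x s - x t) - h *\<^sub>R f t z y a) \<le> integral {t..s} (\<lambda>_. e)"
      proof (rule has_integral_norm_le_interior)
        show "((\<lambda>r. f r (x r) (x (rtime x r)) (\<alpha> r) - f t z y a) has_integral (x s - x t) - h *\<^sub>R f t z y a) {t..s}"
          by (rule has_integral_diff[OF traj_has_integral[OF x order_refl less_imp_le[OF s(1)] s(2)] ci])
        show "norm (f r (x r) (x (rtime x r)) (\<alpha> r) - f t z y a) \<le> e" if "r \<in> {t<..<s}" for r
          using H4[of r] that by (simp add: \<alpha>_def)
      qed auto
      then have n: "norm ((x s - z) - h *\<^sub>R f t z y a) \<le> e * h"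
        using h traj_start[OF x] by (simp add: s_def z_def mult.commute)
      have "(x s - z) \<bullet> p = h * (f t z y a \<bullet> p) + ((x s - z) - h *\<^sub>R f t z y a) \<bullet> p"
        by (simp add: inner_diff_left)
      moreover have "((x s - z) - h *\<^sub>R f t z y a) \<bullet> p \<le> norm ((x s - z) - h *\<^sub>R f t z y a) * norm p"
        by (rule norm_cauchy_schwarz)
      moreover have "norm ((x s - z) - h *\<^sub>R f t z y a) * norm p \<le> e * h * norm p"
        by (rule mult_right_mono[OF n]) simp
      ultimately show ?thesis by (simp add: mult.commute)
    qed
    have m: "projection taubar val t w s (x s) - \<psi> s (x s) \<le> val t w - \<psi> t z"
      using max[OF H1] by (simp add: projection_def z_def)
    have "val t w \<le> integral {t..s} (running \<alpha> x) + val s (hist taubar x s)"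
      by (rule dynamic_programming_le[OF t(1) w \<alpha> x s])
    then have "0 \<le> h * (L t z y a + e) + e * h + (\<psi>t t z * h + (h * (f t z y a \<bullet> p) + norm p * (e * h)) + e * h)"
      using i1 i2 m H2 H3 by linarith
    also have "\<dots> = h * (\<psi>t t z + (f t z y a \<bullet> p + L t z y a) + e * (3 + norm p))"
      by (simp add: algebra_simps)
    finally have "0 \<le> \<psi>t t z + (f t z y a \<bullet> p + L t z y a) + e0"
      using h(1) unfolding ee by (simp add: zero_le_mult_iff)
    then show "- \<psi>t t z \<le> f t z y a \<bullet> p + L t z y a + e0" by linarith
  qed
  then have "- \<psi>t t z \<le> hamiltonian A f L t z y p"
    unfolding hamiltonian_def by (rule cINF_greatest[OF A_nonempty])
  then show ?thesis unfolding z_def[symmetric] y_def[symmetric] p_def[symmetric] by linarith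
qed

text \<open>The growth bounds make the values bounded below over \<open>A\<close>, so that the real
  infimum is a genuine lower bound.\<close>

lemma hamiltonian_le:
  assumes "t \<in> {t0..T}" "a \<in> A"
  shows "hamiltonian A f L t z y p \<le> f t z y a \<bullet> p + L t z y a"
  unfolding hamiltonian_def
proof (rule cINF_lower[OF _ assms(2)])
  show "bdd_below ((\<lambda>a. f t z y a \<bullet> p + L t z y a) ` A)"
  proof (rule bdd_belowI2)
    fix b assume b: "b \<in> A"
    have "norm (f t z y b) * norm p \<le> C_f * (1 + norm z + norm y) * norm p"
      by (rule mult_right_mono[OF f_growth[OF assms(1) b]]) simp
    moreover have "\<bar>f t z y b \<bullet> p\<bar> \<le> norm (f t z y b) * norm p" by (rule Cauchy_Schwarz_ineq2)
    ultimately show "- (C_f * (1 + norm z + norm y) * norm p) - C_L * (1 + norm z + norm y) \<le> f t z y b \<bullet> p + L t z y b"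
      using L_growth[OF assms(1) b, of z y] by linarith
  qed
qed

text \<open>Nothing is known about the values of a nearly optimal control, but at each time the
  velocity paired with \<open>p\<close> plus the running cost is at least the Hamiltonian at the
  base point, up to the continuity error. Integration preserves this lower bound.\<close>

lemma val_supersolution_inequality:
  assumes t: "t \<in> {t0..T}" "t < T" and w: "w \<in> lip_space {-taubar..0}"
    and \<psi>: "C1_with UNIV \<psi> \<psi>t \<psi>z" and C: "C > C_f * (1 + 2 * sup_norm taubar w)"
    and \<delta>: "0 < \<delta>" "t + \<delta> \<le> T"
    and min: "\<And>s x. (s, x) \<in> cone_K t (t + \<delta>) (w 0) C \<Longrightarrow>
      projection taubar val t w t (w 0) - \<psi> t (w 0) \<le> projection taubar val t w s x - \<psi> s x"
  shows "\<psi>t t (w 0) + hamiltonian A f L t (w 0) (w (- \<tau> t (w 0))) (\<psi>z t (w 0)) \<le> 0"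
proof -
  define z where "z = w 0"
  define y where "y = w (- \<tau> t z)"
  define p where "p = \<psi>z t z"
  define Hm where "Hm = hamiltonian A f L t z y p"
  have "\<psi>t t z + Hm \<le> 0"
  proof (rule field_le_epsilon)
    fix e0 :: real assume e0: "0 < e0"
    \<comment> \<open>The 4 stands for the errors of near optimality, projection, test function and
      running cost; the velocity error is multiplied by \<open>norm p\<close>.\<close>
    define e where "e = e0 / (4 + norm p)"
    have n4: "0 < 4 + norm p" by (simp add: add_pos_nonneg)
    have e: "0 < e" and ee: "e * (4 + norm p) = e0" using e0 n4 by (simp_all add: e_def)
    obtain h where h: "0 < h" "h \<le> \<delta>" and H: "\<And>\<alpha> x. \<alpha> \<in> ctrl t \<Longrightarrow> traj t w \<alpha> x \<Longrightarrow>
      (t + h, x (t + h)) \<in> cone_K t (t + \<delta>) (w 0) C \<and>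
      \<bar>val (t + h) (hist taubar x (t + h)) - projection taubar val t w (t + h) (x (t + h))\<bar> \<le> e * h \<and>
      \<bar>\<psi> (t + h) (x (t + h)) - \<psi> t (w 0) - \<psi>t t (w 0) * h - (x (t + h) - w 0) \<bullet> \<psi>z t (w 0)\<bar> \<le> e * h \<and>
      (\<forall>r\<in>{t..t + h}. \<forall>a\<in>A.
        norm (f r (x r) (x (rtime x r)) a - f t (w 0) (w (- \<tau> t (w 0))) a) \<le> e \<and>
        \<bar>L r (x r) (x (rtime x r)) a - L t (w 0) (w (- \<tau> t (w 0))) a\<bar> \<le> e)"
      by (rule local_expansion[OF t w \<psi> C \<delta> e]) (rule that)
    define s where "s = t + h"
    have s: "t < s" "s \<le> T" using h \<delta> by (auto simp: s_def)
    \<comment> \<open>The optimality gap must be small compared with \<open>h\<close>: after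
      division by \<open>h\<close> it leaves only \<open>e\<close>.\<close>
    have eh: "0 < e * h" using e h by simp
    obtain \<alpha> x where \<alpha>: "\<alpha> \<in> ctrl t" and x: "traj t w \<alpha> x"
      and opt: "integral {t..s} (running \<alpha> x) + val s (hist taubar x s) \<le> val t w + e * h"
      by (rule dynamic_programming_ge[OF t(1) w s eh])
    have H1: "(s, x s) \<in> cone_K t (t + \<delta>) (w 0) C"
      and H2: "\<bar>val s (hist taubar x s) - projection taubar val t w s (x s)\<bar> \<le> e * h"
      and H3: "\<bar>\<psi> s (x s) - \<psi> t z - \<psi>t t z * h - (x s - z) \<bullet> p\<bar> \<le> e * h"
      and H4: "\<And>r a. r \<in> {t..s} \<Longrightarrow> a \<in> A \<Longrightarrow> norm (f r (x r) (x (rtime x r)) a - f t z y a) \<le> e \<and> \<bar>L r (x r) (x (rtime x r)) a - L t z y a\<bar> \<le> e"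
      using H[OF \<alpha> x] unfolding s_def[symmetric] z_def[symmetric] y_def[symmetric] p_def[symmetric] by blast+
    have low: "h * (Hm - (1 + norm p) * e) \<le> (x s - z) \<bullet> p + integral {t..s} (running \<alpha> x)"
    proof (rule has_integral_le_AE)
      show "((\<lambda>_. Hm - (1 + norm p) * e) has_integral h * (Hm - (1 + norm p) * e)) {t..s}"
        using has_integral_const_real[of "Hm - (1 + norm p) * e" t s] h by (simp add: s_def)
      have "((\<lambda>r. f r (x r) (x (rtime x r)) (\<alpha> r) \<bullet> p) has_integral (x s - x t) \<bullet> p) {t..s}"
        using has_integral_linear[OF traj_has_integral[OF x order_refl less_imp_le[OF s(1)] s(2)] bounded_linear_inner_left[of p]]
        by (simp add: o_def)
      then have "((\<lambda>r. f r (x r) (x (rtime x r)) (\<alpha> r) \<bullet> p) has_integral (x s - z) \<bullet> p) {t..s}"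
        unfolding traj_start[OF x] z_def .
      from has_integral_add[OF this integrable_integral[OF running_integrable(2)[OF t(1) \<alpha> x order_refl s(2)]]]
      show "((\<lambda>r. f r (x r) (x (rtime x r)) (\<alpha> r) \<bullet> p + running \<alpha> x r) has_integral
          (x s - z) \<bullet> p + integral {t..s} (running \<alpha> x)) {t..s}" .
      show "AE r in lebesgue. r \<in> {t<..<s} \<longrightarrow>
          Hm - (1 + norm p) * e \<le> f r (x r) (x (rtime x r)) (\<alpha> r) \<bullet> p + running \<alpha> x r"
      proof (intro AE_I2 impI)
        fix r assume r: "r \<in> {t<..<s}"
        have a: "\<alpha> r \<in> A" using r s by (intro ctrlD[OF \<alpha>]) auto
        define v where "v = f r (x r) (x (rtime x r)) (\<alpha> r)"
        have d: "norm (v - f t z y (\<alpha> r)) \<le> e" "\<bar>running \<alpha> x r - L t z y (\<alpha> r)\<bar> \<le> e"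
          using H4[of r "\<alpha> r"] r a by (auto simp: v_def running_def)
        have "\<bar>(v - f t z y (\<alpha> r)) \<bullet> p\<bar> \<le> norm (v - f t z y (\<alpha> r)) * norm p" by (rule Cauchy_Schwarz_ineq2)
        also have "\<dots> \<le> e * norm p" by (rule mult_right_mono[OF d(1)]) simp
        finally have "\<bar>v \<bullet> p - f t z y (\<alpha> r) \<bullet> p\<bar> \<le> e * norm p" by (simp add: inner_diff_left)
        moreover have "Hm \<le> f t z y (\<alpha> r) \<bullet> p + L t z y (\<alpha> r)"
          unfolding Hm_def by (rule hamiltonian_le[OF t(1) a])
        moreover have "(1 + norm p) * e = e + e * norm p" by (simp add: algebra_simps)
        ultimately have "Hm - (1 + norm p) * e \<le> v \<bullet> p + running \<alpha> x r" using d(2) by linarith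
        then show "Hm - (1 + norm p) * e \<le> f r (x r) (x (rtime x r)) (\<alpha> r) \<bullet> p + running \<alpha> x r"
          by (simp only: v_def)
      qed
    qed
    have m: "val t w - \<psi> t z \<le> projection taubar val t w s (x s) - \<psi> s (x s)"
      using min[OF H1] by (simp add: projection_def z_def)
    have "\<psi>t t z * h + h * (Hm - (1 + norm p) * e) \<le> 3 * (e * h)"
      using opt low m H2 H3 by linarith
    moreover have "\<psi>t t z * h + h * (Hm - (1 + norm p) * e) = h * (\<psi>t t z + Hm) - h * ((1 + norm p) * e)"
      by (simp add: algebra_simps)
    moreover have "3 * (e * h) + h * ((1 + norm p) * e) = h * (e * (4 + norm p))" by (simp add: algebra_simps)
    ultimately have "h * (\<psi>t t z + Hm) \<le> h * e0" unfolding ee by linarith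
    then show "\<psi>t t z + Hm \<le> 0 + e0" using h(1) by simp
  qed
  then show ?thesis unfolding Hm_def z_def[symmetric] y_def[symmetric] p_def[symmetric] .
qed

theorem value_is_viscosity_solution:
  "viscosity_solution t0 T taubar \<tau> C_f (hamiltonian A f L) g val"
  unfolding viscosity_solution_def
proof (intro conjI ballI)
  show "viscosity_subsolution t0 T taubar \<tau> C_f (hamiltonian A f L) val"
    unfolding viscosity_subsolution_def
  proof (intro conjI allI impI val_in_Phi_class)
    fix t and w :: "real \<Rightarrow> real ^ 'n" and \<psi> \<psi>t \<psi>z C \<delta>
    assume a: "t0 \<le> t" "t < T" "w \<in> lip_space {-taubar..0}" "C1_with UNIV \<psi> \<psi>t \<psi>z"
      "C_f * (1 + 2 * sup_norm taubar w) < C" "0 < \<delta>" "t + \<delta> \<le> T"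
      and m: "\<forall>(s, x)\<in>cone_K t (t + \<delta>) (w 0) C.
        projection taubar val t w s x - \<psi> s x \<le> projection taubar val t w t (w 0) - \<psi> t (w 0)"
    have "t \<in> {t0..T}" using a by simp
    from val_subsolution_inequality[OF this a(2-7)] m
    show "0 \<le> \<psi>t t (w 0) + hamiltonian A f L t (w 0) (w (- \<tau> t (w 0))) (\<psi>z t (w 0))" by blast
  qed
  show "viscosity_supersolution t0 T taubar \<tau> C_f (hamiltonian A f L) val"
    unfolding viscosity_supersolution_def
  proof (intro conjI allI impI val_in_Phi_class)
    fix t and w :: "real \<Rightarrow> real ^ 'n" and \<psi> \<psi>t \<psi>z C \<delta>
    assume a: "t0 \<le> t" "t < T" "w \<in> lip_space {-taubar..0}" "C1_with UNIV \<psi> \<psi>t \<psi>z"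
      "C_f * (1 + 2 * sup_norm taubar w) < C" "0 < \<delta>" "t + \<delta> \<le> T"
      and m: "\<forall>(s, x)\<in>cone_K t (t + \<delta>) (w 0) C.
        projection taubar val t w t (w 0) - \<psi> t (w 0) \<le> projection taubar val t w s x - \<psi> s x"
    have "t \<in> {t0..T}" using a by simp
    from val_supersolution_inequality[OF this a(2-7)] m
    show "\<psi>t t (w 0) + hamiltonian A f L t (w 0) (w (- \<tau> t (w 0))) (\<psi>z t (w 0)) \<le> 0" by blast
  qed
qed (rule val_terminal)

end

theorem theorem3p10:
  fixes t0 T taubar lam_f C_f C_L lam_tau :: real
    and A :: "(real ^ 'm::finite) set"
    and f :: "real \<Rightarrow> real ^ 'n::finite \<Rightarrow> real ^ 'n \<Rightarrow> real ^ 'm \<Rightarrow> real ^ 'n"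
    and L :: "real \<Rightarrow> real ^ 'n \<Rightarrow> real ^ 'n \<Rightarrow> real ^ 'm \<Rightarrow> real"
    and g :: "(real ^ 'n) \<times> (real \<Rightarrow> real ^ 'n) \<Rightarrow> real"
    and \<tau> \<tau>t :: "real \<Rightarrow> real ^ 'n \<Rightarrow> real"
    and \<tau>z :: "real \<Rightarrow> real ^ 'n \<Rightarrow> real ^ 'n"
  assumes time: "t0 < T"
    and A: "A \<noteq> {}" "convex A" "compact A"
    and f_cont: "continuous_on ({t0..T} \<times> UNIV \<times> UNIV \<times> A) (\<lambda>(t, z, y, a). f t z y a)"
    and L_cont: "continuous_on ({t0..T} \<times> UNIV \<times> UNIV \<times> A) (\<lambda>(t, z, y, a). L t z y a)"
    and f_lip: "lam_f > 0"
      "\<forall>t\<in>{t0..T}. \<forall>z y z' y'. \<forall>a\<in>A.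
         norm (f t z y a - f t z' y' a) \<le> lam_f * (norm (z - z') + norm (y - y'))"
    and f_growth: "C_f > 0"
      "\<forall>t\<in>{t0..T}. \<forall>z y. \<forall>a\<in>A. norm (f t z y a) \<le> C_f * (1 + norm z + norm y)"
    and convex_epi: "\<forall>t\<in>{t0..T}. \<forall>z y. convex {(f t z y a, l) | a l. a \<in> A \<and> l \<ge> L t z y a}"
    and L_lip: "\<forall>R>0. \<exists>lam>0. \<forall>t\<in>{t0..T}. \<forall>a\<in>A.
         \<forall>z\<in>cball 0 R. \<forall>y\<in>cball 0 R. \<forall>z'\<in>cball 0 R. \<forall>y'\<in>cball 0 R.
           \<bar>L t z y a - L t z' y' a\<bar> \<le> lam * (norm (z - z') + norm (y - y'))"
    and L_growth: "C_L > 0"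
      "\<forall>t\<in>{t0..T}. \<forall>z y. \<forall>a\<in>A. \<bar>L t z y a\<bar> \<le> C_L * (1 + norm z + norm y)"
    and g_lip: "\<forall>R>0. \<exists>lam>0. \<forall>z1 w1 z2 w2.
         (z1, w1) \<in> X_space taubar \<longrightarrow> (z2, w2) \<in> X_space taubar \<longrightarrow>
         w1 \<in> P_set taubar R \<longrightarrow> w2 \<in> P_set taubar R \<longrightarrow>
           \<bar>g (z1, w1) - g (z2, w2)\<bar> \<le> lam * X_norm taubar (z1 - z2, \<lambda>\<theta>. w1 \<theta> - w2 \<theta>)"
    and tau_nonneg: "\<forall>t\<in>{t0..T}. \<forall>z. \<tau> t z \<ge> 0"
    and tau_C1: "C1_with ({t0..T} \<times> UNIV) \<tau> \<tau>t \<tau>z"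
    and tau_sup: "bdd_above ((\<lambda>(t, z). \<tau> t z) ` ({t0..T} \<times> UNIV))"
      "taubar = (SUP (t, z)\<in>{t0..T} \<times> UNIV. \<tau> t z)"
    and tau_lip: "lam_tau > 0"
      "\<forall>t\<in>{t0..T}. \<forall>z y. \<bar>\<tau> t z - \<tau> t y\<bar> \<le> lam_tau * norm (z - y)"
    and monotone_delay: "\<forall>r>0. \<exists>d>0. \<forall>t\<in>{t0..T}. \<forall>w\<in>P_set taubar r. \<forall>\<alpha>\<in>controls A t T. \<forall>x.
         is_trajectory T taubar \<tau> f t w \<alpha> x \<longrightarrow>
         (AE s in lebesgue. s \<in> {t..T} \<longrightarrow>
            1 - \<tau>t s (x s) - \<tau>z s (x s) \<bullet> vector_derivative x (at s) \<ge> d)"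
  shows "viscosity_solution t0 T taubar \<tau> C_f (hamiltonian A f L) g
           (value_functional T taubar \<tau> A f L g)"
proof -
  have tau_le: "\<tau> t z \<le> taubar" if "t \<in> {t0..T}" for t z
    unfolding tau_sup(2) using cSUP_upper[OF _ tau_sup(1), of "(t, z)"] that by simp
  interpret delay_control t0 T taubar lam_f C_f C_L lam_tau A f L g \<tau> \<tau>t \<tau>z
  proof (rule delay_control.intro)
    show "t0 < T" "A \<noteq> {}" "compact A" "lam_f > 0" "C_f > 0" "C_L > 0" "lam_tau > 0"
      "continuous_on ({t0..T} \<times> UNIV \<times> UNIV \<times> A) (\<lambda>(t, z, y, a). f t z y a)"
      "continuous_on ({t0..T} \<times> UNIV \<times> UNIV \<times> A) (\<lambda>(t, z, y, a). L t z y a)"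
      "C1_with ({t0..T} \<times> UNIV) \<tau> \<tau>t \<tau>z"
      by fact+
  qed (rule tau_le f_lip(2)[rule_format] f_growth(2)[rule_format] L_growth(2)[rule_format]
      L_lip[THEN spec, THEN mp] g_lip[THEN spec, THEN mp] tau_nonneg[rule_format] tau_lip(2)[rule_format]
      monotone_delay[THEN spec, THEN mp]; assumption)+
  show ?thesis by (rule value_is_viscosity_solution)
qed

end
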